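(* Let $E\in\mathbb{R}$. Assume $|V(x)|\le K$ for all $x\in(a,b)$, where $K+|E|>0$. Let $J$ be an interval whose length $|J|$ satisfies $$|J|\le\frac{2}{\sqrt{K+|E|}},$$ and assume that $J\cap M$ has at least two elements. Then $\mathbb{P}(B)=0$ for every measurable subset $B$ of $A(E):=\{\omega\in\Omega: E\in\sigma_p(H_\omega)\}$.
   Context: Probability space: let $I\subseteq\mathbb{Z}$ and let $\{p_n\}_{n\in I}$ be probability measures on $\mathbb{R}$ that are continuous, i.e. $p_n(\{r\})=0$ for all $r\in\mathbb{R}$. $\Omega$ denotes the completion of the product probability space $(\mathbb{R}^I,\mathcal{F},\mathbb{P})$, where $\mathbb{P}=\times_{n\in I}p_n$ and $\mathcal{F}$ is the product $\sigma$-algebra generated by cylinder sets; elements are sequences $\omega=\{\omega(n)\}_{n\in I}$, and "measurable" refers to the completed $\sigma$-algebra. Operators ($\delta$-interactions): let $-\infty\le a<b\le\infty$, let $V\in L^1_{loc}(a,b)$ be real valued, and let $M=\{x_n\}_{n\in I}\subset(a,b)$ be a discrete set of distinct points which accumulate at most at $a$ or $b$. Let $\tau f=-f''+Vf$. For $\omega\in\Omega$, the formal expression $\tau_\omega=-\frac{d^2}{dx^2}+V(x)+\sum_{n\in I}\omega(n)\delta(x-x_n)$ has maximal operator $T_\omega f=\tau f$ with domain $D(T_\omega)$ consisting of all $f\in L^2(a,b)$ such that $f,f'$ are (locally) absolutely continuous in $(a,b)\setminus M$, $-f''+Vf\in L^2(a,b)$, and $f(x_n+)=f(x_n-)$, $f'(x_n+)-f'(x_n-)=\omega(n)f(x_n)$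 for all $n\in I$. A solution of $(\tau_\omega-z)f=0$ ($z\in\mathbb{C}$) is a function $f$ with $f,f'$ (locally) absolutely continuous in $(a,b)\setminus M$, $-f''+Vf-zf=0$, satisfying the same conditions at all $x_n$. $\tau_\omega$ is regular at $a$ if $a$ is finite, $V\in L^1_{loc}[a,b)$ and $a$ is not an accumulation point of $M$; it is in the limit point case (lpc) at $a$ if for every $z\in\mathbb{C}$ there is at least one solution of $(\tau_\omega-z)f=0$ which is not square integrable near $a$; similarly at $b$. Standing assumption: at each of the endpoints $a$, $b$, $\tau_\omega$ is either regular or in the limit point case (for the operators $H_\omega$, $\omega\in\Omega$). For fixed $\theta,\gamma\in[0,\pi)$, $H_\omega$ is the selfadjoint restriction of $T_\omega$ to those $f\in D(T_\omega)$ satisfying $f(a)\cos\theta+f'(a)\sin\theta=0$ if $\tau_\omega$ is regular at $a$, and $f(b)\cos\gamma+f'(b)\sin\gamma=0$ if $\tau_\omega$ is regular at $b$ (no condition at an lpc endpoint). $\sigma_p(L)$ denotes the set of eigenvalues of $L$. *)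

theory Defs
  imports "HOL-Probability.Probability"
begin

text \<open>The library constant \<open>absolutely_continuous\<close> is about measures; this is absolute continuity
  of a function on a compact interval. The pairs \<open>(u, v)\<close> are the end points of
  non-overlapping subintervals.\<close>

definition abs_cont_on :: "real \<Rightarrow> real \<Rightarrow> (real \<Rightarrow> complex) \<Rightarrow> bool" where
  "abs_cont_on c d f \<longleftrightarrow>
     (\<forall>\<epsilon>>0. \<exists>\<delta>>0. \<forall>D :: (real \<times> real) set.
        finite D \<and> (\<forall>(u, v)\<in>D. c \<le> u \<and> u < v \<and> v \<le> d) \<and>
        pairwise (\<lambda>(u, v) (u', v'). {u<..<v} \<inter> {u'<..<v'} = {}) D \<and>
        (\<Sum>(u, v)\<in>D. v - u) < \<delta>
        \<longrightarrow> (\<Sum>(u, v)\<in>D. norm (f v - f u)) < \<epsilon>)"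

definition loc_abs_cont :: "real set \<Rightarrow> (real \<Rightarrow> complex) \<Rightarrow> bool" where
  "loc_abs_cont U f \<longleftrightarrow> (\<forall>c d. c \<le> d \<and> {c..d} \<subseteq> U \<longrightarrow> abs_cont_on c d f)"

definition L1_loc :: "real set \<Rightarrow> (real \<Rightarrow> real) \<Rightarrow> bool" where
  "L1_loc U V \<longleftrightarrow> (\<forall>c d. c \<le> d \<and> {c..d} \<subseteq> U \<longrightarrow> V absolutely_integrable_on {c..d})"

text \<open>Elements of \<open>L\<^sup>2\<close> are handled through representatives; equality of elements is almost
  everywhere equality.\<close>

definition L2_on :: "real set \<Rightarrow> (real \<Rightarrow> complex) \<Rightarrow> bool" where
  "L2_on S f \<longleftrightarrow> f \<in> borel_measurable (lebesgue_on S) \<and>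
     integrable (lebesgue_on S) (\<lambda>t. (norm (f t))\<^sup>2)"

definition point_spectrum ::
    "real set \<Rightarrow> (real \<Rightarrow> complex) set \<Rightarrow> ((real \<Rightarrow> complex) \<Rightarrow> real \<Rightarrow> complex) \<Rightarrow> complex set" where
  "point_spectrum S D L = {z. \<exists>f\<in>D.
     \<not> (AE t in lebesgue_on S. f t = 0) \<and> (AE t in lebesgue_on S. L f t = z * f t)}"

definition deriv1 :: "(real \<Rightarrow> complex) \<Rightarrow> real \<Rightarrow> complex" where
  "deriv1 f t = vector_derivative f (at t)"

text \<open>The value is meaningful only where \<open>f\<close> is twice differentiable, that is, almost everywhere
  for the functions considered below.\<close>

definition tau :: "(real \<Rightarrow> real) \<Rightarrow> (real \<Rightarrow> complex) \<Rightarrow> real \<Rightarrow> complex" where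
  "tau V f t = - deriv1 (deriv1 f) t + of_real (V t) * f t"

definition interaction_points :: "ereal \<Rightarrow> ereal \<Rightarrow> int set \<Rightarrow> (int \<Rightarrow> real) \<Rightarrow> bool" where
  "interaction_points a b I x \<longleftrightarrow> inj_on x I \<and> x ` I \<subseteq> einterval a b \<and>
     (\<forall>c\<in>einterval a b. \<not> c islimpt (x ` I))"

definition regular_off_points ::
    "ereal \<Rightarrow> ereal \<Rightarrow> int set \<Rightarrow> (int \<Rightarrow> real) \<Rightarrow> (real \<Rightarrow> complex) \<Rightarrow> bool" where
  "regular_off_points a b I x f \<longleftrightarrow>
     (\<forall>t \<in> einterval a b - x ` I. f differentiable (at t)) \<and>
     loc_abs_cont (einterval a b - x ` I) f \<and> loc_abs_cont (einterval a b - x ` I) (deriv1 f)"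

text \<open>The conditions \<open>f(x\<^sub>n+) = f(x\<^sub>n-)\<close> and
  \<open>f'(x\<^sub>n+) - f'(x\<^sub>n-) = \<omega>(n) f(x\<^sub>n)\<close>; the representative \<open>f\<close> takes the common value
  of its one-sided limits at \<open>x\<^sub>n\<close>.\<close>

definition jump_conditions ::
    "int set \<Rightarrow> (int \<Rightarrow> real) \<Rightarrow> (int \<Rightarrow> real) \<Rightarrow> (real \<Rightarrow> complex) \<Rightarrow> bool" where
  "jump_conditions I x \<omega> f \<longleftrightarrow> (\<forall>n\<in>I.
     (f \<longlongrightarrow> f (x n)) (at_left (x n)) \<and> (f \<longlongrightarrow> f (x n)) (at_right (x n)) \<and>
     (\<exists>l r. (deriv1 f \<longlongrightarrow> l) (at_left (x n)) \<and> (deriv1 f \<longlongrightarrow> r) (at_right (x n)) \<and>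
            r - l = of_real (\<omega> n) * f (x n)))"

definition T_domain ::
    "ereal \<Rightarrow> ereal \<Rightarrow> (real \<Rightarrow> real) \<Rightarrow> int set \<Rightarrow> (int \<Rightarrow> real) \<Rightarrow> (int \<Rightarrow> real) \<Rightarrow>
     (real \<Rightarrow> complex) set" where
  "T_domain a b V I x \<omega> = {f. L2_on (einterval a b) f \<and> regular_off_points a b I x f \<and>
     L2_on (einterval a b) (tau V f) \<and> jump_conditions I x \<omega> f}"

definition is_solution ::
    "ereal \<Rightarrow> ereal \<Rightarrow> (real \<Rightarrow> real) \<Rightarrow> int set \<Rightarrow> (int \<Rightarrow> real) \<Rightarrow> (int \<Rightarrow> real) \<Rightarrow>
     complex \<Rightarrow> (real \<Rightarrow> complex) \<Rightarrow> bool" where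
  "is_solution a b V I x \<omega> z f \<longleftrightarrow> regular_off_points a b I x f \<and>
     (AE t in lebesgue_on (einterval a b). tau V f t - z * f t = 0) \<and> jump_conditions I x \<omega> f"

definition regular_left ::
    "ereal \<Rightarrow> ereal \<Rightarrow> (real \<Rightarrow> real) \<Rightarrow> int set \<Rightarrow> (int \<Rightarrow> real) \<Rightarrow> bool" where
  "regular_left a b V I x \<longleftrightarrow> (\<exists>r. a = ereal r \<and>
     L1_loc {t. a \<le> ereal t \<and> ereal t < b} V \<and> \<not> r islimpt (x ` I))"

definition regular_right ::
    "ereal \<Rightarrow> ereal \<Rightarrow> (real \<Rightarrow> real) \<Rightarrow> int set \<Rightarrow> (int \<Rightarrow> real) \<Rightarrow> bool" where
  "regular_right a b V I x \<longleftrightarrow> (\<exists>r. b = ereal r \<and>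
     L1_loc {t. a < ereal t \<and> ereal t \<le> b} V \<and> \<not> r islimpt (x ` I))"

definition lpc_left ::
    "ereal \<Rightarrow> ereal \<Rightarrow> (real \<Rightarrow> real) \<Rightarrow> int set \<Rightarrow> (int \<Rightarrow> real) \<Rightarrow> (int \<Rightarrow> real) \<Rightarrow> bool" where
  "lpc_left a b V I x \<omega> \<longleftrightarrow> (\<forall>z. \<exists>f. is_solution a b V I x \<omega> z f \<and>
     \<not> (\<exists>c\<in>einterval a b. L2_on (einterval a (ereal c)) f))"

definition lpc_right ::
    "ereal \<Rightarrow> ereal \<Rightarrow> (real \<Rightarrow> real) \<Rightarrow> int set \<Rightarrow> (int \<Rightarrow> real) \<Rightarrow> (int \<Rightarrow> real) \<Rightarrow> bool" where
  "lpc_right a b V I x \<omega> \<longleftrightarrow> (\<forall>z. \<exists>f. is_solution a b V I x \<omega> z f \<and>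
     \<not> (\<exists>c\<in>einterval a b. L2_on (einterval (ereal c) b) f))"

text \<open>At a regular end point \<open>f\<close> and \<open>f'\<close> have one-sided limits, which are the values
  \<open>f(a)\<close>, \<open>f'(a)\<close> occurring in the boundary condition.\<close>

definition bc_left :: "ereal \<Rightarrow> real \<Rightarrow> (real \<Rightarrow> complex) \<Rightarrow> bool" where
  "bc_left a \<theta> f \<longleftrightarrow> (\<exists>u v.
     (f \<longlongrightarrow> u) (at_right (real_of_ereal a)) \<and> (deriv1 f \<longlongrightarrow> v) (at_right (real_of_ereal a)) \<and>
     u * of_real (cos \<theta>) + v * of_real (sin \<theta>) = 0)"

definition bc_right :: "ereal \<Rightarrow> real \<Rightarrow> (real \<Rightarrow> complex) \<Rightarrow> bool" where
  "bc_right b \<gamma> f \<longleftrightarrow> (\<exists>u v.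
     (f \<longlongrightarrow> u) (at_left (real_of_ereal b)) \<and> (deriv1 f \<longlongrightarrow> v) (at_left (real_of_ereal b)) \<and>
     u * of_real (cos \<gamma>) + v * of_real (sin \<gamma>) = 0)"

definition H_domain ::
    "ereal \<Rightarrow> ereal \<Rightarrow> (real \<Rightarrow> real) \<Rightarrow> int set \<Rightarrow> (int \<Rightarrow> real) \<Rightarrow> real \<Rightarrow> real \<Rightarrow> (int \<Rightarrow> real) \<Rightarrow>
     (real \<Rightarrow> complex) set" where
  "H_domain a b V I x \<theta> \<gamma> \<omega> = {f \<in> T_domain a b V I x \<omega>.
     (regular_left a b V I x \<longrightarrow> bc_left a \<theta> f) \<and>
     (regular_right a b V I x \<longrightarrow> bc_right b \<gamma> f)}"

definition sigma_p ::
    "ereal \<Rightarrow> ereal \<Rightarrow> (real \<Rightarrow> real) \<Rightarrow> int set \<Rightarrow> (int \<Rightarrow> real) \<Rightarrow> real \<Rightarrow> real \<Rightarrow> (int \<Rightarrow> real) \<Rightarrow>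
     complex set" where
  "sigma_p a b V I x \<theta> \<gamma> \<omega> =
     point_spectrum (einterval a b) (H_domain a b V I x \<theta> \<gamma> \<omega>) (tau V)"

definition continuous_prob :: "real measure \<Rightarrow> bool" where
  "continuous_prob q \<longleftrightarrow> prob_space q \<and> sets q = sets borel \<and> (\<forall>r. emeasure q {r} = 0)"

definition Omega :: "int set \<Rightarrow> (int \<Rightarrow> real measure) \<Rightarrow> (int \<Rightarrow> real) measure" where
  "Omega I p = completion (Pi\<^sub>M I p)"

end

theory Submission
  imports Defs
begin

text \<open>Let \<open>Q = K + \<bar>E\<bar>\<close> and let \<open>s < t\<close> be two adjacent interaction points inside \<open>J\<close>. Fix all coupling
constants except the strengths \<open>\<alpha>\<close> at \<open>s\<close> and \<open>\<beta>\<close> at \<open>t\<close>. The claim behind the theorem is that, apart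
from one exceptional \<open>\<alpha>\<close>, at most one \<open>\<beta>\<close> makes \<open>E\<close> an eigenvalue
(\<open>eigenvalue_section\<close>). As the laws of \<open>\<alpha>\<close> and \<open>\<beta>\<close> have no atoms, Fubini's theorem then gives every
measurable set of such configurations probability zero (\<open>PiM_null_by_two_coordinates\<close>).

For the claim, compare eigenfunctions \<open>f\<close>, \<open>g\<close> belonging to \<open>(\<alpha>, \<beta>)\<close> and \<open>(\<alpha>', \<beta>')\<close> by means of
their Wronskian. It is constant wherever the two configurations agree and jumps by
\<open>(\<alpha>' - \<alpha>) f(s) g(s)\<close> at \<open>s\<close> and by \<open>(\<beta>' - \<beta>) f(t) g(t)\<close> at \<open>t\<close>. It vanishes to the left of
\<open>s\<close> and to the right of \<open>t\<close>: at a regular end point by the common boundary condition, and in the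
limit point case because otherwise every solution would be a combination of the two square integrable
functions \<open>f\<close> and \<open>g\<close>. Therefore
  \<open>(\<alpha>' - \<alpha>) f(s) g(s) + (\<beta>' - \<beta>) f(t) g(t) = 0\<close>.
If \<open>f(t) = g(t) = 0\<close>, then \<open>f(s)\<close> and \<open>g(s)\<close> are nonzero by the next paragraph, so \<open>\<alpha> = \<alpha>'\<close>: eigenfunctions vanishing at
\<open>t\<close> occur for at most one \<open>\<alpha>\<close>. If that \<open>\<alpha>\<close> is avoided and \<open>\<alpha> = \<alpha>'\<close>, then \<open>\<beta> = \<beta>'\<close>.

The length of \<open>J\<close> enters through a Lyapunov inequality (\<open>no_two_zeros\<close>): as \<open>Q ((t - s) / 2)\<^sup>2 \<le> 1\<close>, a
solution vanishing at both \<open>s\<close> and \<open>t\<close> vanishes between them, hence everywhere by unique continuation.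

All this is done with absolutely continuous derivatives and an equation that holds only almost
everywhere. Two facts about such functions are needed: they are differentiable almost everywhere,
by Vitali's covering theorem (\<open>abs_cont_on_differentiable_AE\<close>), and an almost everywhere bound on the derivative bounds the
increments, by Cousin's lemma (\<open>abs_cont_on_increment_le\<close>). The first is indispensable because
\<open>vector_derivative\<close> has an arbitrary value at points of non-differentiability, where an
equation for it carries no information.\<close>

section \<open>Absolutely continuous functions\<close>

definition nonoverlapping :: "real \<Rightarrow> real \<Rightarrow> (real \<times> real) set \<Rightarrow> bool" where
  "nonoverlapping c d D \<longleftrightarrow> finite D \<and> (\<forall>(u, v)\<in>D. c \<le> u \<and> u < v \<and> v \<le> d) \<and>
     pairwise (\<lambda>(u, v) (u', v'). {u<..<v} \<inter> {u'<..<v'} = {}) D"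

lemma abs_cont_on_altdef:
  "abs_cont_on c d f \<longleftrightarrow> (\<forall>\<epsilon>>0. \<exists>\<delta>>0. \<forall>D. nonoverlapping c d D \<and> (\<Sum>(u, v)\<in>D. v - u) < \<delta>
     \<longrightarrow> (\<Sum>(u, v)\<in>D. norm (f v - f u)) < \<epsilon>)"
  by (simp add: abs_cont_on_def nonoverlapping_def conj_assoc)

text \<open>Families indexed by an arbitrary set, with degenerate intervals allowed, fit the partitions used below better than
sets of pairs.\<close>

lemma abs_cont_on_family:
  assumes f: "abs_cont_on c d f" and "\<epsilon> > 0"
  shows "\<exists>\<delta>>0. \<forall>(A::'i set) l r. finite A \<and> (\<forall>i\<in>A. c \<le> l i \<and> l i \<le> r i \<and> r i \<le> d) \<and>
      disjoint_family_on (\<lambda>i. {l i<..<r i}) A \<and> (\<Sum>i\<in>A. r i - l i) < \<delta> \<longrightarrow>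
      (\<Sum>i\<in>A. norm (f (r i) - f (l i))) < \<epsilon>"
proof -
  from f \<open>\<epsilon> > 0\<close> obtain \<delta> where \<delta>: "\<delta> > 0" and *: "\<And>D. \<lbrakk>nonoverlapping c d D; (\<Sum>(u, v)\<in>D. v - u) < \<delta>\<rbrakk>
      \<Longrightarrow> (\<Sum>(u, v)\<in>D. norm (f v - f u)) < \<epsilon>"
    unfolding abs_cont_on_altdef by metis
  have "(\<Sum>i\<in>A. norm (f (r i) - f (l i))) < \<epsilon>"
    if A: "finite A" "\<And>i. i \<in> A \<Longrightarrow> c \<le> l i \<and> l i \<le> r i \<and> r i \<le> d"
      and disj: "disjoint_family_on (\<lambda>i. {l i<..<r i}) A"
      and len: "(\<Sum>i\<in>A. r i - l i) < \<delta>" for A :: "'i set" and l r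
  proof -
    \<comment> \<open>degenerate intervals contribute to neither sum\<close>
    define A' where "A' = {i \<in> A. l i < r i}"
    let ?p = "\<lambda>i. (l i, r i)"
    have inj: "inj_on ?p A'"
    proof (rule inj_onI, rule ccontr)
      fix i j assume ij: "i \<in> A'" "j \<in> A'" "?p i = ?p j" "i \<noteq> j"
      then have "(l i + r i) / 2 \<in> {l i<..<r i} \<inter> {l j<..<r j}" by (auto simp: A'_def field_simps)
      moreover have "{l i<..<r i} \<inter> {l j<..<r j} = {}"
        using disjoint_family_onD[OF disj, of i j] ij unfolding A'_def by blast
      ultimately show False by blast
    qed
    have sums: "(\<Sum>i\<in>A. g i) = (\<Sum>i\<in>A'. g i)" if "\<And>i. i \<in> A \<Longrightarrow> r i = l i \<Longrightarrow> g i = 0" for g :: "'i \<Rightarrow> real"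
      using A that by (intro sum.mono_neutral_right) (auto simp: A'_def less_le)
    have "(\<Sum>(u, v)\<in>?p ` A'. norm (f v - f u)) < \<epsilon>"
    proof (rule *, unfold nonoverlapping_def, intro conjI)
      show "finite (?p ` A')" using A by (simp add: A'_def)
      show "\<forall>(u, v)\<in>?p ` A'. c \<le> u \<and> u < v \<and> v \<le> d"
        using A by (auto simp: A'_def)
      show "pairwise (\<lambda>(u, v) (u', v'). {u<..<v} \<inter> {u'<..<v'} = {}) (?p ` A')"
        unfolding pairwise_def
      proof (clarsimp simp del: greaterThanLessThan_iff Int_greaterThanLessThan)
        fix i j assume ij: "i \<in> A'" "j \<in> A'" "l i = l j \<longrightarrow> r i \<noteq> r j"
        have "i \<noteq> j" "i \<in> A" "j \<in> A" using ij by (auto simp: A'_def)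
        then show "{l i<..<r i} \<inter> {l j<..<r j} = {}"
          by (rule disjoint_family_onD[OF disj, rotated 2])
      qed
      show "(\<Sum>(u, v)\<in>?p ` A'. v - u) < \<delta>"
        using len sums[of "\<lambda>i. r i - l i"] inj by (simp add: sum.reindex case_prod_beta)
    qed
    then show ?thesis
      using sums[of "\<lambda>i. norm (f (r i) - f (l i))"] inj by (simp add: sum.reindex case_prod_beta)
  qed
  then show ?thesis
    using \<delta> by (intro exI[of _ \<delta>] conjI allI impI; (elim conjE)?) simp_all
qed

lemma abs_cont_on_imp_continuous_on:
  assumes "abs_cont_on c d f"
  shows "continuous_on {c..d} f"
  unfolding continuous_on_iff
proof (intro ballI allI impI)
  fix t e :: real assume t: "t \<in> {c..d}" and "e > 0"
  obtain \<delta> where "\<delta> > 0" and *: "\<forall>(A::unit set) l r. finite A \<and> (\<forall>i\<in>A. c \<le> l i \<and> l i \<le> r i \<and> r i \<le> d) \<and>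
      disjoint_family_on (\<lambda>i. {l i<..<r i}) A \<and> (\<Sum>i\<in>A. r i - l i) < \<delta> \<longrightarrow>
      (\<Sum>i\<in>A. norm (f (r i) - f (l i))) < e"
    using abs_cont_on_family[OF assms \<open>e > 0\<close>, where 'i=unit] by blast
  have one: "dist (f v) (f u) < e" if "c \<le> u" "u \<le> v" "v \<le> d" "v - u < \<delta>" for u v
    using *[rule_format, of "UNIV" "\<lambda>_. u" "\<lambda>_. v"] that by (simp add: dist_norm disjoint_family_on_def)
  show "\<exists>\<delta>>0. \<forall>s\<in>{c..d}. dist s t < \<delta> \<longrightarrow> dist (f s) (f t) < e"
  proof (intro exI conjI ballI impI)
    fix s assume "s \<in> {c..d}" "dist s t < \<delta>"
    then show "dist (f s) (f t) < e"
      using one[of s t] one[of t s] t by (cases "s \<le> t") (auto simp: dist_real_def dist_commute)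
  qed fact
qed

text \<open>The one closure property from which the others follow: products, differences, real and imaginary parts all have
increments controlled by those of their constituents.\<close>

lemma abs_cont_on_dominated:
  assumes f: "abs_cont_on c d f" and g: "abs_cont_on c d g"
    and le: "\<And>u v. \<lbrakk>c \<le> u; u \<le> v; v \<le> d\<rbrakk> \<Longrightarrow> norm (k v - k u) \<le> B * (norm (f v - f u) + norm (g v - g u))"
  shows "abs_cont_on c d k"
  unfolding abs_cont_on_altdef
proof (intro allI impI)
  fix \<epsilon> :: real assume "\<epsilon> > 0"
  define C where "C = \<bar>B\<bar> + 1"
  have "C > 0" "B \<le> C" by (auto simp: C_def)
  have \<epsilon>': "\<epsilon> / (2 * C) > 0" using \<open>\<epsilon> > 0\<close> \<open>C > 0\<close> by simp
  let ?Q = "\<lambda>D \<delta>. nonoverlapping c d D \<and> (\<Sum>(u, v)\<in>D. v - u) < \<delta>"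
  obtain \<delta>1 where 1: "\<delta>1 > 0" "\<And>D. ?Q D \<delta>1 \<Longrightarrow> (\<Sum>(u, v)\<in>D. norm (f v - f u)) < \<epsilon> / (2 * C)"
    using f[unfolded abs_cont_on_altdef, rule_format, OF \<epsilon>'] by metis
  obtain \<delta>2 where 2: "\<delta>2 > 0" "\<And>D. ?Q D \<delta>2 \<Longrightarrow> (\<Sum>(u, v)\<in>D. norm (g v - g u)) < \<epsilon> / (2 * C)"
    using g[unfolded abs_cont_on_altdef, rule_format, OF \<epsilon>'] by metis
  have "(\<Sum>(u, v)\<in>D. norm (k v - k u)) < \<epsilon>" if D: "?Q D (min \<delta>1 \<delta>2)" for D
  proof -
    have "(\<Sum>(u, v)\<in>D. norm (k v - k u)) \<le> (\<Sum>(u, v)\<in>D. C * (norm (f v - f u) + norm (g v - g u)))"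
    proof (rule sum_mono, clarify)
      fix u v assume "(u, v) \<in> D"
      then have "c \<le> u" "u \<le> v" "v \<le> d" using D by (force simp: nonoverlapping_def)+
      from le[OF this] \<open>B \<le> C\<close> show "norm (k v - k u) \<le> C * (norm (f v - f u) + norm (g v - g u))"
        by (rule order_trans[OF _ mult_right_mono]) auto
    qed
    also have "\<dots> = C * ((\<Sum>(u, v)\<in>D. norm (f v - f u)) + (\<Sum>(u, v)\<in>D. norm (g v - g u)))"
      by (simp add: sum_distrib_left sum.distrib case_prod_beta distrib_left)
    also have "\<dots> < C * (\<epsilon> / (2 * C) + \<epsilon> / (2 * C))"
      using \<open>C > 0\<close> 1(2)[of D] 2(2)[of D] D by (intro mult_strict_left_mono add_strict_mono) auto
    also have "\<dots> = \<epsilon>" using \<open>C > 0\<close> by (simp add: field_simps)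
    finally show ?thesis .
  qed
  then show "\<exists>\<delta>>0. \<forall>D. ?Q D \<delta> \<longrightarrow> (\<Sum>(u, v)\<in>D. norm (k v - k u)) < \<epsilon>"
    using 1(1) 2(1) by (intro exI[of _ "min \<delta>1 \<delta>2"]) auto
qed

lemma abs_cont_on_Re: "abs_cont_on c d f \<Longrightarrow> abs_cont_on c d (\<lambda>t. of_real (Re (f t)))"
  by (rule abs_cont_on_dominated[where f=f and g=f and B=1])
     (auto simp flip: minus_complex.sel of_real_diff intro: order_trans[OF abs_Re_le_cmod])

lemma abs_cont_on_Im: "abs_cont_on c d f \<Longrightarrow> abs_cont_on c d (\<lambda>t. of_real (Im (f t)))"
  by (rule abs_cont_on_dominated[where f=f and g=f and B=1])
     (auto simp flip: minus_complex.sel of_real_diff intro: order_trans[OF abs_Im_le_cmod])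

lemma abs_cont_on_diff: "abs_cont_on c d f \<Longrightarrow> abs_cont_on c d g \<Longrightarrow> abs_cont_on c d (\<lambda>t. f t - g t)"
  by (rule abs_cont_on_dominated[where f=f and g=g and B=1])
     (auto simp: algebra_simps intro: order_trans[OF _ norm_triangle_ineq4])

lemma abs_cont_on_mult:
  assumes f: "abs_cont_on c d f" and g: "abs_cont_on c d g"
  shows "abs_cont_on c d (\<lambda>t. f t * g t)"
proof -
  have "bounded (f ` {c..d})" "bounded (g ` {c..d})"
    using f g by (auto intro!: compact_imp_bounded compact_continuous_image abs_cont_on_imp_continuous_on)
  then obtain B1 B2 where B: "\<And>t. t \<in> {c..d} \<Longrightarrow> norm (f t) \<le> B1" "\<And>t. t \<in> {c..d} \<Longrightarrow> norm (g t) \<le> B2"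
    unfolding bounded_iff by fast
  show ?thesis
  proof (rule abs_cont_on_dominated[OF f g, where B="max B1 B2"])
    fix u v assume uv: "c \<le> u" "u \<le> v" "v \<le> d"
    have "f v * g v - f u * g u = (f v - f u) * g v + f u * (g v - g u)" by (simp add: algebra_simps)
    then have "norm (f v * g v - f u * g u) \<le> norm (f v - f u) * norm (g v) + norm (f u) * norm (g v - g u)"
      by (metis norm_mult norm_triangle_ineq)
    also have "\<dots> \<le> norm (f v - f u) * max B1 B2 + max B1 B2 * norm (g v - g u)"
      using B(1)[of u] B(2)[of v] uv by (intro add_mono mult_left_mono mult_right_mono) auto
    finally show "norm (f v * g v - f u * g u) \<le> max B1 B2 * (norm (f v - f u) + norm (g v - g u))"
      by (simp add: algebra_simps)
  qed
qed

section \<open>Increments bounded by the derivative\<close>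

lemma negligible_open_cover:
  fixes N :: "real set"
  assumes "negligible N" "e > 0"
  obtains U where "open U" "N \<subseteq> U" "U \<in> lmeasurable" "measure lebesgue U < e"
proof -
  have N: "N \<in> sets lebesgue" "N \<in> null_sets lebesgue"
    using assms(1) negligible_iff_null_sets negligible_imp_sets by auto
  obtain U where U: "open U" "N \<subseteq> U" "U - N \<in> lmeasurable" "emeasure lebesgue (U - N) < ennreal e"
    using sets_lebesgue_outer_open[OF N(1) assms(2)] by blast
  have Um: "U \<in> sets lebesgue" using U(1) by auto
  have "emeasure lebesgue U = emeasure lebesgue (U - N)"
    using emeasure_Diff_null_set[OF N(2) Um] by simp
  then have *: "emeasure lebesgue U < ennreal e" using U by simp
  moreover have "U \<in> lmeasurable" using * Um by (metis ennreal_less_top fmeasurableI infinity_ennreal_def order.strict_trans)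
  moreover have "measure lebesgue U < e"
    using * assms(2) calculation(2) by (simp add: emeasure_eq_measure2 ennreal_less_iff)
  ultimately show thesis using that U by blast
qed

text \<open>Cousin's lemma takes the place of integration. Over a partition that is fine for a suitable gauge, the tags
outside \<open>N\<close> contribute at most \<open>L + \<epsilon>\<close> times the total length, by the definition of the derivative; the intervals tagged in
\<open>N\<close> lie in an open set of small measure, and there absolute continuity makes the increments small. With \<open>L = 0\<close>
this says that a vanishing derivative forces constancy.\<close>

lemma abs_cont_on_increment_le:
  assumes "c \<le> d" and f: "abs_cont_on c d f" and N: "negligible N"
    and deriv: "\<And>t. t \<in> {c..d} - N \<Longrightarrow> (f has_vector_derivative f' t) (at t) \<and> norm (f' t) \<le> L"
    and "L \<ge> 0"
  shows "norm (f d - f c) \<le> L * (d - c)"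
proof (rule field_le_epsilon)
  fix e0 :: real assume "e0 > 0"
  \<comment> \<open>the good tags cost \<open>e\<close> per unit of length, the bad ones at most \<open>e\<close> altogether\<close>
  define e where "e = e0 / (d - c + 1)"
  have "e > 0" using \<open>e0 > 0\<close> \<open>c \<le> d\<close> by (simp add: e_def)
  obtain \<delta> where "\<delta> > 0" and \<delta>: "\<forall>(A::(real \<times> real set) set) l r. finite A \<and> (\<forall>i\<in>A. c \<le> l i \<and> l i \<le> r i \<and> r i \<le> d) \<and>
      disjoint_family_on (\<lambda>i. {l i<..<r i}) A \<and> (\<Sum>i\<in>A. r i - l i) < \<delta> \<longrightarrow>
      (\<Sum>i\<in>A. norm (f (r i) - f (l i))) < e"
    using abs_cont_on_family[OF f \<open>e > 0\<close>] by blast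
  obtain U where U: "open U" "N \<subseteq> U" "U \<in> lmeasurable" "measure lebesgue U < \<delta>"
    using negligible_open_cover[OF N \<open>\<delta> > 0\<close>] .
  have "\<exists>h>0. \<forall>s. \<bar>s - t\<bar> < h \<longrightarrow> norm (f s - f t) \<le> (L + e / 2) * \<bar>s - t\<bar>" if t: "t \<in> {c..d} - N" for t
  proof -
    have "(f has_vector_derivative f' t) (at t)" and le: "norm (f' t) \<le> L" using deriv[OF t] by auto
    then have "(f has_derivative (\<lambda>x. x *\<^sub>R f' t)) (at t within UNIV)"
      by (simp add: has_vector_derivative_def)
    then obtain h where h: "h > 0" "\<And>s. norm (s - t) < h \<Longrightarrow>
        norm (f s - f t - (s - t) *\<^sub>R f' t) \<le> (e / 2) * norm (s - t)"
      unfolding has_derivative_within_alt using \<open>e > 0\<close> by (metis UNIV_I half_gt_zero)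
    have "norm (f s - f t) \<le> (L + e / 2) * \<bar>s - t\<bar>" if "\<bar>s - t\<bar> < h" for s
    proof -
      have "norm (f s - f t) \<le> norm ((s - t) *\<^sub>R f' t) + norm (f s - f t - (s - t) *\<^sub>R f' t)"
        using norm_triangle_sub[of "f s - f t" "(s - t) *\<^sub>R f' t"] by simp
      also have "\<dots> \<le> \<bar>s - t\<bar> * L + (e / 2) * \<bar>s - t\<bar>"
        using h(2)[of s] that le by (intro add_mono) (auto intro: mult_left_mono)
      finally show ?thesis by (simp add: algebra_simps)
    qed
    with h(1) show ?thesis by blast
  qed
  then obtain h where h: "\<And>t. t \<in> {c..d} - N \<Longrightarrow> h t > 0"
    "\<And>t s. t \<in> {c..d} - N \<Longrightarrow> \<bar>s - t\<bar> < h t \<Longrightarrow> norm (f s - f t) \<le> (L + e / 2) * \<bar>s - t\<bar>"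
    by metis
  define \<gamma> where "\<gamma> t = (if t \<in> N then U else if t \<in> {c..d} then ball t (h t) else ball t 1)" for t
  have "gauge \<gamma>"
    using U h(1) by (auto simp: gauge_def \<gamma>_def)
  then obtain p where p: "p tagged_division_of {c..d}" and fine: "\<gamma> fine p"
    by (rule fine_division_exists_real)
  have finp: "finite p" using p by (rule tagged_division_of_finite)
  have K: "\<exists>l r. K = {l..r} \<and> l \<le> t \<and> t \<le> r \<and> c \<le> l \<and> r \<le> d \<and> Inf K = l \<and> Sup K = r" if "(t, K) \<in> p" for t K
  proof -
    have "t \<in> K" "K \<subseteq> {c..d}" "\<exists>a b. K = cbox a b"
      using tagged_division_ofD[OF p] that by auto
    then show ?thesis by (auto simp: cbox_interval)
  qed
  define G where "G = {(t, K) \<in> p. t \<notin> N}"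
  define B where "B = {(t, K) \<in> p. t \<in> N}"
  have GB: "p = G \<union> B" "G \<inter> B = {}" and fin: "finite G" "finite B"
    using finp by (auto simp: G_def B_def intro: finite_subset[OF _ finp])
  have good: "norm (\<Sum>(t, K)\<in>G. f (Sup K) - f (Inf K)) \<le> (L + e / 2) * (d - c)"
  proof -
    have "norm (\<Sum>(t, K)\<in>G. f (Sup K) - f (Inf K)) \<le> (\<Sum>(t, K)\<in>G. (L + e / 2) * (Sup K - Inf K))"
    proof (rule sum_norm_le, clarify)
      fix t K assume tK: "(t, K) \<in> G"
      then obtain l r where lr: "K = {l..r}" "l \<le> t" "t \<le> r" "c \<le> l" "r \<le> d" "Inf K = l" "Sup K = r"
        using K GB by blast
      have t: "t \<in> {c..d} - N" using lr tK by (auto simp: G_def)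
      have "K \<subseteq> \<gamma> t"
        using fine tK GB by (auto simp: fine_def)
      then have sub: "K \<subseteq> ball t (h t)"
        using t by (simp add: \<gamma>_def)
      have "\<bar>l - t\<bar> < h t" "\<bar>r - t\<bar> < h t"
        using subsetD[OF sub, of l] subsetD[OF sub, of r] lr
        by (auto simp: dist_real_def abs_minus_commute)
      then have "norm (f l - f t) \<le> (L + e / 2) * (t - l)" "norm (f r - f t) \<le> (L + e / 2) * (r - t)"
        using h(2)[OF t] lr by fastforce+
      then have "norm (f r - f l) \<le> (L + e / 2) * (r - t) + (L + e / 2) * (t - l)"
        using norm_triangle_ineq4[of "f r - f t" "f l - f t"] by simp
      also have "\<dots> = (L + e / 2) * ((r - t) + (t - l))"
        by (rule distrib_left[symmetric])
      finally show "norm (f (Sup K) - f (Inf K)) \<le> (L + e / 2) * (Sup K - Inf K)"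
        using lr by simp
    qed
    also have "\<dots> \<le> (\<Sum>(t, K)\<in>p. (L + e / 2) * (Sup K - Inf K))"
    proof (intro sum_mono2 finp)
      fix i assume "i \<in> p - G"
      then have "Inf (snd i) \<le> Sup (snd i)" using K[of "fst i" "snd i"] by (cases i) force
      then show "0 \<le> (case i of (t, K) \<Rightarrow> (L + e / 2) * (Sup K - Inf K))"
        using \<open>L \<ge> 0\<close> \<open>e > 0\<close> by (simp add: case_prod_beta)
    qed (use GB in auto)
    also have "\<dots> = (L + e / 2) * (d - c)"
      using additive_tagged_division_1[OF \<open>c \<le> d\<close> p, of "\<lambda>x. x"]
      by (simp add: case_prod_beta sum_distrib_left[symmetric])
    finally show ?thesis .
  qed
  have bad: "norm (\<Sum>(t, K)\<in>B. f (Sup K) - f (Inf K)) \<le> e"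
  proof -
    have disj: "disjoint_family_on (\<lambda>i. {Inf (snd i)<..<Sup (snd i)}) B"
      unfolding disjoint_family_on_def
    proof (intro ballI impI)
      fix i j assume ij: "i \<in> B" "j \<in> B" "i \<noteq> j"
      obtain t K s K' where [simp]: "i = (t, K)" "j = (s, K')" by fastforce
      have "interior K \<inter> interior K' = {}"
        using tagged_division_ofD(5)[OF p, of t K s K'] ij GB by simp
      moreover have "interior K = {Inf K<..<Sup K}" "interior K' = {Inf K'<..<Sup K'}"
        using K[of t K] K[of s K'] ij GB by (metis UnCI \<open>i = (t, K)\<close> \<open>j = (s, K')\<close> interior_atLeastAtMost_real)+
      ultimately show "{Inf (snd i)<..<Sup (snd i)} \<inter> {Inf (snd j)<..<Sup (snd j)} = {}" by simp
    qed
    have "(\<Sum>i\<in>B. Sup (snd i) - Inf (snd i)) = (\<Sum>i\<in>B. measure lebesgue {Inf (snd i)<..<Sup (snd i)})"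
    proof (rule sum.cong)
      fix i assume "i \<in> B"
      then show "Sup (snd i) - Inf (snd i) = measure lebesgue {Inf (snd i)<..<Sup (snd i)}"
        using K[of "fst i" "snd i"] GB by (cases i) force
    qed simp
    also have "\<dots> = measure lebesgue (\<Union>i\<in>B. {Inf (snd i)<..<Sup (snd i)})"
    proof (intro measure_finite_Union[symmetric] fin disj)
      fix i assume "i \<in> B"
      show "emeasure lebesgue {Inf (snd i)<..<Sup (snd i)} \<noteq> \<infinity>"
        by (metis box_real(1) fmeasurableD2 infinity_ennreal_def lmeasurable_box)
    qed auto
    also have "\<dots> \<le> measure lebesgue U"
    proof (intro measure_mono_fmeasurable UN_least)
      fix i assume i: "i \<in> B"
      then have "snd i \<subseteq> \<gamma> (fst i)" using fine GB unfolding fine_def by (metis UnCI case_prodD prod.collapse)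
      then have "snd i \<subseteq> U" using i by (auto simp: B_def \<gamma>_def)
      then show "{Inf (snd i)<..<Sup (snd i)} \<subseteq> U"
        using K[of "fst i" "snd i"] i GB by (cases i) force
    qed (use U fin in auto)
    finally have "(\<Sum>i\<in>B. Sup (snd i) - Inf (snd i)) < \<delta>" using U by simp
    moreover have "\<forall>i\<in>B. c \<le> Inf (snd i) \<and> Inf (snd i) \<le> Sup (snd i) \<and> Sup (snd i) \<le> d"
      using K GB by fastforce
    ultimately have "(\<Sum>i\<in>B. norm (f (Sup (snd i)) - f (Inf (snd i)))) < e"
      using \<delta>[rule_format, of B "\<lambda>i. Inf (snd i)" "\<lambda>i. Sup (snd i)"] fin disj by blast
    then show ?thesis
      using norm_sum[of "\<lambda>i. f (Sup (snd i)) - f (Inf (snd i))" B] by (simp add: case_prod_beta)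
  qed
  have "f d - f c = (\<Sum>(t, K)\<in>G. f (Sup K) - f (Inf K)) + (\<Sum>(t, K)\<in>B. f (Sup K) - f (Inf K))"
    using additive_tagged_division_1[OF \<open>c \<le> d\<close> p, of f] GB fin by (simp add: sum.union_disjoint)
  then have "norm (f d - f c) \<le> (L + e / 2) * (d - c) + e"
    using norm_triangle_mono[OF good bad] by simp
  also have "\<dots> \<le> L * (d - c) + e * (d - c + 1)"
  proof -
    have "e / 2 * (d - c) \<le> e * (d - c)"
      using \<open>e > 0\<close> \<open>c \<le> d\<close> by (intro mult_right_mono) auto
    moreover have "e * (d - c + 1) = e * (d - c) + e" by (simp add: distrib_left)
    ultimately show ?thesis by (simp only: distrib_right)
  qed
  also have "e * (d - c + 1) = e0" using \<open>c \<le> d\<close> by (simp add: e_def)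
  finally show "norm (f d - f c) \<le> L * (d - c) + e0" by simp
qed

section \<open>Vitali coverings of the line\<close>

text \<open>A pair \<open>(u, v)\<close> stands for the interval from \<open>u\<close> to \<open>v\<close>. The point \<open>x\<close> may be an end point of the
covering interval, as it is for difference quotients at \<open>x\<close>.\<close>

definition Vitali_cover :: "(real \<times> real) set \<Rightarrow> real set \<Rightarrow> bool" where
  "Vitali_cover \<K> S \<longleftrightarrow> (\<forall>x\<in>S. \<forall>e>0. \<exists>(u, v)\<in>\<K>. u < v \<and> v - u < e \<and> x \<in> {u..v})"

lemma Vitali_coverE:
  assumes "Vitali_cover \<K> S" "x \<in> S" "e > 0"
  obtains u v where "(u, v) \<in> \<K>" "u < v" "v - u < e" "x \<in> {u..v}"
  using assms unfolding Vitali_cover_def by blast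

lemma Vitali_cover_mono: "Vitali_cover \<K> S \<Longrightarrow> T \<subseteq> S \<Longrightarrow> Vitali_cover \<K> T"
  unfolding Vitali_cover_def by blast

lemma Vitali_cover_inside_open:
  assumes "Vitali_cover \<K> S" "open U" "S \<subseteq> U"
  shows "Vitali_cover {(u, v) \<in> \<K>. {u..v} \<subseteq> U} S"
  unfolding Vitali_cover_def
proof (intro ballI allI impI)
  fix x e :: real assume x: "x \<in> S" and "e > 0"
  obtain \<rho> where "\<rho> > 0" "ball x \<rho> \<subseteq> U"
    using assms x by (meson open_contains_ball subsetD)
  obtain u v where uv: "(u, v) \<in> \<K>" "u < v" "v - u < min e \<rho>" "x \<in> {u..v}"
    using Vitali_coverE[OF assms(1) x, of "min e \<rho>"] \<open>e > 0\<close> \<open>\<rho> > 0\<close> by auto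
  then have "{u..v} \<subseteq> ball x \<rho>" by (auto simp: dist_real_def)
  then show "\<exists>(u, v)\<in>{(u, v) \<in> \<K>. {u..v} \<subseteq> U}. u < v \<and> v - u < e \<and> x \<in> {u..v}"
    using uv \<open>ball x \<rho> \<subseteq> U\<close> by (intro bexI[of _ "(u, v)"]) auto
qed

text \<open>In dimension one the closed balls of Vitali's theorem are all the nondegenerate compact intervals, with no centring at the
covered point.\<close>

lemma Vitali_covering_intervals:
  assumes "Vitali_cover \<K> S"
  obtains C where "countable C" "C \<subseteq> {(u, v) \<in> \<K>. u < v}"
    "disjoint_family_on (\<lambda>(u, v). {u..v}) C" "negligible (S - (\<Union>(u, v)\<in>C. {u..v}))"
proof -
  let ?K = "{(u, v) \<in> \<K>. u < v}"
  let ?a = "\<lambda>(u, v). (u + v) / 2 :: real" and ?r = "\<lambda>(u, v). (v - u) / 2 :: real"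
  have ball: "cball (?a i) (?r i) = (case i of (u, v) \<Rightarrow> {u..v})" for i
  proof (cases i)
    case (Pair u v)
    have "\<bar>(u + v) / 2 - x\<bar> \<le> (v - u) / 2 \<longleftrightarrow> u \<le> x \<and> x \<le> v" for x
      by (auto simp: abs_le_iff field_simps)
    with Pair show ?thesis by (auto simp: dist_real_def)
  qed
  obtain C where C: "countable C" "C \<subseteq> ?K"
    "pairwise (\<lambda>i j. disjnt (cball (?a i) (?r i)) (cball (?a j) (?r j))) C"
    "negligible (S - (\<Union>i\<in>C. cball (?a i) (?r i)))"
  proof (rule Vitali_covering_theorem_cballs[of ?K ?r S ?a])
    show "\<And>i. i \<in> ?K \<Longrightarrow> 0 < ?r i" by auto
    fix x d :: real assume "x \<in> S" "0 < d"
    then obtain u v where "(u, v) \<in> \<K>" "u < v" "v - u < d" "x \<in> {u..v}"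
      using Vitali_coverE[OF assms] by metis
    then show "\<exists>i. i \<in> ?K \<and> x \<in> cball (?a i) (?r i) \<and> ?r i < d"
      unfolding ball using \<open>0 < d\<close> by (intro exI[of _ "(u, v)"]) auto
  qed
  show thesis
    using that[of C] C by (simp add: ball pairwise_def disjoint_family_on_def disjnt_def)
qed

lemma measure_disjoint_intervals:
  fixes F :: "(real \<times> real) set"
  assumes "finite F" "disjoint_family_on (\<lambda>(u, v). {u..v}) F" "\<And>u v. (u, v) \<in> F \<Longrightarrow> u \<le> v"
  shows "measure lebesgue (\<Union>(u, v)\<in>F. {u..v}) = (\<Sum>(u, v)\<in>F. v - u)"
    and "(\<Union>(u, v)\<in>F. {u..v}) \<in> lmeasurable"
proof -
  have lm: "{u..v} \<in> lmeasurable" for u v :: real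
    by (metis box_real(2) lmeasurable_cbox)
  have "measure lebesgue (\<Union>i\<in>F. case i of (u, v) \<Rightarrow> {u..v}) =
      (\<Sum>i\<in>F. measure lebesgue (case i of (u, v) \<Rightarrow> {u..v}))"
    using assms fmeasurableD2[OF lm] by (intro measure_finite_Union) (auto split: prod.splits)
  also have "\<dots> = (\<Sum>(u, v)\<in>F. v - u)"
    using assms(3) by (intro sum.cong) auto
  finally show "measure lebesgue (\<Union>(u, v)\<in>F. {u..v}) = (\<Sum>(u, v)\<in>F. v - u)" .
  show "(\<Union>(u, v)\<in>F. {u..v}) \<in> lmeasurable"
    using assms(1) lm by (intro fmeasurable.finite_UN) (auto split: prod.splits)
qed

text \<open>The number \<open>m\<close> plays the part of the outer measure of \<open>S\<close>, which need not be measurable; 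
\<open>outer\<close> says that \<open>m\<close> does not exceed the measure of any set covering almost all of \<open>S\<close>.\<close>

lemma Vitali_finite_approximation:
  assumes cover: "Vitali_cover \<K> S" and U: "open U" "U \<in> lmeasurable" "S \<subseteq> U" and "e > 0"
    and outer: "\<forall>T. T \<in> lmeasurable \<and> negligible (S - T) \<longrightarrow> m \<le> measure lebesgue T"
  obtains F where "finite F" "F \<subseteq> {(u, v) \<in> \<K>. u < v \<and> {u..v} \<subseteq> U}"
    "disjoint_family_on (\<lambda>(u, v). {u..v}) F" "m - e < (\<Sum>(u, v)\<in>F. v - u)"
proof -
  obtain C where C: "countable C" "C \<subseteq> {(u, v) \<in> {(u, v) \<in> \<K>. {u..v} \<subseteq> U}. u < v}"
    "disjoint_family_on (\<lambda>(u, v). {u..v}) C" "negligible (S - (\<Union>(u, v)\<in>C. {u..v}))"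
    using Vitali_covering_intervals[OF Vitali_cover_inside_open[OF cover U(1,3)]] .
  let ?I = "\<lambda>(u, v). {u..v} :: real set"
  have lm: "?I i \<in> lmeasurable" for i
    by (cases i) (metis box_real(2) lmeasurable_cbox case_prod_conv)
  have sub: "?I i \<subseteq> U" if "i \<in> C" for i using that C(2) by auto
  have bound: "measure lebesgue (\<Union>D') \<le> measure lebesgue U" if "D' \<subseteq> ?I ` C" "finite D'" for D'
  proof (intro measure_mono_fmeasurable U(2))
    show "\<Union>D' \<subseteq> U" using that(1) sub by fast
    show "\<Union>D' \<in> sets lebesgue"
      using that lm by (intro sets.finite_Union) (auto intro!: fmeasurableD)
  qed
  obtain D' where D': "D' \<subseteq> ?I ` C" "finite D'"
      "measure lebesgue (\<Union>(?I ` C)) - e < measure lebesgue (\<Union>D')"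
    using measure_countable_Union_approachable[of "?I ` C" e "measure lebesgue U"] C(1) \<open>e > 0\<close> lm bound
    by (metis (no_types, lifting) countable_image imageE)
  obtain F where F: "F \<subseteq> C" "finite F" "D' = ?I ` F"
    using D' by (meson finite_subset_image)
  have lmC: "\<Union>(?I ` C) \<in> lmeasurable"
  proof (rule fmeasurableI2[OF U(2)])
    show "\<Union>(?I ` C) \<subseteq> U" using sub by blast
    show "\<Union>(?I ` C) \<in> sets lebesgue"
      using C(1) lm by (intro sets.countable_UN') (auto intro: fmeasurableD)
  qed
  have "m \<le> measure lebesgue (\<Union>(?I ` C))"
    using outer lmC C(4) by simp
  moreover have "measure lebesgue (\<Union>D') = (\<Sum>(u, v)\<in>F. v - u)"
    unfolding F(3) using F C by (intro measure_disjoint_intervals) (auto intro: disjoint_family_on_mono)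
  ultimately show thesis
    using that[of F] F C D'(3) disjoint_family_on_mono[OF F(1) C(3)] by auto
qed

text \<open>The number \<open>m\<close> is the outer measure of \<open>S\<close>. The sets whose negligibility is at stake below are given by conditions
on difference quotients, and this avoids proving them measurable.\<close>

lemma outer_measure_by_open_sets:
  fixes S W :: "real set"
  assumes W: "open W" "W \<in> lmeasurable" "S \<subseteq> W"
  shows "\<exists>m::real. (\<forall>T. T \<in> lmeasurable \<and> negligible (S - T) \<longrightarrow> m \<le> measure lebesgue T) \<and>
    (\<forall>e>0. \<exists>U. open U \<and> U \<in> lmeasurable \<and> S \<subseteq> U \<and> U \<subseteq> W \<and> measure lebesgue U < m + e) \<and>
    (m \<le> 0 \<longrightarrow> negligible S)"
proof -
  define O' where "O' = {U. open U \<and> S \<subseteq> U \<and> U \<subseteq> W}"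
  define m where "m = Inf (measure lebesgue ` O')"
  have lm: "U \<in> lmeasurable" if "U \<in> O'" for U
    using that W by (auto simp: O'_def intro: fmeasurableI2)
  have "W \<in> O'" using W by (simp add: O'_def)
  have bdd: "bdd_below (measure lebesgue ` O')" by (rule bdd_belowI[of _ 0]) auto
  have le: "m \<le> measure lebesgue U" if "U \<in> O'" for U
    unfolding m_def using that bdd by (intro cInf_lower) auto
  have ex: "\<exists>U. open U \<and> U \<in> lmeasurable \<and> S \<subseteq> U \<and> U \<subseteq> W \<and> measure lebesgue U < m + e" if "e > 0" for e
  proof -
    have "\<exists>y\<in>measure lebesgue ` O'. y < m + e"
      using cInf_lessD[of "measure lebesgue ` O'" "m + e"] \<open>W \<in> O'\<close> that by (auto simp: m_def)
    then show ?thesis using lm by (auto simp: O'_def)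
  qed
  show ?thesis
  proof (intro exI[of _ m] conjI allI impI ex; (elim conjE)?)
    fix T assume T: "T \<in> lmeasurable" "negligible (S - T)"
    show "m \<le> measure lebesgue T"
    proof (rule field_le_epsilon)
      fix e :: real assume "e > 0"
      obtain N where N: "open N" "S - T \<subseteq> N" "N \<in> lmeasurable" "measure lebesgue N < e / 2"
        using negligible_open_cover[OF T(2), of "e / 2"] \<open>e > 0\<close> by auto
      obtain T' where T': "open T'" "T \<subseteq> T'" "T' - T \<in> lmeasurable" "emeasure lebesgue (T' - T) < ennreal (e / 2)"
        using sets_lebesgue_outer_open[of T "e / 2"] T(1) \<open>e > 0\<close> by (auto intro: fmeasurableD)
      have T'm: "T' \<in> lmeasurable" using T' T(1) fmeasurable.Un[OF T(1) T'(3)] by (simp add: Un_absorb1)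
      have "(T' \<union> N) \<inter> W \<in> O'" using N T' W by (auto simp: O'_def)
      then have "m \<le> measure lebesgue ((T' \<union> N) \<inter> W)" by (rule le)
      also have "\<dots> \<le> measure lebesgue (T \<union> (T' - T) \<union> N)"
        using T T' N W lm[OF \<open>(T' \<union> N) \<inter> W \<in> O'\<close>]
        by (intro measure_mono_fmeasurable fmeasurable.Un) auto
      also have "\<dots> \<le> measure lebesgue T + measure lebesgue (T' - T) + measure lebesgue N"
        using T T' N by (meson add_right_mono measure_Un_le fmeasurable.Un fmeasurableD order_trans)
      also have "measure lebesgue (T' - T) < e / 2"
        using T'(3,4) \<open>e > 0\<close> by (simp add: emeasure_eq_measure2 ennreal_less_iff)
      finally show "m \<le> measure lebesgue T + e" using N by simp
    qed
  next
    assume "m \<le> 0"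
    show "negligible S"
      unfolding negligible_outer
    proof (intro allI impI)
      fix e :: real assume "e > 0"
      then obtain U where "U \<in> lmeasurable" "S \<subseteq> U" "measure lebesgue U < m + e"
        using ex by blast
      then show "\<exists>T. S \<subseteq> T \<and> T \<in> lmeasurable \<and> measure lebesgue T < e"
        using \<open>m \<le> 0\<close> by (intro exI[of _ U]) simp
    qed
  qed
qed

section \<open>Almost everywhere differentiability\<close>

text \<open>The last conjunct says that \<open>F\<close> and \<open>G\<close> together partition the interval from \<open>a\<close> to \<open>b\<close>, in the form
in which it is used: increments telescope.\<close>

definition fills_gaps :: "real \<Rightarrow> real \<Rightarrow> (real \<times> real) set \<Rightarrow> (real \<times> real) set \<Rightarrow> bool" where
  "fills_gaps a b F G \<longleftrightarrow> finite G \<and> (\<forall>(u, v)\<in>G. a \<le> u \<and> u \<le> v \<and> v \<le> b) \<and>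
    disjoint_family_on (\<lambda>(u, v). {u<..<v}) G \<and>
    (\<forall>h::real \<Rightarrow> real. (\<Sum>(u, v)\<in>F. h v - h u) + (\<Sum>(u, v)\<in>G. h v - h u) = h b - h a)"

lemma gaps_between_intervals:
  fixes F :: "(real \<times> real) set"
  assumes "a \<le> b" "finite F" and disj: "disjoint_family_on (\<lambda>(u, v). {u..v}) F"
    and F: "\<And>u v. (u, v) \<in> F \<Longrightarrow> a \<le> u \<and> u < v \<and> v \<le> b"
  shows "\<exists>G. fills_gaps a b F G"
proof -
  let ?I = "\<lambda>(u, v). {u..v} :: real set"
  define p where "p = ?I ` F"
  have "p division_of \<Union>p"
  proof (rule division_ofI)
    show "finite p" using \<open>finite F\<close> by (simp add: p_def)
    fix K assume K: "K \<in> p"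
    then show "K \<subseteq> \<Union>p" by blast
    show "K \<noteq> {}" using K F by (fastforce simp: p_def)
    show "\<exists>a b. K = cbox a b" using K by (auto simp: p_def simp flip: box_real(2))
    fix K' assume "K' \<in> p" "K \<noteq> K'"
    then obtain i j where "i \<in> F" "j \<in> F" "K = ?I i" "K' = ?I j" "i \<noteq> j"
      using K by (auto simp: p_def)
    then have "K \<inter> K' = {}" using disjoint_family_onD[OF disj] by simp
    then show "interior K \<inter> interior K' = {}"
      using interior_subset by blast
  qed simp
  moreover have "\<Union>p \<subseteq> cbox a b"
    using F by (fastforce simp: p_def)
  ultimately obtain q where "p \<subseteq> q" and q: "q division_of cbox a b"
    by (rule partial_division_extend_interval)
  have fq: "finite q" using q by (rule division_of_finite)
  have K: "\<exists>l r. K = {l..r} \<and> a \<le> l \<and> l \<le> r \<and> r \<le> b \<and> Inf K = l \<and> Sup K = r" if "K \<in> q" for K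
  proof -
    have "K \<noteq> {}" "K \<subseteq> cbox a b" "\<exists>a b. K = cbox a b"
      using division_ofD[OF q] that by auto
    then show ?thesis by (auto simp: cbox_interval)
  qed
  have tq: "(\<lambda>K. (Inf K, K)) ` q tagged_division_of {a..b}"
  proof (rule tagged_division_ofI)
    show "finite ((\<lambda>K. (Inf K, K)) ` q)" using fq by simp
    have "{K. \<exists>x. (x, K) \<in> (\<lambda>K. (Inf K, K)) ` q} = q" by auto
    then show "\<Union> {K. \<exists>x. (x, K) \<in> (\<lambda>K. (Inf K, K)) ` q} = {a..b}"
      using division_ofD(6)[OF q] by simp
    fix x L assume "(x, L) \<in> (\<lambda>K. (Inf K, K)) ` q"
    then have L: "L \<in> q" "x = Inf L" by blast+
    obtain l r where "L = {l..r}" "l \<le> r" "Inf L = l" using K[OF L(1)] by metis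
    then show "x \<in> L" using L(2) by simp
    show "L \<subseteq> {a..b}" "\<exists>a b. L = cbox a b"
      using division_ofD(2,4)[OF q L(1)] by (auto simp: cbox_interval)
    fix x' L' assume "(x', L') \<in> (\<lambda>K. (Inf K, K)) ` q" "(x, L) \<noteq> (x', L')"
    then show "interior L \<inter> interior L' = {}"
      using L division_ofD(5)[OF q, of L L'] by auto
  qed
  have tele: "(\<Sum>K\<in>q. h (Sup K) - h (Inf K)) = h b - h a" for h :: "real \<Rightarrow> real"
    using additive_tagged_division_1[OF \<open>a \<le> b\<close> tq, of h]
    by (subst (asm) sum.reindex) (auto simp: inj_on_def)
  let ?p = "\<lambda>K. (Inf K, Sup K)"
  define G where "G = ?p ` (q - p)"
  have inj: "inj_on ?p q"
    by (rule inj_onI) (metis K Pair_inject)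
  have sumG: "(\<Sum>(u, v)\<in>G. h v - h u) = (\<Sum>K\<in>q - p. h (Sup K) - h (Inf K))" for h :: "real \<Rightarrow> real"
    unfolding G_def using inj_on_subset[OF inj, of "q - p"] by (simp add: sum.reindex)
  have injF: "inj_on ?I F"
  proof (rule inj_onI, rule ccontr)
    fix i j assume "i \<in> F" "j \<in> F" "?I i = ?I j" "i \<noteq> j"
    then have "?I i = {}" using disjoint_family_onD[OF disj, of i j] by simp
    then show False using F[of "fst i" "snd i"] \<open>i \<in> F\<close> by (cases i) auto
  qed
  have sumF: "(\<Sum>(u, v)\<in>F. h v - h u) = (\<Sum>K\<in>p. h (Sup K) - h (Inf K))" for h :: "real \<Rightarrow> real"
    unfolding p_def using F by (subst sum.reindex[OF injF]) (auto intro!: sum.cong split: prod.splits dest!: F)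
  show ?thesis
    unfolding fills_gaps_def
  proof (intro exI[of _ G] conjI allI)
    show "finite G" using fq by (simp add: G_def)
    show "\<forall>(u, v)\<in>G. a \<le> u \<and> u \<le> v \<and> v \<le> b" using K by (fastforce simp: G_def)
    show "disjoint_family_on (\<lambda>(u, v). {u<..<v}) G"
      unfolding disjoint_family_on_def
    proof (intro ballI impI)
      fix i j assume "i \<in> G" "j \<in> G" "i \<noteq> j"
      then obtain K1 K2 where K12: "K1 \<in> q" "K2 \<in> q" "i = ?p K1" "j = ?p K2" "K1 \<noteq> K2"
        unfolding G_def by blast
      then have "interior K1 \<inter> interior K2 = {}" using division_ofD(5)[OF q] by blast
      moreover have "interior K1 = {Inf K1<..<Sup K1}" "interior K2 = {Inf K2<..<Sup K2}"
        using K K12 interior_atLeastAtMost_real by metis+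
      ultimately show "(case i of (u, v) \<Rightarrow> {u<..<v}) \<inter> (case j of (u, v) \<Rightarrow> {u<..<v}) = {}"
        using K12 by simp
    qed
    fix h :: "real \<Rightarrow> real"
    have "(\<Sum>K\<in>p. h (Sup K) - h (Inf K)) + (\<Sum>K\<in>q - p. h (Sup K) - h (Inf K)) = h b - h a"
      using sum.subset_diff[OF \<open>p \<subseteq> q\<close> fq, of "\<lambda>K. h (Sup K) - h (Inf K)"] tele[of h] by simp
    then show "(\<Sum>(u, v)\<in>F. h v - h u) + (\<Sum>(u, v)\<in>G. h v - h u) = h b - h a"
      by (simp only: sumG sumF)
  qed
qed

definition nested_families :: "real \<Rightarrow> real \<Rightarrow> (real \<times> real) set \<Rightarrow> (real \<times> real) set \<Rightarrow> bool" where
  "nested_families c d F F1 \<longleftrightarrow> finite F \<and> finite F1 \<and>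
     disjoint_family_on (\<lambda>(u, v). {u..v}) F \<and> disjoint_family_on (\<lambda>(u, v). {u..v}) F1 \<and>
     (\<forall>i\<in>F. fst i < snd i) \<and> (\<forall>j\<in>F1. c \<le> fst j \<and> fst j < snd j \<and> snd j \<le> d) \<and>
     (\<forall>i\<in>F. \<exists>j\<in>F1. {fst i..snd i} \<subseteq> {fst j..snd j})"

text \<open>The increments over \<open>F1\<close> and over \<open>F\<close> differ by the increments over the gaps that \<open>F\<close> leaves in \<open>F1\<close>, and those have
small total length.\<close>

lemma abs_cont_on_nested_families:
  fixes h :: "real \<Rightarrow> real"
  assumes h: "abs_cont_on c d (\<lambda>t. of_real (h t))" and "\<eta> > 0"
  shows "\<exists>\<delta>>0. \<forall>F F1. nested_families c d F F1 \<and> (\<Sum>(u, v)\<in>F1. v - u) - (\<Sum>(u, v)\<in>F. v - u) < \<delta> \<longrightarrow>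
      (\<Sum>(u, v)\<in>F. v - u) \<le> (\<Sum>(u, v)\<in>F1. v - u) \<and>
      \<bar>(\<Sum>(u, v)\<in>F1. h v - h u) - (\<Sum>(u, v)\<in>F. h v - h u)\<bar> < \<eta>"
proof -
  obtain \<delta> where "\<delta> > 0" and \<delta>: "\<forall>(A::((real \<times> real) \<times> real \<times> real) set) l r. finite A \<and> (\<forall>i\<in>A. c \<le> l i \<and> l i \<le> r i \<and> r i \<le> d) \<and>
    disjoint_family_on (\<lambda>i. {l i<..<r i}) A \<and> (\<Sum>i\<in>A. r i - l i) < \<delta> \<longrightarrow>
    (\<Sum>i\<in>A. norm (of_real (h (r i)) - of_real (h (l i)) :: complex)) < \<eta>"
    using abs_cont_on_family[OF h \<open>\<eta> > 0\<close>] by blast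
  show ?thesis
  proof (intro exI[of _ \<delta>] conjI allI impI \<open>\<delta> > 0\<close>; elim conjE)
    fix F F1 :: "(real \<times> real) set"
    assume nested: "nested_families c d F F1" and len: "(\<Sum>(u, v)\<in>F1. v - u) - (\<Sum>(u, v)\<in>F. v - u) < \<delta>"
    have fin: "finite F" "finite F1"
      and disj: "disjoint_family_on (\<lambda>(u, v). {u..v}) F" and disj1: "disjoint_family_on (\<lambda>(u, v). {u..v}) F1"
      and F: "\<And>i. i \<in> F \<Longrightarrow> fst i < snd i" and F1: "\<And>j. j \<in> F1 \<Longrightarrow> c \<le> fst j \<and> fst j < snd j \<and> snd j \<le> d"
      and ex: "\<And>i. i \<in> F \<Longrightarrow> \<exists>j\<in>F1. {fst i..snd i} \<subseteq> {fst j..snd j}"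
      using nested by (auto simp: nested_families_def)
    obtain k where k: "\<And>i. i \<in> F \<Longrightarrow> k i \<in> F1" "\<And>i. i \<in> F \<Longrightarrow> {fst i..snd i} \<subseteq> {fst (k i)..snd (k i)}"
      using ex by metis
    define F2 where "F2 j = {i \<in> F. k i = j}" for j
    have "\<exists>G. fills_gaps (fst j) (snd j) (F2 j) G" if "j \<in> F1" for j
    proof (rule gaps_between_intervals)
      show "fst j \<le> snd j" using F1[OF that] by simp
      show "finite (F2 j)" using fin by (simp add: F2_def)
      show "disjoint_family_on (\<lambda>(u, v). {u..v}) (F2 j)"
        using disj by (rule disjoint_family_on_mono[rotated]) (auto simp: F2_def)
      fix u v assume "(u, v) \<in> F2 j"
      then have "{u..v} \<subseteq> {fst j..snd j}" "u < v" using k(2)[of "(u, v)"] F[of "(u, v)"] by (auto simp: F2_def)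
      then show "fst j \<le> u \<and> u < v \<and> v \<le> snd j" by auto
    qed
    then obtain G where G': "\<And>j. j \<in> F1 \<Longrightarrow> fills_gaps (fst j) (snd j) (F2 j) (G j)"
      by metis
    have G: "finite (G j)" "\<And>u v. (u, v) \<in> G j \<Longrightarrow> fst j \<le> u \<and> u \<le> v \<and> v \<le> snd j"
      "disjoint_family_on (\<lambda>(u, v). {u<..<v}) (G j)"
      "(\<Sum>(u, v)\<in>F2 j. g v - g u) + (\<Sum>(u, v)\<in>G j. g v - g u) = g (snd j) - g (fst j)"
      if "j \<in> F1" for j and g :: "real \<Rightarrow> real"
      using G'[OF that] by (auto simp: fills_gaps_def)
    define A where "A = Sigma F1 G"
    have finA: "finite A" using fin G(1) by (simp add: A_def)
    have A: "j \<in> F1" "fst j \<le> u" "u \<le> v" "v \<le> snd j" "c \<le> u" "v \<le> d" if "(j, u, v) \<in> A" for j u v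
    proof -
      have "j \<in> F1" "(u, v) \<in> G j" using that by (auto simp: A_def)
      then show "j \<in> F1" "fst j \<le> u" "u \<le> v" "v \<le> snd j" "c \<le> u" "v \<le> d"
        using G(2)[of j u v] F1[of j] by auto
    qed
    have sumA: "(\<Sum>(j, u, v)\<in>A. g v - g u) = (\<Sum>(u, v)\<in>F1. g v - g u) - (\<Sum>(u, v)\<in>F. g v - g u)"
      for g :: "real \<Rightarrow> real"
    proof -
      have "(\<Sum>(j, u, v)\<in>A. g v - g u) = (\<Sum>j\<in>F1. \<Sum>(u, v)\<in>G j. g v - g u)"
        unfolding A_def using fin G(1) by (simp add: sum.Sigma case_prod_beta)
      also have "\<dots> = (\<Sum>j\<in>F1. (g (snd j) - g (fst j)) - (\<Sum>(u, v)\<in>F2 j. g v - g u))"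
        using G(4)[of _ g] by (intro sum.cong) (auto simp: algebra_simps)
      also have "\<dots> = (\<Sum>(u, v)\<in>F1. g v - g u) - (\<Sum>j\<in>F1. \<Sum>(u, v)\<in>F2 j. g v - g u)"
        by (simp add: sum_subtractf case_prod_beta)
      also have "(\<Sum>j\<in>F1. \<Sum>(u, v)\<in>F2 j. g v - g u) = (\<Sum>(u, v)\<in>F. g v - g u)"
        unfolding F2_def using fin k(1) by (intro sum.group) auto
      finally show ?thesis .
    qed
    have disjA: "disjoint_family_on (\<lambda>i. {fst (snd i)<..<snd (snd i)}) A"
      unfolding disjoint_family_on_def
    proof (intro ballI impI)
      fix i i' assume i: "i \<in> A" "i' \<in> A" "i \<noteq> i'"
      obtain j u v j' u' v' where [simp]: "i = (j, u, v)" "i' = (j', u', v')" by (metis prod.collapse)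
      have j: "j \<in> F1" "j' \<in> F1" "(u, v) \<in> G j" "(u', v') \<in> G j'" using i by (auto simp: A_def)
      show "{fst (snd i)<..<snd (snd i)} \<inter> {fst (snd i')<..<snd (snd i')} = {}"
      proof (cases "j = j'")
        case True
        then show ?thesis
          using disjoint_family_onD[OF G(3)[OF j(1)], of "(u, v)" "(u', v')"] j i by simp
      next
        case False
        then have "{fst j..snd j} \<inter> {fst j'..snd j'} = {}"
          using disjoint_family_onD[OF disj1 j(1,2)] by (simp add: case_prod_beta)
        moreover have "{u<..<v} \<subseteq> {fst j..snd j}" "{u'<..<v'} \<subseteq> {fst j'..snd j'}"
          using A[of j u v] A[of j' u' v'] i by auto
        ultimately have "{u<..<v} \<inter> {u'<..<v'} = {}" by blast
        then show ?thesis by simp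
      qed
    qed
    have "(\<Sum>i\<in>A. norm (of_real (h (snd (snd i))) - of_real (h (fst (snd i))) :: complex)) < \<eta>"
    proof (rule \<delta>[rule_format], intro conjI ballI)
      fix i assume "i \<in> A"
      then show "c \<le> fst (snd i)" "fst (snd i) \<le> snd (snd i)" "snd (snd i) \<le> d"
        using A[of "fst i" "fst (snd i)" "snd (snd i)"] by simp_all
    next
      show "(\<Sum>i\<in>A. snd (snd i) - fst (snd i)) < \<delta>"
        using len sumA[of "\<lambda>x. x"] by (simp add: case_prod_beta)
    qed (use finA disjA in auto)
    then have "(\<Sum>i\<in>A. \<bar>h (snd (snd i)) - h (fst (snd i))\<bar>) < \<eta>"
      by (simp flip: of_real_diff)
    then have "\<bar>\<Sum>i\<in>A. h (snd (snd i)) - h (fst (snd i))\<bar> < \<eta>"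
      by (rule order.strict_trans1[OF sum_abs])
    then have "\<bar>(\<Sum>(u, v)\<in>F1. h v - h u) - (\<Sum>(u, v)\<in>F. h v - h u)\<bar> < \<eta>"
      unfolding sumA[of h, symmetric] by (simp add: case_prod_beta)
    moreover have "0 \<le> (\<Sum>(j, u, v)\<in>A. v - u)"
      using A by (intro sum_nonneg) auto
    ultimately show "(\<Sum>(u, v)\<in>F. v - u) \<le> (\<Sum>(u, v)\<in>F1. v - u)"
      "\<bar>(\<Sum>(u, v)\<in>F1. h v - h u) - (\<Sum>(u, v)\<in>F. h v - h u)\<bar> < \<eta>"
      using sumA[of "\<lambda>x. x"] by simp_all
  qed
qed

text \<open>The set \<open>S\<close> consists of points where difference quotients drop below \<open>p\<close> and exceed \<open>q\<close> at arbitrarily small scales.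
Almost all of \<open>S\<close> is covered by intervals \<open>F1\<close> of mean slope below \<open>p\<close>, and within these by intervals \<open>F\<close> of
mean slope above \<open>q\<close>. Both families have total length close to the outer measure \<open>m\<close> of \<open>S\<close>, so by absolute continuity
their increments nearly agree, although one is at most about \<open>p m\<close> and the other at least about \<open>q m\<close>. Hence
\<open>m = 0\<close>. For monotone functions this is Lebesgue's argument; absolute continuity makes the detour over
the total variation unnecessary.\<close>

lemma Vitali_nested_covers_negligible:
  fixes h :: "real \<Rightarrow> real"
  assumes h: "abs_cont_on c d (\<lambda>t. of_real (h t))" and S: "S \<subseteq> {c<..<d}" and "p < q"
    and below: "Vitali_cover {(u, v). h v - h u < p * (v - u)} S"
    and above: "Vitali_cover {(u, v). q * (v - u) < h v - h u} S"
  shows "negligible S"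
proof -
  have Wlm: "{c<..<d} \<in> lmeasurable" by (metis box_real(1) lmeasurable_box)
  obtain m where m: "\<forall>T. T \<in> lmeasurable \<and> negligible (S - T) \<longrightarrow> m \<le> measure lebesgue T"
    "\<forall>e>0. \<exists>U. open U \<and> U \<in> lmeasurable \<and> S \<subseteq> U \<and> U \<subseteq> {c<..<d} \<and> measure lebesgue U < m + e"
    "m \<le> 0 \<longrightarrow> negligible S"
    using outer_measure_by_open_sets[OF _ Wlm S] open_greaterThanLessThan by metis
  have "\<not> m > 0"
  proof
    assume "m > 0"
    define \<eta> where "\<eta> = (q - p) * m / 4"
    have "\<eta> > 0" using \<open>m > 0\<close> \<open>p < q\<close> by (simp add: \<eta>_def)
    obtain \<delta> where "\<delta> > 0" and
      \<delta>: "\<forall>F F1. nested_families c d F F1 \<and> (\<Sum>(u, v)\<in>F1. v - u) - (\<Sum>(u, v)\<in>F. v - u) < \<delta> \<longrightarrow>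
        (\<Sum>(u, v)\<in>F. v - u) \<le> (\<Sum>(u, v)\<in>F1. v - u) \<and>
        \<bar>(\<Sum>(u, v)\<in>F1. h v - h u) - (\<Sum>(u, v)\<in>F. h v - h u)\<bar> < \<eta>"
      using abs_cont_on_nested_families[OF h \<open>\<eta> > 0\<close>] by metis
    \<comment> \<open>the three bounds ensure, in turn, that the gaps are short enough for \<open>\<delta>\<close>, that \<open>F\<close> has length above \<open>m / 2\<close>,
      and that the increment \<open>p\<close> times the length of the gaps is below \<open>\<eta>\<close>\<close>
    define e where "e = min (\<delta> / 2) (min (m / 2) (\<eta> / (2 * (\<bar>p\<bar> + 1))))"
    have le: "e \<le> \<delta> / 2" "e \<le> m / 2" "e \<le> \<eta> / (2 * (\<bar>p\<bar> + 1))"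
      unfolding e_def by linarith+
    have "e > 0" using \<open>\<delta> > 0\<close> \<open>m > 0\<close> \<open>\<eta> > 0\<close> by (simp add: e_def)
    have "(\<bar>p\<bar> + 1) * (2 * e) \<le> \<eta>" using le(3) by (simp add: field_simps)
    then have pe: "\<bar>p\<bar> * (2 * e) < \<eta>" using \<open>e > 0\<close> by (simp add: distrib_right)
    obtain U where U: "open U" "U \<in> lmeasurable" "S \<subseteq> U" "U \<subseteq> {c<..<d}" "measure lebesgue U < m + e"
      using m(2) \<open>e > 0\<close> by metis
    \<comment> \<open>intervals on which \<open>h\<close> has mean slope below \<open>p\<close>, covering almost all of \<open>S\<close>\<close>
    obtain C where C: "countable C" "C \<subseteq> {(u, v) \<in> {(u, v) \<in> {(u, v). h v - h u < p * (v - u)}. {u..v} \<subseteq> U}. u < v}"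
      "disjoint_family_on (\<lambda>(u, v). {u..v}) C" "negligible (S - (\<Union>(u, v)\<in>C. {u..v}))"
      using Vitali_covering_intervals[OF Vitali_cover_inside_open[OF below U(1,3)]] .
    have Cp: "h v - h u < p * (v - u)" "{u..v} \<subseteq> U" "u < v" if "(u, v) \<in> C" for u v
      using C(2) that by auto
    \<comment> \<open>open intervals leave room for small intervals around each point; only end points are lost\<close>
    define S' where "S' = S \<inter> (\<Union>(u, v)\<in>C. {u<..<v})"
    have neg: "negligible (S - S')"
    proof (rule negligible_subset)
      have "countable (fst ` C \<union> snd ` C)" using C(1) by simp
      then have "negligible (fst ` C \<union> snd ` C)"
        by (simp add: negligible_iff_null_sets countable_imp_null_set_lborel null_sets_completionI)
      then show "negligible ((S - (\<Union>(u, v)\<in>C. {u..v})) \<union> (fst ` C \<union> snd ` C))"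
        using C(4) by (rule negligible_Un[rotated])
      show "S - S' \<subseteq> (S - (\<Union>(u, v)\<in>C. {u..v})) \<union> (fst ` C \<union> snd ` C)"
        by (force simp: S'_def less_le)
    qed
    \<comment> \<open>inside them, finitely many intervals with mean slope above \<open>q\<close>\<close>
    define \<K> where "\<K> = {(u, v). q * (v - u) < h v - h u \<and> (\<exists>j\<in>C. {u..v} \<subseteq> {fst j..snd j})}"
    have "Vitali_cover \<K> S'"
      unfolding Vitali_cover_def
    proof (intro ballI allI impI)
      fix x e' :: real assume "x \<in> S'" and "e' > 0"
      then obtain u' v' where u'v': "(u', v') \<in> C" "x \<in> {u'<..<v'}" and "x \<in> S" by (auto simp: S'_def)
      have cov: "Vitali_cover {(u, v) \<in> {(u, v). q * (v - u) < h v - h u}. {u..v} \<subseteq> {u'<..<v'}} {x}"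
        using u'v' \<open>x \<in> S\<close> by (intro Vitali_cover_inside_open[OF Vitali_cover_mono[OF above]]) auto
      obtain u v where uv: "(u, v) \<in> {(u, v) \<in> {(u, v). q * (v - u) < h v - h u}. {u..v} \<subseteq> {u'<..<v'}}"
          "u < v" "v - u < e'" "x \<in> {u..v}"
        by (rule Vitali_coverE[OF cov singletonI \<open>e' > 0\<close>])
      have "{u..v} \<subseteq> {u'<..<v'}" using uv(1) by simp
      also have "\<dots> \<subseteq> {u'..v'}" by auto
      finally have "(u, v) \<in> \<K>" using uv(1) u'v'(1) by (force simp: \<K>_def)
      then show "\<exists>(u, v)\<in>\<K>. u < v \<and> v - u < e' \<and> x \<in> {u..v}" using uv by blast
    qed
    moreover have "S' \<subseteq> U" using U by (auto simp: S'_def)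
    moreover have "\<forall>T. T \<in> lmeasurable \<and> negligible (S' - T) \<longrightarrow> m \<le> measure lebesgue T"
    proof (intro allI impI; elim conjE)
      fix T assume T: "T \<in> lmeasurable" "negligible (S' - T)"
      have "negligible (S - T)"
        by (rule negligible_subset[OF negligible_Un[OF T(2) neg]]) auto
      then show "m \<le> measure lebesgue T" using m(1) T(1) by blast
    qed
    ultimately obtain F where F: "finite F" "F \<subseteq> {(u, v) \<in> \<K>. u < v \<and> {u..v} \<subseteq> U}"
      "disjoint_family_on (\<lambda>(u, v). {u..v}) F" "m - e < (\<Sum>(u, v)\<in>F. v - u)"
      by (rule Vitali_finite_approximation[OF _ U(1,2) _ \<open>e > 0\<close>])
    have FK: "q * (v - u) < h v - h u" "u < v" "\<exists>j\<in>C. {u..v} \<subseteq> {fst j..snd j}" if "(u, v) \<in> F" for u v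
      using that F(2) by (auto simp: \<K>_def)
    have "\<exists>j\<in>C. {fst i..snd i} \<subseteq> {fst j..snd j}" if "i \<in> F" for i
      using FK(3)[of "fst i" "snd i"] that by simp
    then obtain k where k: "\<And>i. i \<in> F \<Longrightarrow> k i \<in> C" "\<And>i. i \<in> F \<Longrightarrow> {fst i..snd i} \<subseteq> {fst (k i)..snd (k i)}"
      by metis
    define F1 where "F1 = k ` F"
    have F1: "finite F1" "F1 \<subseteq> C" using F(1) k by (auto simp: F1_def)
    have disj1: "disjoint_family_on (\<lambda>(u, v). {u..v}) F1"
      using disjoint_family_on_mono[OF F1(2) C(3)] .
    have F1p: "h v - h u < p * (v - u)" "{u..v} \<subseteq> U" "u < v" if "(u, v) \<in> F1" for u v
      using Cp[of u v] F1(2) that by blast+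
    have ends: "c \<le> fst j \<and> fst j < snd j \<and> snd j \<le> d" if "j \<in> F1" for j
    proof -
      have "{fst j..snd j} \<subseteq> {c<..<d}" "fst j < snd j" using F1p[of "fst j" "snd j"] that U(4) by auto
      then show ?thesis by (auto simp: subset_iff dest: spec[of _ "fst j"] spec[of _ "snd j"])
    qed
    let ?X = "\<Sum>(u, v)\<in>F. v - u" and ?Y = "\<Sum>(u, v)\<in>F1. v - u"
    have "?Y = measure lebesgue (\<Union>(u, v)\<in>F1. {u..v})"
      using F1 disj1 F1p(3) by (intro measure_disjoint_intervals(1)[symmetric]) (auto intro: less_imp_le)
    also have "\<dots> \<le> measure lebesgue U"
    proof (intro measure_mono_fmeasurable U(2) UN_least)
      show "(\<Union>(u, v)\<in>F1. {u..v}) \<in> sets lebesgue" using F1(1) by (intro sets.finite_UN) auto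
      show "(case j of (u, v) \<Rightarrow> {u..v}) \<subseteq> U" if "j \<in> F1" for j using F1p(2) that by (cases j) auto
    qed
    finally have len: "?Y - ?X < 2 * e" using F(4) U(5) by simp
    have "?X \<le> ?Y \<and> \<bar>(\<Sum>(u, v)\<in>F1. h v - h u) - (\<Sum>(u, v)\<in>F. h v - h u)\<bar> < \<eta>"
    proof (rule \<delta>[rule_format], intro conjI)
      show "nested_families c d F F1"
        unfolding nested_families_def
      proof (intro conjI ballI F(1,3) F1(1) disj1)
        show "fst i < snd i" if "i \<in> F" for i using FK(2)[of "fst i" "snd i"] that by simp
        show "\<exists>j\<in>F1. {fst i..snd i} \<subseteq> {fst j..snd j}" if "i \<in> F" for i
          unfolding F1_def using k[OF that] that by blast
      qed (use ends in auto)
      show "?Y - ?X < \<delta>" using len le(1) by simp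
    qed
    moreover have "(\<Sum>(u, v)\<in>F1. h v - h u) \<le> p * ?Y"
      unfolding sum_distrib_left using F1p(1) by (intro sum_mono) (auto intro: less_imp_le)
    moreover have "q * ?X \<le> (\<Sum>(u, v)\<in>F. h v - h u)"
      unfolding sum_distrib_left using FK(1) by (intro sum_mono) (auto intro: less_imp_le)
    ultimately have "q * ?X - p * ?Y < \<eta>" and "?X \<le> ?Y" by linarith+
    moreover have "p * (?Y - ?X) < \<eta>"
    proof -
      have "p * (?Y - ?X) \<le> \<bar>p\<bar> * (2 * e)"
        using len \<open>?X \<le> ?Y\<close> by (intro mult_mono) auto
      then show ?thesis using pe by simp
    qed
    moreover have "(q - p) * ?X = (q * ?X - p * ?Y) + p * (?Y - ?X)"
      by (simp add: left_diff_distrib right_diff_distrib)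
    ultimately have "(q - p) * ?X < 2 * \<eta>" by linarith
    moreover have "(q - p) * (m / 2) < (q - p) * ?X"
      using F(4) le(2) \<open>p < q\<close> by (intro mult_strict_left_mono) auto
    moreover have "(q - p) * (m / 2) = 2 * \<eta>" by (simp add: \<eta>_def)
    ultimately show False by linarith
  qed
  then show ?thesis using m(3) by simp
qed

text \<open>On an interval shorter than the \<open>\<delta>\<close> belonging to \<open>\<epsilon> = 1\<close> the total increment is below \<open>1\<close>, so the set where the
slopes exceed \<open>R\<close> has outer measure at most \<open>1 / R\<close> there. The claim is therefore first proved locally.\<close>

lemma infinite_slope_negligible:
  fixes h :: "real \<Rightarrow> real"
  assumes h: "abs_cont_on c d (\<lambda>t. of_real (h t))" and S: "S \<subseteq> {c<..<d}"
    and steep: "\<And>R. Vitali_cover {(u, v). R * (v - u) < \<bar>h v - h u\<bar>} S"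
  shows "negligible S"
proof -
  obtain \<delta> where "\<delta> > 0" and \<delta>: "\<forall>(A::(real \<times> real) set) l r. finite A \<and> (\<forall>i\<in>A. c \<le> l i \<and> l i \<le> r i \<and> r i \<le> d) \<and>
      disjoint_family_on (\<lambda>i. {l i<..<r i}) A \<and> (\<Sum>i\<in>A. r i - l i) < \<delta> \<longrightarrow>
      (\<Sum>i\<in>A. norm (of_real (h (r i)) - of_real (h (l i)) :: complex)) < 1"
    using abs_cont_on_family[OF h zero_less_one] by blast
  have local: "negligible (S \<inter> {y<..<z})" if "c \<le> y" "y < z" "z \<le> d" "z - y < \<delta>" for y z
  proof -
    let ?W = "{y<..<z}"
    have Wlm: "?W \<in> lmeasurable" by (metis box_real(1) lmeasurable_box)
    obtain m where m: "\<forall>T. T \<in> lmeasurable \<and> negligible (S \<inter> ?W - T) \<longrightarrow> m \<le> measure lebesgue T"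
      "m \<le> 0 \<longrightarrow> negligible (S \<inter> ?W)"
      using outer_measure_by_open_sets[of ?W "S \<inter> ?W"] Wlm open_greaterThanLessThan by (metis inf_le2)
    have "\<not> m > 0"
    proof
      assume "m > 0"
      obtain F where F: "finite F" "F \<subseteq> {(u, v) \<in> {(u, v). (2 / m) * (v - u) < \<bar>h v - h u\<bar>}. u < v \<and> {u..v} \<subseteq> ?W}"
        "disjoint_family_on (\<lambda>(u, v). {u..v}) F" "m - m / 2 < (\<Sum>(u, v)\<in>F. v - u)"
        by (rule Vitali_finite_approximation[OF Vitali_cover_mono[OF steep[of "2 / m"] inf_le1] open_greaterThanLessThan Wlm inf_le2 half_gt_zero[OF \<open>m > 0\<close>] m(1)])
      have "(\<Sum>(u, v)\<in>F. v - u) = measure lebesgue (\<Union>(u, v)\<in>F. {u..v})"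
        using F by (intro measure_disjoint_intervals(1)[symmetric]) auto
      also have "\<dots> \<le> measure lebesgue ?W"
      proof (intro measure_mono_fmeasurable Wlm UN_least)
        show "(\<Union>(u, v)\<in>F. {u..v}) \<in> sets lebesgue" using F(1) by (intro sets.finite_UN) auto
        show "(case j of (u, v) \<Rightarrow> {u..v}) \<subseteq> ?W" if "j \<in> F" for j using F(2) that by (cases j) auto
      qed
      finally have "(\<Sum>(u, v)\<in>F. v - u) < \<delta>" using that by simp
      moreover have "\<forall>i\<in>F. c \<le> fst i \<and> fst i \<le> snd i \<and> snd i \<le> d"
      proof
        fix i assume "i \<in> F"
        then have "{fst i..snd i} \<subseteq> ?W" "fst i < snd i" using F(2) by (auto simp del: ivl_subset simp: case_prod_beta subset_eq)
        then show "c \<le> fst i \<and> fst i \<le> snd i \<and> snd i \<le> d" using that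
          by (auto simp: subset_iff dest: spec[of _ "fst i"] spec[of _ "snd i"])
      qed
      moreover have "disjoint_family_on (\<lambda>i. {fst i<..<snd i}) F"
        using F(3) greaterThanLessThan_subseteq_atLeastAtMost_iff
        unfolding disjoint_family_on_def case_prod_beta by (metis Int_mono order_refl subset_empty)
      ultimately have "(\<Sum>i\<in>F. norm (of_real (h (snd i)) - of_real (h (fst i)) :: complex)) < 1"
        using \<delta>[rule_format, of F fst snd] F(1) by (simp add: case_prod_beta)
      then have "(\<Sum>(u, v)\<in>F. \<bar>h v - h u\<bar>) < 1" by (simp add: case_prod_beta flip: of_real_diff)
      moreover have "(2 / m) * (\<Sum>(u, v)\<in>F. v - u) \<le> (\<Sum>(u, v)\<in>F. \<bar>h v - h u\<bar>)"
        unfolding sum_distrib_left using F(2) by (intro sum_mono) auto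
      moreover have "(2 / m) * (m / 2) < (2 / m) * (\<Sum>(u, v)\<in>F. v - u)"
        using F(4) \<open>m > 0\<close> by (intro mult_strict_left_mono) auto
      moreover have "(2 / m) * (m / 2) = 1" using \<open>m > 0\<close> by simp
      ultimately show False by linarith
    qed
    then show ?thesis using m(2) by simp
  qed
  show ?thesis
  proof (subst locally_negligible_alt, rule ballI)
    fix x assume x: "x \<in> S"
    define \<rho> where "\<rho> = min (\<delta> / 3) (min (x - c) (d - x))"
    have "\<rho> > 0" using \<open>\<delta> > 0\<close> S x by (auto simp: \<rho>_def)
    show "\<exists>U. openin (top_of_set S) U \<and> x \<in> U \<and> negligible U"
    proof (intro exI conjI)
      show "openin (top_of_set S) (S \<inter> {x - \<rho><..<x + \<rho>})" by (simp add: openin_open_Int)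
      show "negligible (S \<inter> {x - \<rho><..<x + \<rho>})"
        using \<open>\<rho> > 0\<close> \<open>\<delta> > 0\<close> by (intro local) (auto simp: \<rho>_def min_def)
    qed (use x \<open>\<rho> > 0\<close> in auto)
  qed
qed

text \<open>If the lower and the upper limit were different, two rationals could be put between them.\<close>

lemma bounded_not_oscillating_imp_convergent:
  fixes Q :: "'a \<Rightarrow> real"
  assumes F: "F \<noteq> bot" and bound: "eventually (\<lambda>y. \<bar>Q y\<bar> \<le> R) F"
    and osc: "\<And>p q::rat. p < q \<Longrightarrow> \<not> ((\<exists>\<^sub>F y in F. Q y < of_rat p) \<and> (\<exists>\<^sub>F y in F. of_rat q < Q y))"
  shows "\<exists>l. (Q \<longlongrightarrow> l) F"
proof -
  let ?li = "Liminf F (\<lambda>y. ereal (Q y))" and ?ls = "Limsup F (\<lambda>y. ereal (Q y))"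
  have "\<not> ?li < ?ls"
  proof
    assume "?li < ?ls"
    then obtain p q :: rat where pq: "?li < ereal (of_rat p)" "p < q" "ereal (of_rat q) < ?ls"
      using ereal_dense3 by (metis less_ereal.simps(1) of_rat_less)
    have "\<exists>\<^sub>F y in F. Q y < of_rat p"
    proof (rule ccontr)
      assume "\<not> (\<exists>\<^sub>F y in F. Q y < of_rat p)"
      then have "\<forall>\<^sub>F y in F. ereal (of_rat p) \<le> ereal (Q y)"
        by (simp add: not_frequently not_less)
      then show False using Liminf_bounded pq(1) by (metis not_less)
    qed
    moreover have "\<exists>\<^sub>F y in F. of_rat q < Q y"
    proof (rule ccontr)
      assume "\<not> (\<exists>\<^sub>F y in F. of_rat q < Q y)"
      then have "\<forall>\<^sub>F y in F. ereal (Q y) \<le> ereal (of_rat q)"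
        by (simp add: not_frequently not_less)
      then show False using Limsup_bounded pq(3) by (metis not_less)
    qed
    ultimately show False using osc[OF pq(2)] by blast
  qed
  then have eq: "?li = ?ls" using Liminf_le_Limsup[OF F] by (metis order.order_iff_strict)
  then have lim: "((\<lambda>y. ereal (Q y)) \<longlongrightarrow> ?ls) F"
    using Liminf_eq_Limsup[OF F] tendsto_iff_Liminf_eq_Limsup[OF F] by blast
  have "ereal (- R) \<le> ?li" "?ls \<le> ereal R"
    using bound by (auto intro!: Liminf_bounded Limsup_bounded elim!: eventually_mono)
  then obtain l where "?ls = ereal l" using eq by (cases ?ls) auto
  then show ?thesis using lim by auto
qed

text \<open>The difference quotient is symmetric in its two points, so difference quotients at \<open>x\<close> from either side become mean slopes of intervals with
end point \<open>x\<close>.\<close>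

lemma frequently_at_imp_Vitali_cover:
  fixes h :: "real \<Rightarrow> real"
  assumes "\<exists>\<^sub>F y in at x. P ((h y - h x) / (y - x))"
  shows "Vitali_cover {(u, v). P ((h v - h u) / (v - u))} {x}"
  unfolding Vitali_cover_def
proof (intro ballI allI impI)
  fix x' e :: real assume "x' \<in> {x}" "e > 0"
  have "\<exists>\<^sub>F y in at x. P ((h y - h x) / (y - x)) \<and> y \<noteq> x \<and> dist y x < e"
  proof (rule frequently_eventually_frequently[OF assms])
    show "\<forall>\<^sub>F y in at x. y \<noteq> x \<and> dist y x < e"
      using \<open>e > 0\<close> by (auto simp: eventually_at)
  qed
  then obtain y where y: "P ((h y - h x) / (y - x))" "y \<noteq> x" "dist y x < e"
    using frequently_ex by blast
  have swap: "(h y - h x) / (y - x) = (h x - h y) / (x - y)"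
    using minus_divide_divide[of "h x - h y" "x - y"] by simp
  show "\<exists>(u, v)\<in>{(u, v). P ((h v - h u) / (v - u))}. u < v \<and> v - u < e \<and> x' \<in> {u..v}"
  proof (cases "x < y")
    case True
    then show ?thesis
      using y \<open>x' \<in> {x}\<close> by (intro bexI[of _ "(x, y)"]) (auto simp: dist_real_def)
  next
    case False
    then show ?thesis
      using y swap \<open>x' \<in> {x}\<close> by (intro bexI[of _ "(y, x)"]) (auto simp: dist_real_def)
  qed
qed

lemma Vitali_cover_pointwise: "(\<And>x. x \<in> S \<Longrightarrow> Vitali_cover \<K> {x}) \<Longrightarrow> Vitali_cover \<K> S"
  unfolding Vitali_cover_def by blast

lemma Vitali_cover_weaken:
  assumes "Vitali_cover \<K> S" "\<And>u v. (u, v) \<in> \<K> \<Longrightarrow> u < v \<Longrightarrow> (u, v) \<in> \<K>'"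
  shows "Vitali_cover \<K>' S"
  unfolding Vitali_cover_def
proof (intro ballI allI impI)
  fix x e :: real assume "x \<in> S" "e > 0"
  with assms(1) obtain u v where "(u, v) \<in> \<K>" "u < v" "v - u < e" "x \<in> {u..v}"
    by (rule Vitali_coverE)
  then show "\<exists>(u, v)\<in>\<K>'. u < v \<and> v - u < e \<and> x \<in> {u..v}"
    using assms(2) by (intro bexI[of _ "(u, v)"]) auto
qed

lemma abs_cont_on_real_differentiable_AE:
  fixes h :: "real \<Rightarrow> real"
  assumes h: "abs_cont_on c d (\<lambda>t. of_real (h t))"
  shows "negligible {x \<in> {c<..<d}. \<not> h differentiable (at x)}"
proof -
  let ?Q = "\<lambda>x y. (h y - h x) / (y - x)"
  let ?osc = "\<lambda>p q. {x \<in> {c<..<d}. (\<exists>\<^sub>F y in at x. ?Q x y < p) \<and> (\<exists>\<^sub>F y in at x. q < ?Q x y)}"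
  let ?inf = "{x \<in> {c<..<d}. \<forall>R. \<exists>\<^sub>F y in at x. R < \<bar>?Q x y\<bar>}"
  have osc: "negligible (?osc p q)" if "p < q" for p q
  proof (rule Vitali_nested_covers_negligible[OF h _ that])
    show "Vitali_cover {(u, v). h v - h u < p * (v - u)} (?osc p q)"
    proof (rule Vitali_cover_pointwise, rule Vitali_cover_weaken)
      fix x assume "x \<in> ?osc p q"
      then show "Vitali_cover {(u, v). (h v - h u) / (v - u) < p} {x}"
        by (intro frequently_at_imp_Vitali_cover[where P="\<lambda>s. s < p"]) auto
    qed (auto simp: field_simps)
    show "Vitali_cover {(u, v). q * (v - u) < h v - h u} (?osc p q)"
    proof (rule Vitali_cover_pointwise, rule Vitali_cover_weaken)
      fix x assume "x \<in> ?osc p q"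
      then show "Vitali_cover {(u, v). q < (h v - h u) / (v - u)} {x}"
        by (intro frequently_at_imp_Vitali_cover[where P="\<lambda>s. q < s"]) auto
    qed (auto simp: field_simps)
  qed auto
  have inf: "negligible ?inf"
  proof (rule infinite_slope_negligible[OF h])
    show "Vitali_cover {(u, v). R * (v - u) < \<bar>h v - h u\<bar>} ?inf" for R
    proof (rule Vitali_cover_pointwise, rule Vitali_cover_weaken)
      fix x assume "x \<in> ?inf"
      then show "Vitali_cover {(u, v). R < \<bar>(h v - h u) / (v - u)\<bar>} {x}"
        by (intro frequently_at_imp_Vitali_cover[where P="\<lambda>s. R < \<bar>s\<bar>"]) auto
    qed (auto simp: field_simps abs_divide)
  qed auto
  have "{x \<in> {c<..<d}. \<not> h differentiable (at x)} \<subseteq>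
      ?inf \<union> (\<Union>(p, q)\<in>{(p, q). p < q}. ?osc (of_rat p) (of_rat q))"
  proof (rule subsetI, rule ccontr)
    fix x assume x: "x \<in> {x \<in> {c<..<d}. \<not> h differentiable (at x)}"
      and not: "x \<notin> ?inf \<union> (\<Union>(p, q)\<in>{(p, q). p < q}. ?osc (of_rat p) (of_rat q))"
    obtain R where "\<forall>\<^sub>F y in at x. \<bar>?Q x y\<bar> \<le> R"
      using x not by (auto simp: not_frequently not_less)
    then have "\<exists>l. (?Q x \<longlongrightarrow> l) (at x)"
      using x not by (intro bounded_not_oscillating_imp_convergent) auto
    then have "h differentiable (at x)"
      by (auto simp: real_differentiable_def has_field_derivative_iff)
    then show False using x by simp
  qed
  moreover have "negligible (?inf \<union> (\<Union>(p, q)\<in>{(p, q::rat). p < q}. ?osc (of_rat p) (of_rat q)))"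
    using inf osc by (intro negligible_Un negligible_countable_Union) (auto simp: of_rat_less)
  ultimately show ?thesis by (rule negligible_subset[rotated])
qed

lemma abs_cont_on_differentiable_AE:
  assumes f: "abs_cont_on c d f"
  shows "negligible {x \<in> {c<..<d}. \<not> f differentiable (at x)}"
proof (rule negligible_subset)
  let ?N = "\<lambda>h::real \<Rightarrow> real. {x \<in> {c<..<d}. \<not> h differentiable (at x)}"
  show "negligible (?N (\<lambda>t. Re (f t)) \<union> ?N (\<lambda>t. Im (f t)))"
    using abs_cont_on_real_differentiable_AE[OF abs_cont_on_Re[OF f]]
      abs_cont_on_real_differentiable_AE[OF abs_cont_on_Im[OF f]]
    by (rule negligible_Un)
  show "{x \<in> {c<..<d}. \<not> f differentiable (at x)} \<subseteq> ?N (\<lambda>t. Re (f t)) \<union> ?N (\<lambda>t. Im (f t))"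
  proof
    fix x assume "x \<in> {x \<in> {c<..<d}. \<not> f differentiable (at x)}"
    moreover have "f differentiable (at x)"
      if d: "(\<lambda>t. Re (f t)) differentiable (at x)" "(\<lambda>t. Im (f t)) differentiable (at x)"
    proof -
      obtain r i where "((\<lambda>t. Re (f t)) has_field_derivative r) (at x)"
          "((\<lambda>t. Im (f t)) has_field_derivative i) (at x)"
        using d unfolding real_differentiable_def by blast
      then have "(f has_vector_derivative Complex r i) (at x)"
        by (simp add: has_vector_derivative_complex_iff)
      then show ?thesis by (auto intro: differentiableI_vector)
    qed
    ultimately show "x \<in> ?N (\<lambda>t. Re (f t)) \<union> ?N (\<lambda>t. Im (f t))" by blast
  qed
qed

section \<open>Solutions of the equation with point interactions\<close>

lemma connected_einterval: "connected (einterval a b)"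
  unfolding is_interval_connected_1[symmetric] is_interval_1 einterval_def
  by (metis (mono_tags, lifting) ereal_less_eq(3) le_less_trans less_le_trans mem_Collect_eq)

lemma negligible_AE_lebesgue_on:
  assumes "AE t in lebesgue_on S. P t" "S \<in> sets lebesgue"
  shows "negligible {t \<in> S. \<not> P t}"
proof -
  have "AE t in lebesgue. t \<in> S \<longrightarrow> P t"
    using assms by (subst (asm) AE_restrict_space_iff) auto
  then obtain N where N: "{t \<in> space lebesgue. \<not> (t \<in> S \<longrightarrow> P t)} \<subseteq> N" "N \<in> null_sets lebesgue"
    unfolding eventually_ae_filter by blast
  have "{t \<in> S. \<not> P t} \<subseteq> N" using N(1) by auto
  moreover have "negligible N" using N(2) by (simp add: negligible_iff_null_sets)
  ultimately show ?thesis by (rule negligible_subset[rotated])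
qed

locale delta_points =
  fixes a b :: ereal and I :: "int set" and x :: "int \<Rightarrow> real"
  assumes points: "interaction_points a b I x"
begin

abbreviation "M \<equiv> x ` I"
abbreviation "\<Omega> \<equiv> einterval a b"

text \<open>The coupling constant as a function of position. Off the interaction points it is \<open>0\<close>, so
that a single jump relation describes solutions at every point of the interval.\<close>

definition strength :: "(int \<Rightarrow> real) \<Rightarrow> real \<Rightarrow> real" where
  "strength \<omega> c = (if c \<in> M then \<omega> (inv_into I x c) else 0)"

lemma strength_point: "n \<in> I \<Longrightarrow> strength \<omega> (x n) = \<omega> n"
  using points by (simp add: strength_def interaction_points_def)

lemma isolated:
  assumes "c \<in> \<Omega>"
  obtains \<rho> where "\<rho> > 0" "{c - \<rho>..c + \<rho>} \<subseteq> \<Omega>" "{c - \<rho>..c + \<rho>} \<inter> M \<subseteq> {c}"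
proof -
  have "\<not> c islimpt M" using points assms by (simp add: interaction_points_def)
  then obtain T where T: "open T" "c \<in> T" "\<And>y. y \<in> M \<Longrightarrow> y \<in> T \<Longrightarrow> y = c"
    unfolding islimpt_def by blast
  have "open (T \<inter> \<Omega>)" using T by (intro open_Int) auto
  then obtain e where e: "e > 0" "cball c e \<subseteq> T \<inter> \<Omega>"
    using T assms open_contains_cball by (metis IntI)
  then show thesis
    using T(3) by (intro that[of e]) (auto simp: subset_iff dist_real_def cball_eq_atLeastAtMost)
qed

lemma between: "u \<in> \<Omega> \<Longrightarrow> v \<in> \<Omega> \<Longrightarrow> {u..v} \<subseteq> \<Omega>"
  by (auto simp: einterval_def) (meson ereal_less_eq(3) less_le_trans le_less_trans)+

end

locale delta_equation = delta_points +
  fixes V :: "real \<Rightarrow> real" and K E :: real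
  assumes bounded: "\<And>t. t \<in> einterval a b \<Longrightarrow> \<bar>V t\<bar> \<le> K"
begin

abbreviation "Q \<equiv> K + \<bar>E\<bar>"
abbreviation "solution \<omega> f \<equiv> is_solution a b V I x \<omega> (complex_of_real E) f"

text \<open>The equation is stated through \<open>deriv1 (deriv1 f)\<close>, which is meaningful only where \<open>deriv1 f\<close> is differentiable;
this holds almost everywhere by absolute continuity.\<close>

lemma solution_off_points:
  assumes f: "solution \<omega> f" and uv: "u \<le> v" "{u..v} \<subseteq> \<Omega> - M"
  shows "\<And>t. t \<in> {u..v} \<Longrightarrow> (f has_vector_derivative deriv1 f t) (at t)"
    and "abs_cont_on u v f" "abs_cont_on u v (deriv1 f)"
    and "\<exists>N. negligible N \<and> (\<forall>t\<in>{u..v} - N. (deriv1 f has_vector_derivative of_real (V t - E) * f t) (at t))"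
proof -
  have reg: "\<And>t. t \<in> \<Omega> - M \<Longrightarrow> f differentiable (at t)"
      "loc_abs_cont (\<Omega> - M) f" "loc_abs_cont (\<Omega> - M) (deriv1 f)"
    and ae: "AE t in lebesgue_on \<Omega>. tau V f t - complex_of_real E * f t = 0"
    using f by (auto simp: is_solution_def regular_off_points_def)
  show "(f has_vector_derivative deriv1 f t) (at t)" if "t \<in> {u..v}" for t
    using reg(1)[of t] that uv by (auto simp: deriv1_def vector_derivative_works)
  show ac: "abs_cont_on u v f" "abs_cont_on u v (deriv1 f)"
    using reg(2,3) uv by (auto simp: loc_abs_cont_def)
  let ?N1 = "{t \<in> \<Omega>. \<not> tau V f t - complex_of_real E * f t = 0}"
  let ?N2 = "{t \<in> {u<..<v}. \<not> deriv1 f differentiable (at t)}"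
  let ?N = "?N1 \<union> ?N2 \<union> {u, v}"
  have "negligible ?N"
    using negligible_AE_lebesgue_on[OF ae] abs_cont_on_differentiable_AE[OF ac(2)]
    by (intro negligible_Un) auto
  moreover have "(deriv1 f has_vector_derivative of_real (V t - E) * f t) (at t)" if t: "t \<in> {u..v} - ?N" for t
  proof -
    have "deriv1 f differentiable (at t)" using t by auto
    then have "(deriv1 f has_vector_derivative deriv1 (deriv1 f) t) (at t)"
      unfolding deriv1_def[of "deriv1 f"] by (simp add: vector_derivative_works)
    moreover have "t \<in> \<Omega>" using t uv by blast
    then have "tau V f t - complex_of_real E * f t = 0" using t by blast
    then have "deriv1 (deriv1 f) t = of_real (V t - E) * f t"
      by (simp add: tau_def algebra_simps)
    ultimately show ?thesis by simp
  qed
  ultimately show "\<exists>N. negligible N \<and> (\<forall>t\<in>{u..v} - N. (deriv1 f has_vector_derivative of_real (V t - E) * f t) (at t))"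
    by blast
qed

lemma interval_off_points:
  assumes "c \<in> \<Omega> - M"
  obtains u v where "u < c" "c < v" "{u..v} \<subseteq> \<Omega> - M"
proof -
  obtain \<rho> where "\<rho> > 0" "{c - \<rho>..c + \<rho>} \<subseteq> \<Omega>" "{c - \<rho>..c + \<rho>} \<inter> M \<subseteq> {c}"
    using isolated[of c] assms by auto
  then show thesis using assms by (intro that[of "c - \<rho>" "c + \<rho>"]) auto
qed

lemma deriv1_continuous_off_points:
  assumes f: "solution \<omega> f" and c: "c \<in> \<Omega> - M"
  shows "isCont f c" "isCont (deriv1 f) c"
proof -
  obtain u v where uv: "u < c" "c < v" "{u..v} \<subseteq> \<Omega> - M"
    using interval_off_points[OF c] .
  have "continuous_on {u..v} f" "continuous_on {u..v} (deriv1 f)"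
    using solution_off_points[OF f _ uv(3)] uv by (auto intro: abs_cont_on_imp_continuous_on)
  then show "isCont f c" "isCont (deriv1 f) c"
    using uv by (auto intro: continuous_on_interior)
qed

text \<open>Taking the left limit at every point, including the interaction points, makes the Wronskian a function on the whole interval
with an explicit jump.\<close>

definition left_deriv :: "(real \<Rightarrow> complex) \<Rightarrow> real \<Rightarrow> complex" where
  "left_deriv f c = Lim (at_left c) (deriv1 f)"

lemma solution_at:
  assumes f: "solution \<omega> f" and c: "c \<in> \<Omega>"
  shows "isCont f c"
    and "(deriv1 f \<longlongrightarrow> left_deriv f c) (at_left c)"
    and "(deriv1 f \<longlongrightarrow> left_deriv f c + of_real (strength \<omega> c) * f c) (at_right c)"
proof -
  have "isCont f c \<and> (\<exists>l r. (deriv1 f \<longlongrightarrow> l) (at_left c) \<and> (deriv1 f \<longlongrightarrow> r) (at_right c) \<and>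
            r - l = of_real (strength \<omega> c) * f c)"
  proof (cases "c \<in> M")
    case True
    then obtain n where n: "n \<in> I" "c = x n" by blast
    then show ?thesis
      using f strength_point[OF n(1), of \<omega>] unfolding is_solution_def jump_conditions_def
      by (auto simp: isCont_def filterlim_at_split)
  next
    case False
    then show ?thesis
      using deriv1_continuous_off_points[OF f, of c] c
      by (auto simp: strength_def isCont_def filterlim_at_split)
  qed
  then obtain l r where lr: "isCont f c" "(deriv1 f \<longlongrightarrow> l) (at_left c)" "(deriv1 f \<longlongrightarrow> r) (at_right c)"
    "r - l = of_real (strength \<omega> c) * f c" by blast
  have "left_deriv f c = l"
    unfolding left_deriv_def using lr(2) by (intro tendsto_Lim) auto
  moreover have "r = l + of_real (strength \<omega> c) * f c" using lr(4) by (simp add: algebra_simps)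
  ultimately show "isCont f c" "(deriv1 f \<longlongrightarrow> left_deriv f c) (at_left c)"
    "(deriv1 f \<longlongrightarrow> left_deriv f c + of_real (strength \<omega> c) * f c) (at_right c)"
    using lr by auto
qed

lemma left_deriv_off_points:
  assumes f: "solution \<omega> f" and c: "c \<in> \<Omega> - M"
  shows "left_deriv f c = deriv1 f c"
  using deriv1_continuous_off_points(2)[OF assms]
  unfolding left_deriv_def by (intro tendsto_Lim) (auto simp: isCont_def filterlim_at_split)

lemma solution_continuous_on:
  assumes "solution \<omega> f" "S \<subseteq> \<Omega>"
  shows "continuous_on S f"
  using solution_at(1)[OF assms(1)] assms(2) by (meson continuous_at_imp_continuous_on subsetD)

definition wronskian :: "(real \<Rightarrow> complex) \<Rightarrow> (real \<Rightarrow> complex) \<Rightarrow> real \<Rightarrow> complex" where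
  "wronskian f g c = f c * left_deriv g c - left_deriv f c * g c"

text \<open>Its derivative \<open>f g'' - f'' g\<close> vanishes almost everywhere, because both functions satisfy the same
equation \<open>u'' = (V - E) u\<close>.\<close>

lemma wronskian_off_points:
  assumes f: "solution \<omega>\<^sub>1 f" and g: "solution \<omega>\<^sub>2 g" and uv: "u \<le> v" "{u..v} \<subseteq> \<Omega> - M"
  shows "wronskian f g v = wronskian f g u"
proof -
  let ?W = "\<lambda>t. f t * deriv1 g t - deriv1 f t * g t"
  note F = solution_off_points[OF f uv] and G = solution_off_points[OF g uv]
  obtain N1 N2 where N: "negligible N1" "negligible N2"
    "\<And>t. t \<in> {u..v} - N1 \<Longrightarrow> (deriv1 f has_vector_derivative of_real (V t - E) * f t) (at t)"
    "\<And>t. t \<in> {u..v} - N2 \<Longrightarrow> (deriv1 g has_vector_derivative of_real (V t - E) * g t) (at t)"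
    using F(4) G(4) by blast
  have "norm (?W v - ?W u) \<le> 0 * (v - u)"
  proof (rule abs_cont_on_increment_le[OF uv(1), where N="N1 \<union> N2" and f'="\<lambda>_. 0"])
    show "abs_cont_on u v ?W"
      using F G by (intro abs_cont_on_diff abs_cont_on_mult)
    show "negligible (N1 \<union> N2)" using N by (intro negligible_Un)
    fix t assume t: "t \<in> {u..v} - (N1 \<union> N2)"
    have "(?W has_vector_derivative (f t * (of_real (V t - E) * g t) + deriv1 f t * deriv1 g t)
        - (deriv1 f t * deriv1 g t + (of_real (V t - E) * f t) * g t)) (at t)"
      using t by (intro has_vector_derivative_diff has_vector_derivative_mult F(1) G(1) N(3,4)) auto
    then show "(?W has_vector_derivative 0) (at t) \<and> norm (0 :: complex) \<le> 0" by (simp add: algebra_simps)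
  qed simp
  then have "?W v = ?W u" by simp
  moreover have "u \<in> \<Omega> - M" "v \<in> \<Omega> - M" using uv by auto
  ultimately show ?thesis
    unfolding wronskian_def using left_deriv_off_points[OF f] left_deriv_off_points[OF g] by simp
qed

lemma wronskian_near:
  assumes f: "solution \<omega>\<^sub>1 f" and g: "solution \<omega>\<^sub>2 g" and c: "c \<in> \<Omega>"
  obtains \<rho> where "\<rho> > 0" "\<And>y. y \<in> {c - \<rho><..c} \<Longrightarrow> wronskian f g y = wronskian f g c"
    "\<And>y. y \<in> {c<..<c + \<rho>} \<Longrightarrow> wronskian f g y =
        wronskian f g c + of_real (strength \<omega>\<^sub>2 c - strength \<omega>\<^sub>1 c) * (f c * g c)"
proof -
  obtain \<rho> where \<rho>: "\<rho> > 0" "{c - \<rho>..c + \<rho>} \<subseteq> \<Omega>" "{c - \<rho>..c + \<rho>} \<inter> M \<subseteq> {c}"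
    using isolated[OF c] .
  have off: "{c - \<rho>..c + \<rho>} - {c} \<subseteq> \<Omega> - M" using \<rho> by blast
  let ?w = "\<lambda>t. f t * deriv1 g t - deriv1 f t * g t"
  have w: "?w y = wronskian f g y" if "y \<in> {c - \<rho>..c + \<rho>}" "y \<noteq> c" for y
  proof -
    have "y \<in> \<Omega> - M" using that \<rho> by blast
    then show ?thesis
      unfolding wronskian_def using left_deriv_off_points[OF f] left_deriv_off_points[OF g] by simp
  qed
  have fc: "(f \<longlongrightarrow> f c) (at_left c)" "(f \<longlongrightarrow> f c) (at_right c)"
       "(g \<longlongrightarrow> g c) (at_left c)" "(g \<longlongrightarrow> g c) (at_right c)"
    using solution_at(1)[OF f c] solution_at(1)[OF g c] by (auto simp: isCont_def filterlim_at_split)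
  have left: "wronskian f g y = wronskian f g c" if y: "y \<in> {c - \<rho><..<c}" for y
  proof -
    have "(?w \<longlongrightarrow> wronskian f g c) (at_left c)"
      unfolding wronskian_def by (intro tendsto_intros fc solution_at(2)[OF f c] solution_at(2)[OF g c])
    moreover have "(?w \<longlongrightarrow> wronskian f g y) (at_left c)"
    proof (rule tendsto_eventually)
      have "\<forall>\<^sub>F z in at_left c. z \<in> {y<..<c}" using y by (intro eventually_at_leftI[of y]) auto
      then show "\<forall>\<^sub>F z in at_left c. ?w z = wronskian f g y"
      proof eventually_elim
        case (elim z)
        have "{y..z} \<subseteq> {c - \<rho>..c + \<rho>} - {c}" using y elim \<rho>(1) by auto
        then have "wronskian f g z = wronskian f g y"
          using wronskian_off_points[OF f g, of y z] off elim by simp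
        then show ?case
          using w[of z] y elim \<rho>(1) by simp
      qed
    qed
    ultimately have "wronskian f g c = wronskian f g y"
      by (rule tendsto_unique[OF trivial_limit_at_left_real])
    then show ?thesis by simp
  qed
  have right: "wronskian f g y = wronskian f g c + of_real (strength \<omega>\<^sub>2 c - strength \<omega>\<^sub>1 c) * (f c * g c)"
    if y: "y \<in> {c<..<c + \<rho>}" for y
  proof -
    have "(?w \<longlongrightarrow> f c * (left_deriv g c + of_real (strength \<omega>\<^sub>2 c) * g c) -
        (left_deriv f c + of_real (strength \<omega>\<^sub>1 c) * f c) * g c) (at_right c)"
      by (intro tendsto_intros fc solution_at(3)[OF f c] solution_at(3)[OF g c])
    moreover have "(?w \<longlongrightarrow> wronskian f g y) (at_right c)"
    proof (rule tendsto_eventually)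
      have "\<forall>\<^sub>F z in at_right c. z \<in> {c<..<y}" using y by (intro eventually_at_rightI[of c y]) auto
      then show "\<forall>\<^sub>F z in at_right c. ?w z = wronskian f g y"
      proof eventually_elim
        case (elim z)
        have "{z..y} \<subseteq> {c - \<rho>..c + \<rho>} - {c}" using y elim \<rho>(1) by auto
        then have "wronskian f g y = wronskian f g z"
          using wronskian_off_points[OF f g, of z y] off elim by simp
        then show ?case
          using w[of z] y elim \<rho>(1) by simp
      qed
    qed
    ultimately have "f c * (left_deriv g c + of_real (strength \<omega>\<^sub>2 c) * g c) -
        (left_deriv f c + of_real (strength \<omega>\<^sub>1 c) * f c) * g c = wronskian f g y"
      by (rule tendsto_unique[OF trivial_limit_at_right_real])
    then show ?thesis by (simp add: wronskian_def algebra_simps)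
  qed
  show thesis
  proof (rule that[OF \<rho>(1) _ right])
    show "wronskian f g y = wronskian f g c" if "y \<in> {c - \<rho><..c}" for y
      using left[of y] that by (cases "y = c") auto
  qed
qed

lemma wronskian_constant:
  assumes f: "solution \<omega>\<^sub>1 f" and g: "solution \<omega>\<^sub>2 g" and S: "open S" "connected S" "S \<subseteq> \<Omega>"
    and same: "\<And>c. c \<in> S \<Longrightarrow> strength \<omega>\<^sub>1 c = strength \<omega>\<^sub>2 c" and cd: "c \<in> S" "d \<in> S"
  shows "wronskian f g c = wronskian f g d"
proof -
  have "wronskian f g constant_on S"
  proof (rule locally_constant_imp_constant[OF S(2)])
    fix c assume c: "c \<in> S"
    then obtain \<rho> where \<rho>: "\<rho> > 0" "\<And>y. y \<in> {c - \<rho><..c} \<Longrightarrow> wronskian f g y = wronskian f g c"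
      "\<And>y. y \<in> {c<..<c + \<rho>} \<Longrightarrow> wronskian f g y =
        wronskian f g c + of_real (strength \<omega>\<^sub>2 c - strength \<omega>\<^sub>1 c) * (f c * g c)"
      using wronskian_near[OF f g, of c] S(3) by blast
    show "\<exists>T. openin (top_of_set S) T \<and> c \<in> T \<and> (\<forall>y\<in>T. wronskian f g y = wronskian f g c)"
    proof (intro exI conjI ballI)
      show "openin (top_of_set S) (S \<inter> {c - \<rho><..<c + \<rho>})" by (simp add: openin_open_Int)
      show "c \<in> S \<inter> {c - \<rho><..<c + \<rho>}" using c \<rho>(1) by simp
      fix y assume "y \<in> S \<inter> {c - \<rho><..<c + \<rho>}"
      then show "wronskian f g y = wronskian f g c"
        using \<rho>(2)[of y] \<rho>(3)[of y] same[OF c] by (cases "y \<le> c") auto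
    qed
  qed
  then show ?thesis using cd by (auto simp: constant_on_def)
qed

end

section \<open>Short intervals and unique continuation\<close>

text \<open>The mean value theorem fails for complex values but holds for a component in a fixed direction \<open>w\<close>. It is used with \<open>w\<close>
the value of \<open>f\<close> at a maximum of \<open>\<bar>f\<bar>\<close>.\<close>

lemma MVT_direction:
  fixes f f' :: "real \<Rightarrow> complex"
  assumes "u < v" and cont: "continuous_on {u..v} f"
    and deriv: "\<And>y. y \<in> {u<..<v} \<Longrightarrow> (f has_vector_derivative f' y) (at y)"
  shows "\<exists>\<xi>\<in>{u<..<v}. Re (cnj w * (f v - f u)) = (v - u) * Re (cnj w * f' \<xi>)"
proof -
  let ?\<phi> = "\<lambda>y. Re (cnj w * f y)"
  have d: "(?\<phi> has_vector_derivative Re (cnj w * f' y)) (at y)" if "y \<in> {u<..<v}" for y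
    using deriv[OF that]
    by (intro bounded_linear.has_vector_derivative[OF bounded_linear_Re]
        bounded_linear.has_vector_derivative[OF bounded_linear_mult_right])
  obtain \<xi> where "\<xi> \<in> {u<..<v}" "?\<phi> v - ?\<phi> u = (v - u) * Re (cnj w * f' \<xi>)"
  proof (rule mvt[OF \<open>u < v\<close>, of ?\<phi> "\<lambda>y t. t * Re (cnj w * f' y)"])
    show "continuous_on {u..v} ?\<phi>" by (intro continuous_intros cont)
    fix y assume "u < y" "y < v"
    then show "(?\<phi> has_derivative (\<lambda>t. t * Re (cnj w * f' y))) (at y)"
      using d[of y] by (simp add: has_vector_derivative_def)
  qed (use that in auto)
  then show ?thesis by (auto simp: right_diff_distrib)
qed

context delta_equation
begin

text \<open>The quantitative core of the next lemmas: a slope growing linearly from zero at rate \<open>q m\<close> cannot produce the increment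
\<open>m\<close> over a length \<open>l\<close> with \<open>q l\<^sup>2 \<le> 1\<close>. The factors \<open>m\<close> are squared since the slope is that of the component in the
direction of a vector of length \<open>m\<close>.\<close>

lemma increment_estimate:
  fixes m q d l r :: real
  assumes "m > 0" "q \<ge> 0" "0 \<le> d" "d < l" "q * l\<^sup>2 \<le> 1" "r \<le> m * (q * m * d)"
  shows "r * l < m\<^sup>2"
proof -
  have "r * l \<le> m * (q * m * d) * l" using assms by (intro mult_right_mono) auto
  also have "\<dots> = m\<^sup>2 * (q * (d * l))" by (simp add: power2_eq_square algebra_simps)
  also have "\<dots> < m\<^sup>2"
  proof (cases "q = 0")
    case False
    have "q * (d * l) < q * (l * l)" using False assms by (intro mult_strict_left_mono mult_strict_right_mono) auto
    then have "q * (d * l) < 1" using assms(5) by (simp add: power2_eq_square)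
    then show ?thesis using \<open>m > 0\<close> by simp
  qed (use \<open>m > 0\<close> in simp)
  finally show ?thesis .
qed

lemma deriv1_Lipschitz:
  assumes f: "solution \<omega> f" and uv: "u \<le> v" "{u..v} \<subseteq> \<Omega> - M"
    and m: "\<And>t. t \<in> {u..v} \<Longrightarrow> norm (f t) \<le> m"
  shows "norm (deriv1 f v - deriv1 f u) \<le> Q * m * (v - u)"
proof -
  note F = solution_off_points[OF f uv]
  obtain N where N: "negligible N" "\<And>t. t \<in> {u..v} - N \<Longrightarrow> (deriv1 f has_vector_derivative of_real (V t - E) * f t) (at t)"
    using F(4) by blast
  have VQ: "\<bar>V t - E\<bar> \<le> Q" if "t \<in> {u..v}" for t
    using bounded[of t] that uv(2) abs_triangle_ineq4[of "V t" E] by fastforce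
  have "0 \<le> m" "0 \<le> Q" using order_trans[OF norm_ge_zero m[of u]] order_trans[OF abs_ge_zero VQ[of u]] uv(1) by auto
  show ?thesis
  proof (rule abs_cont_on_increment_le[OF uv(1) F(3) N(1)])
    fix t assume t: "t \<in> {u..v} - N"
    have "norm (of_real (V t - E) * f t) \<le> Q * m"
      unfolding norm_mult using VQ[of t] m[of t] t \<open>0 \<le> Q\<close> by (intro mult_mono) (auto simp flip: of_real_diff)
    with N(2)[OF t] show "(deriv1 f has_vector_derivative of_real (V t - E) * f t) (at t) \<and>
        norm (of_real (V t - E) * f t) \<le> Q * m" by blast
  qed (use \<open>0 \<le> m\<close> \<open>0 \<le> Q\<close> in simp)
qed

lemma Lipschitz_at_left_end:
  assumes f: "solution \<omega> f" and uv: "u < v" "{u<..v} \<subseteq> \<Omega> - M"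
    and m: "\<And>t. t \<in> {u<..v} \<Longrightarrow> norm (f t) \<le> m" and r: "(deriv1 f \<longlongrightarrow> r) (at_right u)"
  shows "norm (deriv1 f v - r) \<le> Q * m * (v - u)"
proof (rule tendsto_le[of "at_right u"])
  show "((\<lambda>z. norm (deriv1 f v - deriv1 f z)) \<longlongrightarrow> norm (deriv1 f v - r)) (at_right u)"
    by (intro tendsto_intros r)
  show "((\<lambda>z. Q * m * (v - z)) \<longlongrightarrow> Q * m * (v - u)) (at_right u)"
    by (intro tendsto_intros)
  have "\<forall>\<^sub>F z in at_right u. z \<in> {u<..<v}" using uv(1) by (intro eventually_at_rightI[of u v]) auto
  then show "\<forall>\<^sub>F z in at_right u. norm (deriv1 f v - deriv1 f z) \<le> Q * m * (v - z)"
  proof eventually_elim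
    case (elim z)
    then have "{z..v} \<subseteq> {u<..v}" by auto
    with elim show ?case using uv m by (intro deriv1_Lipschitz[OF f]) auto
  qed
qed simp

lemma Lipschitz_at_right_end:
  assumes f: "solution \<omega> f" and uv: "u < v" "{u..<v} \<subseteq> \<Omega> - M"
    and m: "\<And>t. t \<in> {u..<v} \<Longrightarrow> norm (f t) \<le> m" and r: "(deriv1 f \<longlongrightarrow> r) (at_left v)"
  shows "norm (deriv1 f u - r) \<le> Q * m * (v - u)"
proof (rule tendsto_le[of "at_left v"])
  show "((\<lambda>z. norm (deriv1 f u - deriv1 f z)) \<longlongrightarrow> norm (deriv1 f u - r)) (at_left v)"
    by (intro tendsto_intros r)
  show "((\<lambda>z. Q * m * (z - u)) \<longlongrightarrow> Q * m * (v - u)) (at_left v)"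
    by (intro tendsto_intros)
  have "\<forall>\<^sub>F z in at_left v. z \<in> {u<..<v}" using uv(1) by (intro eventually_at_leftI[of u]) auto
  then show "\<forall>\<^sub>F z in at_left v. norm (deriv1 f u - deriv1 f z) \<le> Q * m * (z - u)"
  proof eventually_elim
    case (elim z)
    then have "{u..z} \<subseteq> {u..<v}" by auto
    with elim show ?case using uv m deriv1_Lipschitz[OF f, of u z m] by (auto simp: norm_minus_commute)
  qed
qed simp

lemma no_steep_climb:
  assumes f: "solution \<omega> f" and J: "{u<..<v} \<subseteq> \<Omega> - M" "{u..v} \<subseteq> \<Omega>" and "u < v"
    and zero: "f p = 0" and ends: "(p, z) = (u, v) \<or> (p, z) = (v, u)"
    and slow: "\<And>y. y \<in> {u<..<v} \<Longrightarrow> \<bar>Re (cnj (f z) * deriv1 f y)\<bar> * (v - u) < (norm (f z))\<^sup>2"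
  shows False
proof -
  have "\<exists>\<xi>\<in>{u<..<v}. Re (cnj (f z) * (f v - f u)) = (v - u) * Re (cnj (f z) * deriv1 f \<xi>)"
  proof (rule MVT_direction[OF \<open>u < v\<close> solution_continuous_on[OF f J(2)]])
    show "(f has_vector_derivative deriv1 f y) (at y)" if "y \<in> {u<..<v}" for y
      using solution_off_points(1)[OF f, of y y y] that J by auto
  qed
  then obtain \<xi> where \<xi>: "\<xi> \<in> {u<..<v}" "Re (cnj (f z) * (f v - f u)) = (v - u) * Re (cnj (f z) * deriv1 f \<xi>)" by blast
  have sq: "Re (cnj (f z) * f z) = (norm (f z))\<^sup>2" unfolding cmod_power2 by (simp add: power2_eq_square)
  have "\<bar>Re (cnj (f z) * (f v - f u))\<bar> = (norm (f z))\<^sup>2"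
    using ends zero sq by (auto simp: right_diff_distrib)
  then show False using \<xi> slow[OF \<xi>(1)] \<open>u < v\<close> by (simp add: abs_mult mult.commute)
qed

lemma Q_nonneg: "\<Omega> \<noteq> {} \<Longrightarrow> 0 \<le> Q"
  using bounded by fastforce

text \<open>A Lyapunov-type inequality. At a maximum \<open>z\<close> of \<open>\<bar>f\<bar>\<close>, with value \<open>m > 0\<close>, the component of \<open>f'\<close> in
the direction of \<open>f z\<close> is zero, and it changes at rate at most \<open>Q m\<close>. One of the zeros is within half
the length of the interval from \<open>z\<close>, too close for \<open>f\<close> to climb to \<open>m\<close>.\<close>

lemma no_two_zeros:
  assumes f: "solution \<omega> f" and uv: "u < v" "{u<..<v} \<subseteq> \<Omega> - M" "{u..v} \<subseteq> \<Omega>"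
    and zeros: "f u = 0" "f v = 0" and short: "Q * ((v - u) / 2)\<^sup>2 \<le> 1"
  shows "\<forall>t\<in>{u..v}. f t = 0"
proof -
  have "continuous_on {u..v} (\<lambda>t. norm (f t))"
    by (intro continuous_intros solution_continuous_on[OF f uv(3)])
  then obtain z where z: "z \<in> {u..v}" "\<And>t. t \<in> {u..v} \<Longrightarrow> norm (f t) \<le> norm (f z)"
    using continuous_attains_sup[of "{u..v}" "\<lambda>t. norm (f t)"] uv(1) by force
  define m where "m = norm (f z)"
  have "\<not> m > 0"
  proof
    assume "m > 0"
    then have zuv: "z \<in> {u<..<v}" using z(1) zeros by (auto simp: m_def less_le)
    then have zO: "z \<in> \<Omega> - M" using uv by auto
    have Q0: "0 \<le> Q" using zO by (intro Q_nonneg) auto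
    have crit: "Re (cnj (f z) * deriv1 f z) = 0"
    proof -
      let ?\<phi> = "\<lambda>y. Re (cnj (f z) * f y)"
      have "(?\<phi> has_vector_derivative Re (cnj (f z) * deriv1 f z)) (at z)"
        using solution_off_points(1)[OF f, of z z z] zO
        by (intro bounded_linear.has_vector_derivative[OF bounded_linear_Re]
            bounded_linear.has_vector_derivative[OF bounded_linear_mult_right]) auto
      then have "DERIV ?\<phi> z :> Re (cnj (f z) * deriv1 f z)"
        by (simp add: has_real_derivative_iff_has_vector_derivative)
      moreover have "0 < min (z - u) (v - z)" using zuv by simp
      moreover have "\<forall>y. \<bar>z - y\<bar> < min (z - u) (v - z) \<longrightarrow> ?\<phi> y \<le> ?\<phi> z"
      proof (intro allI impI)
        fix y assume "\<bar>z - y\<bar> < min (z - u) (v - z)"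
        then have "y \<in> {u..v}" by auto
        have "?\<phi> y \<le> norm (cnj (f z) * f y)" by (rule complex_Re_le_cmod)
        also have "\<dots> \<le> m * m" using z(2)[OF \<open>y \<in> {u..v}\<close>] \<open>m > 0\<close> by (simp add: norm_mult m_def)
        also have "\<dots> = ?\<phi> z" by (simp add: m_def cmod_power2 flip: power2_eq_square)
        finally show "?\<phi> y \<le> ?\<phi> z" .
      qed
      ultimately show ?thesis by (rule DERIV_local_max)
    qed
    have lip: "\<bar>Re (cnj (f z) * deriv1 f y)\<bar> \<le> m * (Q * m * \<bar>z - y\<bar>)" if y: "y \<in> {u<..<v}" for y
    proof -
      have "norm (deriv1 f y - deriv1 f z) \<le> Q * m * \<bar>z - y\<bar>"
      proof (cases "y \<le> z")
        case True
        moreover have "{y..z} \<subseteq> {u<..<v}" using y zuv by auto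
        moreover have "norm (f t) \<le> m" if "t \<in> {y..z}" for t
          using z(2)[of t] calculation(2) that by (force simp: m_def)
        ultimately show ?thesis
          using deriv1_Lipschitz[OF f, of y z m] uv(2) by (simp add: norm_minus_commute)
      next
        case False
        moreover have "{z..y} \<subseteq> {u<..<v}" using y zuv by auto
        moreover have "norm (f t) \<le> m" if "t \<in> {z..y}" for t
          using z(2)[of t] calculation(2) that by (force simp: m_def)
        ultimately show ?thesis
          using deriv1_Lipschitz[OF f, of z y m] uv(2) by simp
      qed
      moreover have "Re (cnj (f z) * deriv1 f y) = Re (cnj (f z) * (deriv1 f y - deriv1 f z))"
        using crit by (simp add: right_diff_distrib)
      moreover have "\<bar>Re (cnj (f z) * (deriv1 f y - deriv1 f z))\<bar> \<le> m * norm (deriv1 f y - deriv1 f z)"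
        using abs_Re_le_cmod[of "cnj (f z) * (deriv1 f y - deriv1 f z)"] by (simp add: norm_mult m_def)
      moreover have "m * norm (deriv1 f y - deriv1 f z) \<le> m * (Q * m * \<bar>z - y\<bar>)"
        using calculation(1) \<open>m > 0\<close> by (intro mult_left_mono) auto
      ultimately show ?thesis by linarith
    qed
    have slow: "\<bar>Re (cnj (f z) * deriv1 f y)\<bar> * l < m\<^sup>2"
      if y: "y \<in> {u<..<v}" "\<bar>z - y\<bar> < l" "l \<le> (v - u) / 2" for y l
    proof (rule increment_estimate[OF \<open>m > 0\<close> Q0 abs_ge_zero y(2) _ lip[OF y(1)]])
      have "l\<^sup>2 \<le> ((v - u) / 2)\<^sup>2" using y(2,3) by (intro power_mono) auto
      then have "Q * l\<^sup>2 \<le> Q * ((v - u) / 2)\<^sup>2" using Q0 by (rule mult_left_mono)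
      then show "Q * l\<^sup>2 \<le> 1" using short by linarith
    qed
    show False
    proof (cases "z - u \<le> (v - u) / 2")
      case True
      have sub: "{u<..<z} \<subseteq> {u<..<v}" "{u..z} \<subseteq> {u..v}" using zuv by auto
      show False
      proof (rule no_steep_climb[OF f, of u z u z])
        show "\<bar>Re (cnj (f z) * deriv1 f y)\<bar> * (z - u) < (norm (f z))\<^sup>2" if "y \<in> {u<..<z}" for y
          using slow[of y "z - u"] that sub True unfolding m_def by auto
      qed (use sub uv zeros zuv in auto)
    next
      case False
      have sub: "{z<..<v} \<subseteq> {u<..<v}" "{z..v} \<subseteq> {u..v}" using zuv by auto
      show False
      proof (rule no_steep_climb[OF f, of z v v z])
        show "\<bar>Re (cnj (f z) * deriv1 f y)\<bar> * (v - z) < (norm (f z))\<^sup>2" if "y \<in> {z<..<v}" for y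
          using slow[of y "v - z"] that sub False zuv unfolding m_def by (auto simp: field_simps)
      qed (use sub uv zeros zuv in auto)
    qed
  qed
  then show ?thesis using z(2) unfolding m_def by (metis linorder_not_le norm_le_zero_iff order_trans)
qed

text \<open>Uniqueness for the initial value problem on short intervals, with the starting point \<open>p\<close> at either end. The reason is the same
as for \<open>no_two_zeros\<close>, but now the slope vanishes at the zero of \<open>f\<close> instead of at the maximum.\<close>

lemma zero_if_slow_from_zero:
  assumes f: "solution \<omega> f" and uv: "u < v" "{u<..<v} \<subseteq> \<Omega> - M" "{u..v} \<subseteq> \<Omega>"
    and p: "p = u \<or> p = v" "f p = 0" and short: "Q * (v - u)\<^sup>2 \<le> 1"
    and slow: "\<And>m y. \<lbrakk>\<And>t. t \<in> {u..v} \<Longrightarrow> norm (f t) \<le> m; y \<in> {u<..<v}\<rbrakk> \<Longrightarrow> norm (deriv1 f y) \<le> Q * m * \<bar>y - p\<bar>"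
  shows "\<forall>t\<in>{u..v}. f t = 0"
proof -
  have "continuous_on {u..v} (\<lambda>t. norm (f t))"
    by (intro continuous_intros solution_continuous_on[OF f uv(3)])
  then obtain z where z: "z \<in> {u..v}" "\<And>t. t \<in> {u..v} \<Longrightarrow> norm (f t) \<le> norm (f z)"
    using continuous_attains_sup[of "{u..v}" "\<lambda>t. norm (f t)"] uv(1) by force
  define m where "m = norm (f z)"
  have "\<not> m > 0"
  proof
    assume "m > 0"
    then have "z \<noteq> p" using p by (auto simp: m_def)
    have Q0: "0 \<le> Q" using uv(3) z(1) by (intro Q_nonneg) auto
    have slow': "\<bar>Re (cnj (f z) * deriv1 f y)\<bar> * \<bar>z - p\<bar> < (norm (f z))\<^sup>2"
      if y: "y \<in> {u<..<v}" "\<bar>y - p\<bar> < \<bar>z - p\<bar>" for y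
      unfolding m_def[symmetric]
    proof (rule increment_estimate[OF \<open>m > 0\<close> Q0 _ y(2)])
      have "\<bar>Re (cnj (f z) * deriv1 f y)\<bar> \<le> norm (cnj (f z) * deriv1 f y)" by (rule abs_Re_le_cmod)
      also have "\<dots> = m * norm (deriv1 f y)" by (simp add: norm_mult m_def)
      also have "\<dots> \<le> m * (Q * m * \<bar>y - p\<bar>)"
        using slow[of m y] z(2) y(1) \<open>m > 0\<close> by (intro mult_left_mono) (auto simp: m_def)
      finally show "\<bar>Re (cnj (f z) * deriv1 f y)\<bar> \<le> m * (Q * m * \<bar>y - p\<bar>)" .
      have "\<bar>z - p\<bar>\<^sup>2 \<le> (v - u)\<^sup>2" using z(1) p(1) by (intro power_mono) auto
      then have "Q * \<bar>z - p\<bar>\<^sup>2 \<le> Q * (v - u)\<^sup>2" using Q0 by (rule mult_left_mono)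
      then show "Q * \<bar>z - p\<bar>\<^sup>2 \<le> 1" using short by linarith
    qed simp
    from p(1) show False
    proof
      assume [simp]: "p = u"
      have "u < z" using z(1) \<open>z \<noteq> p\<close> by auto
      then have sub: "{u<..<z} \<subseteq> {u<..<v}" "{u..z} \<subseteq> {u..v}" using z(1) by auto
      show False
      proof (rule no_steep_climb[OF f, of u z u z])
        show "\<bar>Re (cnj (f z) * deriv1 f y)\<bar> * (z - u) < (norm (f z))\<^sup>2" if "y \<in> {u<..<z}" for y
          using slow'[of y] that sub(1) \<open>u < z\<close> by auto
      qed (use sub uv p \<open>u < z\<close> in auto)
    next
      assume [simp]: "p = v"
      have "z < v" using z(1) \<open>z \<noteq> p\<close> by auto
      then have sub: "{z<..<v} \<subseteq> {u<..<v}" "{z..v} \<subseteq> {u..v}" using z(1) by auto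
      show False
      proof (rule no_steep_climb[OF f, of z v v z])
        show "\<bar>Re (cnj (f z) * deriv1 f y)\<bar> * (v - z) < (norm (f z))\<^sup>2" if "y \<in> {z<..<v}" for y
          using slow'[of y] that sub(1) \<open>z < v\<close> by auto
      qed (use sub uv p \<open>z < v\<close> in auto)
    qed
  qed
  then show ?thesis using z(2) unfolding m_def by (metis linorder_not_le norm_le_zero_iff order_trans)
qed

lemma zero_Cauchy_data_right:
  assumes f: "solution \<omega> f" and uv: "u < v" "{u<..<v} \<subseteq> \<Omega> - M" "{u..v} \<subseteq> \<Omega>"
    and zero: "f u = 0" "(deriv1 f \<longlongrightarrow> 0) (at_right u)" and short: "Q * (v - u)\<^sup>2 \<le> 1"
  shows "\<forall>t\<in>{u..v}. f t = 0"
proof (rule zero_if_slow_from_zero[OF f uv _ zero(1) short])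
  fix m y assume m: "\<And>t. t \<in> {u..v} \<Longrightarrow> norm (f t) \<le> m" and y: "y \<in> {u<..<v}"
  then have "{u<..y} \<subseteq> {u<..<v}" by auto
  then have "norm (deriv1 f y - 0) \<le> Q * m * (y - u)"
    using uv y m zero by (intro Lipschitz_at_left_end[OF f]) auto
  then show "norm (deriv1 f y) \<le> Q * m * \<bar>y - u\<bar>" using y by simp
qed simp

lemma zero_Cauchy_data_left:
  assumes f: "solution \<omega> f" and uv: "u < v" "{u<..<v} \<subseteq> \<Omega> - M" "{u..v} \<subseteq> \<Omega>"
    and zero: "f v = 0" "(deriv1 f \<longlongrightarrow> 0) (at_left v)" and short: "Q * (v - u)\<^sup>2 \<le> 1"
  shows "\<forall>t\<in>{u..v}. f t = 0"
proof (rule zero_if_slow_from_zero[OF f uv _ zero(1) short])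
  fix m y assume m: "\<And>t. t \<in> {u..v} \<Longrightarrow> norm (f t) \<le> m" and y: "y \<in> {u<..<v}"
  then have "{y..<v} \<subseteq> {u<..<v}" by auto
  then have "norm (deriv1 f y - 0) \<le> Q * m * (v - y)"
    using uv y m zero by (intro Lipschitz_at_right_end[OF f]) auto
  then show "norm (deriv1 f y) \<le> Q * m * \<bar>y - v\<bar>" using y by simp
qed simp

text \<open>A uniform distance over which vanishing propagates to \<open>c\<close> and, when \<open>c\<close> is an interaction point, past it: with \<open>f c = 0\<close>
the jump of the derivative is zero, whatever the strength at \<open>c\<close>.\<close>

lemma vanishing_spreads:
  assumes f: "solution \<omega> f" and c: "c \<in> \<Omega>"
  shows "\<exists>\<rho>>0. \<forall>y\<in>{c - \<rho><..<c + \<rho>}. (\<forall>\<^sub>F t in nhds y. f t = 0) \<longrightarrow> (\<forall>\<^sub>F t in nhds c. f t = 0)"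
proof -
  obtain \<rho>0 where \<rho>0: "\<rho>0 > 0" "{c - \<rho>0..c + \<rho>0} \<subseteq> \<Omega>" "{c - \<rho>0..c + \<rho>0} \<inter> M \<subseteq> {c}"
    using isolated[OF c] .
  have Q0: "0 \<le> Q" using c by (intro Q_nonneg) auto
  \<comment> \<open>the second bound makes \<open>Q l\<^sup>2 \<le> 1\<close> for all lengths \<open>l \<le> \<rho>\<close>\<close>
  define \<rho> where "\<rho> = min \<rho>0 (1 / (Q + 1))"
  have "\<rho> > 0" using \<rho>0(1) Q0 by (simp add: \<rho>_def)
  have "\<rho> \<le> \<rho>0" by (simp add: \<rho>_def)
  have sub: "{c - \<rho>..c + \<rho>} \<subseteq> \<Omega>" "{c - \<rho>..c + \<rho>} - {c} \<subseteq> \<Omega> - M"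
  proof -
    have "{c - \<rho>..c + \<rho>} \<subseteq> {c - \<rho>0..c + \<rho>0}" using \<open>\<rho> \<le> \<rho>0\<close> by auto
    then show "{c - \<rho>..c + \<rho>} \<subseteq> \<Omega>" "{c - \<rho>..c + \<rho>} - {c} \<subseteq> \<Omega> - M" using \<rho>0(2,3) by blast+
  qed
  have short: "Q * l\<^sup>2 \<le> 1" if "0 \<le> l" "l \<le> \<rho>" for l
  proof -
    have "l \<le> 1 / (Q + 1)" using that by (simp add: \<rho>_def)
    also have "\<dots> \<le> 1" using Q0 by simp
    finally have "l \<le> 1" .
    then have "l\<^sup>2 \<le> l" using that by (simp add: power2_eq_square mult_left_le)
    then have "Q * l\<^sup>2 \<le> Q * (1 / (Q + 1))"
      using \<open>l \<le> 1 / (Q + 1)\<close> Q0 by (intro mult_left_mono) auto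
    also have "\<dots> \<le> 1" using Q0 by simp
    finally show ?thesis .
  qed
  have right: "\<forall>t\<in>{c..c + \<rho>}. f t = 0" if "f c = 0" "left_deriv f c = 0"
  proof (rule zero_Cauchy_data_right[OF f])
    show "(deriv1 f \<longlongrightarrow> 0) (at_right c)" using solution_at(3)[OF f c] that by simp
    have "{c<..<c + \<rho>} \<subseteq> {c - \<rho>..c + \<rho>} - {c}" "{c..c + \<rho>} \<subseteq> {c - \<rho>..c + \<rho>}" using \<open>\<rho> > 0\<close> by auto
    then show "{c<..<c + \<rho>} \<subseteq> \<Omega> - M" "{c..c + \<rho>} \<subseteq> \<Omega>" using sub by blast+
  qed (use that \<open>\<rho> > 0\<close> short in auto)
  have left: "\<forall>t\<in>{c - \<rho>..c}. f t = 0" if "f c = 0" "left_deriv f c = 0"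
  proof (rule zero_Cauchy_data_left[OF f])
    show "(deriv1 f \<longlongrightarrow> 0) (at_left c)" using solution_at(2)[OF f c] that by simp
    have "{c - \<rho><..<c} \<subseteq> {c - \<rho>..c + \<rho>} - {c}" "{c - \<rho>..c} \<subseteq> {c - \<rho>..c + \<rho>}" using \<open>\<rho> > 0\<close> by auto
    then show "{c - \<rho><..<c} \<subseteq> \<Omega> - M" "{c - \<rho>..c} \<subseteq> \<Omega>" using sub by blast+
  qed (use that \<open>\<rho> > 0\<close> short in auto)
  have near: "\<forall>\<^sub>F t in nhds c. f t = 0" if "f c = 0" "left_deriv f c = 0"
  proof -
    have "\<forall>\<^sub>F t in nhds c. t \<in> {c - \<rho><..<c + \<rho>}" using \<open>\<rho> > 0\<close> by (intro eventually_nhds_in_open) auto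
    then show ?thesis
      by eventually_elim (use left[OF that] right[OF that] in force)
  qed
  have deriv0: "(deriv1 f \<longlongrightarrow> 0) (at y)" if "\<forall>\<^sub>F t in nhds y. f t = 0" for y
  proof (rule tendsto_eventually)
    have "\<forall>\<^sub>F s in nhds y. \<forall>\<^sub>F t in nhds s. f t = 0" using that by (simp add: eventually_eventually)
    then have "\<forall>\<^sub>F s in nhds y. deriv1 f s = 0"
    proof eventually_elim
      case (elim s)
      have "(f has_vector_derivative 0) (at s)"
        using elim has_vector_derivative_cong_ev[of UNIV f "\<lambda>_. 0" s 0]
        by (auto dest: eventually_nhds_x_imp_x)
      then show ?case unfolding deriv1_def by (rule vector_derivative_at)
    qed
    then show "\<forall>\<^sub>F s in at y. deriv1 f s = 0" by (simp add: eventually_nhds_conv_at)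
  qed
  show ?thesis
  proof (intro exI[of _ \<rho>] conjI \<open>\<rho> > 0\<close> ballI impI)
    fix y assume y: "y \<in> {c - \<rho><..<c + \<rho>}" and Z: "\<forall>\<^sub>F t in nhds y. f t = 0"
    have fy: "f y = 0" using Z by (rule eventually_nhds_x_imp_x)
    have dy: "(deriv1 f \<longlongrightarrow> 0) (at_left y)" "(deriv1 f \<longlongrightarrow> 0) (at_right y)"
      using deriv0[OF Z] by (auto simp: filterlim_at_split)
    consider "y = c" | "y < c" | "c < y" by linarith
    then show "\<forall>\<^sub>F t in nhds c. f t = 0"
    proof cases
      case 1
      then show ?thesis using Z by simp
    next
      case 2
      have "{y<..<c} \<subseteq> {c - \<rho>..c + \<rho>} - {c}" "{y..c} \<subseteq> {c - \<rho>..c + \<rho>}" using y 2 \<open>\<rho> > 0\<close> by auto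
      then have o: "{y<..<c} \<subseteq> \<Omega> - M" "{y..c} \<subseteq> \<Omega>" using sub by blast+
      have zero: "\<forall>t\<in>{y..c}. f t = 0"
        by (rule zero_Cauchy_data_right[OF f 2 o fy dy(2)]) (use y 2 short in auto)
      have "(deriv1 f \<longlongrightarrow> 0) (at_left c)"
      proof (rule tendsto_eventually)
        have "\<forall>\<^sub>F s in at_left c. s \<in> {y<..<c}" using 2 by (intro eventually_at_leftI[of y]) auto
        then show "\<forall>\<^sub>F s in at_left c. deriv1 f s = 0"
        proof eventually_elim
          case (elim s)
          then have "\<forall>\<^sub>F t in nhds s. t \<in> {y<..<c}" by (intro eventually_nhds_in_open) auto
          then have "\<forall>\<^sub>F t in nhds s. f t = 0" by eventually_elim (use zero in auto)
          then have "(deriv1 f \<longlongrightarrow> 0) (at s)" by (rule deriv0)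
          moreover have "isCont (deriv1 f) s" using elim o by (intro deriv1_continuous_off_points[OF f]) auto
          ultimately show ?case by (metis LIM_unique isCont_def)
        qed
      qed
      then have "left_deriv f c = 0"
        using solution_at(2)[OF f c] tendsto_unique[OF trivial_limit_at_left_real] by blast
      then show ?thesis using near zero 2 by auto
    next
      case 3
      have "{c<..<y} \<subseteq> {c - \<rho>..c + \<rho>} - {c}" "{c..y} \<subseteq> {c - \<rho>..c + \<rho>}" using y 3 \<open>\<rho> > 0\<close> by auto
      then have o: "{c<..<y} \<subseteq> \<Omega> - M" "{c..y} \<subseteq> \<Omega>" using sub by blast+
      have zero: "\<forall>t\<in>{c..y}. f t = 0"
        by (rule zero_Cauchy_data_left[OF f 3 o fy dy(1)]) (use y 3 short in auto)
      have "(deriv1 f \<longlongrightarrow> 0) (at_right c)"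
      proof (rule tendsto_eventually)
        have "\<forall>\<^sub>F s in at_right c. s \<in> {c<..<y}" using 3 by (intro eventually_at_rightI[of c y]) auto
        then show "\<forall>\<^sub>F s in at_right c. deriv1 f s = 0"
        proof eventually_elim
          case (elim s)
          then have "\<forall>\<^sub>F t in nhds s. t \<in> {c<..<y}" by (intro eventually_nhds_in_open) auto
          then have "\<forall>\<^sub>F t in nhds s. f t = 0" by eventually_elim (use zero in auto)
          then have "(deriv1 f \<longlongrightarrow> 0) (at s)" by (rule deriv0)
          moreover have "isCont (deriv1 f) s" using elim o by (intro deriv1_continuous_off_points[OF f]) auto
          ultimately show ?case by (metis LIM_unique isCont_def)
        qed
      qed
      moreover have fc: "f c = 0" using zero 3 by auto
      ultimately have "left_deriv f c = 0"
        using solution_at(3)[OF f c] tendsto_unique[OF trivial_limit_at_right_real] by fastforce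
      then show ?thesis using near fc by auto
    qed
  qed
qed

text \<open>By \<open>vanishing_spreads\<close>, vanishing near a point is a locally constant property on a connected set.\<close>

lemma unique_continuation:
  assumes f: "solution \<omega> f" and "y \<in> \<Omega>" "\<forall>\<^sub>F t in nhds y. f t = 0" and "c \<in> \<Omega>"
  shows "f c = 0"
proof -
  let ?Z = "\<lambda>c. \<forall>\<^sub>F t in nhds c. f t = 0"
  have "?Z constant_on \<Omega>"
  proof (rule locally_constant_imp_constant[OF connected_einterval])
    fix c assume c: "c \<in> \<Omega>"
    obtain \<rho> where \<rho>: "\<rho> > 0" "\<forall>y\<in>{c - \<rho><..<c + \<rho>}. ?Z y \<longrightarrow> ?Z c"
      using vanishing_spreads[OF f c] by blast
    show "\<exists>T. openin (top_of_set \<Omega>) T \<and> c \<in> T \<and> (\<forall>y\<in>T. ?Z y = ?Z c)"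
    proof (cases "?Z c")
      case True
      then have "\<forall>\<^sub>F y in nhds c. ?Z y" by (simp add: eventually_eventually)
      then obtain U where U: "open U" "c \<in> U" "\<forall>y\<in>U. ?Z y"
        unfolding eventually_nhds[of _ c] by blast
      then show ?thesis
        using True c by (intro exI[of _ "\<Omega> \<inter> U"]) (auto simp: openin_open_Int)
    next
      case False
      show ?thesis
      proof (intro exI[of _ "\<Omega> \<inter> {c - \<rho><..<c + \<rho>}"] conjI)
        show "openin (top_of_set \<Omega>) (\<Omega> \<inter> {c - \<rho><..<c + \<rho>})" by (simp add: openin_open_Int)
        show "c \<in> \<Omega> \<inter> {c - \<rho><..<c + \<rho>}" using \<rho>(1) c by simp
        show "\<forall>y\<in>\<Omega> \<inter> {c - \<rho><..<c + \<rho>}. ?Z y = ?Z c" using \<rho>(2) False by blast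
      qed
    qed
  qed
  then have "?Z c" using assms unfolding constant_on_def by blast
  then show ?thesis by (rule eventually_nhds_x_imp_x)
qed

end

section \<open>The Wronskian of two eigenfunctions at the end points\<close>

lemma einterval_split:
  assumes "s \<in> einterval a b"
  shows "einterval a (ereal s) \<subseteq> einterval a b" "einterval (ereal s) b \<subseteq> einterval a b"
  using assms unfolding einterval_def by (blast intro: order.strict_trans)+

lemma L2_on_subset:
  assumes "L2_on S f" "T \<subseteq> S" "S \<in> sets lebesgue" "T \<in> sets lebesgue"
  shows "L2_on T f"
proof -
  have "integrable lebesgue (\<lambda>t. indicator S t *\<^sub>R (norm (f t))\<^sup>2)"
    using assms by (simp add: L2_on_def integrable_restrict_space)
  then have "integrable lebesgue (\<lambda>t. indicator T t *\<^sub>R (indicator S t *\<^sub>R (norm (f t))\<^sup>2))"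
    by (rule integrable_mult_indicator[OF assms(4)])
  also have "(\<lambda>t. indicator T t *\<^sub>R (indicator S t *\<^sub>R (norm (f t))\<^sup>2)) = (\<lambda>t. indicator T t *\<^sub>R (norm (f t))\<^sup>2)"
    using assms(2) by (auto simp: indicator_def fun_eq_iff)
  finally have "integrable (lebesgue_on T) (\<lambda>t. (norm (f t))\<^sup>2)"
    using assms(4) by (simp add: integrable_restrict_space)
  moreover have "f \<in> borel_measurable (lebesgue_on T)"
    using assms(1,2) unfolding L2_on_def by (blast intro: measurable_restrict_mono)
  ultimately show ?thesis by (simp add: L2_on_def)
qed

lemma L2_on_linear_combination:
  assumes f: "L2_on S f" and g: "L2_on S g" and h: "\<And>t. t \<in> S \<Longrightarrow> h t = \<alpha> * f t + \<beta> * g t"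
  shows "L2_on S h"
proof -
  let ?k = "\<lambda>t. \<alpha> * f t + \<beta> * g t"
  have [measurable]: "f \<in> borel_measurable (lebesgue_on S)" "g \<in> borel_measurable (lebesgue_on S)"
    using f g by (auto simp: L2_on_def)
  have "integrable (lebesgue_on S) (\<lambda>t. (norm (?k t))\<^sup>2)"
  proof (rule Bochner_Integration.integrable_bound)
    show "integrable (lebesgue_on S) (\<lambda>t. 2 * (norm \<alpha>)\<^sup>2 * (norm (f t))\<^sup>2 + 2 * (norm \<beta>)\<^sup>2 * (norm (g t))\<^sup>2)"
      using f g by (auto simp: L2_on_def)
    show "(\<lambda>t. (norm (?k t))\<^sup>2) \<in> borel_measurable (lebesgue_on S)" by measurable
    have "(norm (?k t))\<^sup>2 \<le> 2 * (norm \<alpha>)\<^sup>2 * (norm (f t))\<^sup>2 + 2 * (norm \<beta>)\<^sup>2 * (norm (g t))\<^sup>2" for t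
    proof -
      have "(norm (?k t))\<^sup>2 \<le> (norm \<alpha> * norm (f t) + norm \<beta> * norm (g t))\<^sup>2"
        using norm_triangle_ineq[of "\<alpha> * f t" "\<beta> * g t"] by (intro power_mono) (auto simp: norm_mult)
      also have "\<dots> \<le> 2 * (norm \<alpha> * norm (f t))\<^sup>2 + 2 * (norm \<beta> * norm (g t))\<^sup>2"
        using sum_squares_bound[of "norm \<alpha> * norm (f t)" "norm \<beta> * norm (g t)"] by (simp add: power2_sum)
      finally show ?thesis by (simp add: power_mult_distrib)
    qed
    then show "AE t in lebesgue_on S. norm ((norm (?k t))\<^sup>2) \<le>
        norm (2 * (norm \<alpha>)\<^sup>2 * (norm (f t))\<^sup>2 + 2 * (norm \<beta>)\<^sup>2 * (norm (g t))\<^sup>2)"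
      by (auto intro!: AE_I2)
  qed
  moreover have "?k \<in> borel_measurable (lebesgue_on S)" by measurable
  moreover have "h t = ?k t" if "t \<in> space (lebesgue_on S)" for t using h that by simp
  ultimately show ?thesis
    unfolding L2_on_def
    using measurable_cong[of "lebesgue_on S" h ?k borel]
      Bochner_Integration.integrable_cong[of "lebesgue_on S" "lebesgue_on S" "\<lambda>t. (norm (h t))\<^sup>2" "\<lambda>t. (norm (?k t))\<^sup>2"]
    by auto
qed

context delta_equation
begin

text \<open>The identity \<open>W(f, g) h = W(h, g) f + W(f, h) g\<close> is purely algebraic. With constant Wronskians it shows that every
solution is a combination of \<open>f\<close> and \<open>g\<close>, without any existence theorem for solutions.\<close>

lemma L2_solutions_span:
  assumes f: "solution \<omega>\<^sub>1 f" and g: "solution \<omega>\<^sub>2 g" and h: "solution \<omega>\<^sub>1 h"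
    and S: "open S" "connected S" "S \<subseteq> \<Omega>"
    and same: "\<And>c. c \<in> S \<Longrightarrow> strength \<omega>\<^sub>1 c = strength \<omega>\<^sub>2 c"
    and L2: "L2_on S f" "L2_on S g" and w: "y \<in> S" "wronskian f g y \<noteq> 0"
  shows "L2_on S h"
proof (rule L2_on_linear_combination[OF L2])
  fix t assume t: "t \<in> S"
  have "wronskian f g t = wronskian f g y" "wronskian h g t = wronskian h g y" "wronskian f h t = wronskian f h y"
    using wronskian_constant[OF f g S same t w(1)] wronskian_constant[OF h g S same t w(1)]
      wronskian_constant[OF f h S refl t w(1)] by auto
  moreover have "wronskian f g t * h t = wronskian h g t * f t + wronskian f h t * g t"
    by (simp add: wronskian_def algebra_simps)
  ultimately have "wronskian f g y * h t = wronskian h g y * f t + wronskian f h y * g t" by simp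
  then show "h t = (wronskian h g y / wronskian f g y) * f t + (wronskian f h y / wronskian f g y) * g t"
    using w(2) by (simp add: field_simps)
qed

text \<open>The pairs \<open>(u, v)\<close> and \<open>(u', v')\<close> are both orthogonal to the nonzero vector \<open>(cos \<theta>, sin \<theta>)\<close>, hence
proportional, and the limit of the Wronskian is their determinant.\<close>

lemma wronskian_zero_if_boundary_condition:
  assumes f: "solution \<omega>\<^sub>1 f" and g: "solution \<omega>\<^sub>2 g"
    and S: "open S" "connected S" "S \<subseteq> \<Omega>" and y: "y \<in> S"
    and same: "\<And>c. c \<in> S \<Longrightarrow> strength \<omega>\<^sub>1 c = strength \<omega>\<^sub>2 c"
    and F: "F \<noteq> bot" "\<forall>\<^sub>F t in F. t \<in> S - M"
    and lims: "(f \<longlongrightarrow> u) F" "(deriv1 f \<longlongrightarrow> v) F" "(g \<longlongrightarrow> u') F" "(deriv1 g \<longlongrightarrow> v') F"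
    and bc: "u * of_real (cos \<theta>) + v * of_real (sin \<theta>) = 0" "u' * of_real (cos \<theta>) + v' * of_real (sin \<theta>) = 0"
  shows "wronskian f g y = 0"
proof -
  have "((\<lambda>t. f t * deriv1 g t - deriv1 f t * g t) \<longlongrightarrow> u * v' - v * u') F"
    by (intro tendsto_intros lims)
  moreover have "((\<lambda>t. f t * deriv1 g t - deriv1 f t * g t) \<longlongrightarrow> wronskian f g y) F"
  proof (rule tendsto_eventually)
    show "\<forall>\<^sub>F t in F. f t * deriv1 g t - deriv1 f t * g t = wronskian f g y"
      using F(2)
    proof eventually_elim
      case (elim t)
      then have "t \<in> \<Omega> - M" using S(3) by blast
      then have "f t * deriv1 g t - deriv1 f t * g t = wronskian f g t"
        unfolding wronskian_def using left_deriv_off_points[OF f] left_deriv_off_points[OF g] by simp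
      also have "\<dots> = wronskian f g y" using elim y by (intro wronskian_constant[OF f g S same]) auto
      finally show ?case .
    qed
  qed
  ultimately have eq: "u * v' - v * u' = wronskian f g y" by (rule tendsto_unique[OF F(1)])
  let ?c = "complex_of_real (cos \<theta>)" and ?s = "complex_of_real (sin \<theta>)"
  have "?s * (u * v' - v * u') = u * (u' * ?c + v' * ?s) - u' * (u * ?c + v * ?s)" by (simp add: algebra_simps)
  moreover have "?c * (u * v' - v * u') = v' * (u * ?c + v * ?s) - v * (u' * ?c + v' * ?s)" by (simp add: algebra_simps)
  ultimately have "?s * (u * v' - v * u') = 0" "?c * (u * v' - v * u') = 0" using bc by simp_all
  moreover have "?s \<noteq> 0 \<or> ?c \<noteq> 0" using sin_zero_abs_cos_one[of \<theta>] by auto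
  ultimately show ?thesis using eq by auto
qed

definition eigenfunction :: "real \<Rightarrow> real \<Rightarrow> (int \<Rightarrow> real) \<Rightarrow> (real \<Rightarrow> complex) \<Rightarrow> bool" where
  "eigenfunction \<theta> \<gamma> \<omega> f \<longleftrightarrow> f \<in> H_domain a b V I x \<theta> \<gamma> \<omega> \<and> \<not> (AE t in lebesgue_on \<Omega>. f t = 0) \<and>
     (AE t in lebesgue_on \<Omega>. tau V f t = of_real E * f t)"

lemma sigma_p_iff: "of_real E \<in> sigma_p a b V I x \<theta> \<gamma> \<omega> \<longleftrightarrow> (\<exists>f. eigenfunction \<theta> \<gamma> \<omega> f)"
  by (auto simp: sigma_p_def point_spectrum_def eigenfunction_def)

lemma eigenfunctionD:
  assumes "eigenfunction \<theta> \<gamma> \<omega> f"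
  shows "solution \<omega> f" "L2_on \<Omega> f" "\<exists>c\<in>\<Omega>. f c \<noteq> 0"
    "regular_left a b V I x \<Longrightarrow> bc_left a \<theta> f" "regular_right a b V I x \<Longrightarrow> bc_right b \<gamma> f"
proof -
  have "AE t in lebesgue_on \<Omega>. tau V f t = of_real E * f t" using assms by (simp add: eigenfunction_def)
  then have "AE t in lebesgue_on \<Omega>. tau V f t - of_real E * f t = 0" by eventually_elim simp
  then show "solution \<omega> f" "L2_on \<Omega> f"
    "regular_left a b V I x \<Longrightarrow> bc_left a \<theta> f" "regular_right a b V I x \<Longrightarrow> bc_right b \<gamma> f"
    using assms by (auto simp: eigenfunction_def H_domain_def T_domain_def is_solution_def)
  show "\<exists>c\<in>\<Omega>. f c \<noteq> 0"
  proof (rule ccontr)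
    assume "\<not> (\<exists>c\<in>\<Omega>. f c \<noteq> 0)"
    then have "AE t in lebesgue_on \<Omega>. f t = 0" by (intro AE_I2) auto
    then show False using assms by (simp add: eigenfunction_def)
  qed
qed

text \<open>In the limit point case some solution is not square integrable near \<open>a\<close>, and by \<open>L2_solutions_span\<close> this excludes
a nonzero Wronskian of two square integrable solutions.\<close>

lemma wronskian_zero_left:
  assumes f: "eigenfunction \<theta> \<gamma> \<omega>\<^sub>1 f" and g: "eigenfunction \<theta> \<gamma> \<omega>\<^sub>2 g" and s: "s \<in> \<Omega>"
    and same: "\<And>c. c \<in> \<Omega> \<Longrightarrow> c < s \<Longrightarrow> strength \<omega>\<^sub>1 c = strength \<omega>\<^sub>2 c"
    and alt: "regular_left a b V I x \<or> lpc_left a b V I x \<omega>\<^sub>1"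
  shows "wronskian f g s = 0"
proof -
  note F = eigenfunctionD[OF f] and G = eigenfunctionD[OF g]
  let ?S = "einterval a (ereal s)"
  have S: "open ?S" "connected ?S" "?S \<subseteq> \<Omega>"
    using einterval_split(1)[OF s] connected_einterval by auto
  have same': "strength \<omega>\<^sub>1 c = strength \<omega>\<^sub>2 c" if "c \<in> ?S" for c
    using same that S(3) by (auto simp: einterval_def)
  obtain \<rho> where \<rho>: "\<rho> > 0" "\<And>y. y \<in> {s - \<rho><..s} \<Longrightarrow> wronskian f g y = wronskian f g s"
    using wronskian_near[OF F(1) G(1) s] by metis
  obtain \<rho>' where \<rho>': "\<rho>' > 0" "{s - \<rho>'..s + \<rho>'} \<subseteq> \<Omega>" "{s - \<rho>'..s + \<rho>'} \<inter> M \<subseteq> {s}"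
    using isolated[OF s] .
  \<comment> \<open>a point to the left of \<open>s\<close> at which the Wronskian already has its value at \<open>s\<close>\<close>
  define y where "y = s - min \<rho> \<rho>' / 2"
  have "y \<in> {s - \<rho><..s}" "y \<in> {s - \<rho>'..s + \<rho>'}" "y < s"
    using \<rho>(1) \<rho>'(1) by (auto simp: y_def min_def)
  then have y: "wronskian f g y = wronskian f g s"
    using \<rho>(2)[of y] by auto
  have "y \<in> \<Omega>" using \<open>y \<in> {s - \<rho>'..s + \<rho>'}\<close> \<rho>'(2) by blast
  then have yS: "y \<in> ?S" using \<open>y < s\<close> by (simp add: einterval_iff)
  have "wronskian f g y = 0"
  proof (cases "regular_left a b V I x")
    case True
    then obtain r where r: "a = ereal r" "\<not> r islimpt M" by (auto simp: regular_left_def)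
    have "r < s" using s r by (simp add: einterval_def)
    obtain u v where uv: "(f \<longlongrightarrow> u) (at_right r)" "(deriv1 f \<longlongrightarrow> v) (at_right r)"
      "u * of_real (cos \<theta>) + v * of_real (sin \<theta>) = 0"
      using F(4)[OF True] r by (auto simp: bc_left_def)
    obtain u' v' where uv': "(g \<longlongrightarrow> u') (at_right r)" "(deriv1 g \<longlongrightarrow> v') (at_right r)"
      "u' * of_real (cos \<theta>) + v' * of_real (sin \<theta>) = 0"
      using G(4)[OF True] r by (auto simp: bc_left_def)
    have "\<forall>\<^sub>F t in at_right r. t \<in> {r<..<s}" using \<open>r < s\<close> by (intro eventually_at_rightI[of r s]) auto
    moreover have "\<forall>\<^sub>F t in at_right r. t \<notin> M"
      using r(2) unfolding islimpt_iff_eventually by (auto intro: filter_leD[OF at_le])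
    ultimately have ev: "\<forall>\<^sub>F t in at_right r. t \<in> ?S - M"
      by eventually_elim (auto simp: r)
    show ?thesis
      by (rule wronskian_zero_if_boundary_condition[OF F(1) G(1) S yS same' _ ev uv(1,2) uv'(1,2) uv(3) uv'(3)]) auto
  next
    case False
    then obtain h where h: "solution \<omega>\<^sub>1 h" "\<not> L2_on ?S h"
      using alt s by (auto simp: lpc_left_def)
    have "L2_on ?S f" "L2_on ?S g"
      using L2_on_subset[OF F(2) S(3)] L2_on_subset[OF G(2) S(3)] by auto
    then show ?thesis
      using L2_solutions_span[OF F(1) G(1) h(1) S same' _ _ yS] h(2) by blast
  qed
  then show ?thesis using y by simp
qed

text \<open>Since \<open>wronskian\<close> uses left derivatives, its value just to the right of \<open>t\<close> includes the jump at \<open>t\<close>.\<close>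

lemma wronskian_zero_right:
  assumes f: "eigenfunction \<theta> \<gamma> \<omega>\<^sub>1 f" and g: "eigenfunction \<theta> \<gamma> \<omega>\<^sub>2 g" and t: "t \<in> \<Omega>"
    and same: "\<And>c. c \<in> \<Omega> \<Longrightarrow> t < c \<Longrightarrow> strength \<omega>\<^sub>1 c = strength \<omega>\<^sub>2 c"
    and alt: "regular_right a b V I x \<or> lpc_right a b V I x \<omega>\<^sub>1"
  shows "wronskian f g t + of_real (strength \<omega>\<^sub>2 t - strength \<omega>\<^sub>1 t) * (f t * g t) = 0"
proof -
  note F = eigenfunctionD[OF f] and G = eigenfunctionD[OF g]
  let ?S = "einterval (ereal t) b"
  have S: "open ?S" "connected ?S" "?S \<subseteq> \<Omega>"
    using einterval_split(2)[OF t] connected_einterval by auto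
  have same': "strength \<omega>\<^sub>1 c = strength \<omega>\<^sub>2 c" if "c \<in> ?S" for c
    using same that S(3) by (auto simp: einterval_def)
  obtain \<rho> where \<rho>: "\<rho> > 0" "\<And>y. y \<in> {t<..<t + \<rho>} \<Longrightarrow> wronskian f g y =
      wronskian f g t + of_real (strength \<omega>\<^sub>2 t - strength \<omega>\<^sub>1 t) * (f t * g t)"
    using wronskian_near[OF F(1) G(1) t] by metis
  obtain \<rho>' where \<rho>': "\<rho>' > 0" "{t - \<rho>'..t + \<rho>'} \<subseteq> \<Omega>" "{t - \<rho>'..t + \<rho>'} \<inter> M \<subseteq> {t}"
    using isolated[OF t] .
  define y where "y = t + min \<rho> \<rho>' / 2"
  have "y \<in> {t<..<t + \<rho>}" "y \<in> {t - \<rho>'..t + \<rho>'}" "t < y"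
    using \<rho>(1) \<rho>'(1) by (auto simp: y_def min_def)
  then have y: "wronskian f g y = wronskian f g t + of_real (strength \<omega>\<^sub>2 t - strength \<omega>\<^sub>1 t) * (f t * g t)"
    using \<rho>(2)[of y] by auto
  have "y \<in> \<Omega>" using \<open>y \<in> {t - \<rho>'..t + \<rho>'}\<close> \<rho>'(2) by blast
  then have yS: "y \<in> ?S" using \<open>t < y\<close> by (simp add: einterval_iff)
  have "wronskian f g y = 0"
  proof (cases "regular_right a b V I x")
    case True
    then obtain r where r: "b = ereal r" "\<not> r islimpt M" by (auto simp: regular_right_def)
    have "t < r" using t r by (simp add: einterval_def)
    obtain u v where uv: "(f \<longlongrightarrow> u) (at_left r)" "(deriv1 f \<longlongrightarrow> v) (at_left r)"
      "u * of_real (cos \<gamma>) + v * of_real (sin \<gamma>) = 0"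
      using F(5)[OF True] r by (auto simp: bc_right_def)
    obtain u' v' where uv': "(g \<longlongrightarrow> u') (at_left r)" "(deriv1 g \<longlongrightarrow> v') (at_left r)"
      "u' * of_real (cos \<gamma>) + v' * of_real (sin \<gamma>) = 0"
      using G(5)[OF True] r by (auto simp: bc_right_def)
    have "\<forall>\<^sub>F s in at_left r. s \<in> {t<..<r}" using \<open>t < r\<close> by (intro eventually_at_leftI[of t]) auto
    moreover have "\<forall>\<^sub>F s in at_left r. s \<notin> M"
      using r(2) unfolding islimpt_iff_eventually by (auto intro: filter_leD[OF at_le])
    ultimately have ev: "\<forall>\<^sub>F s in at_left r. s \<in> ?S - M"
      by eventually_elim (auto simp: r)
    show ?thesis
      by (rule wronskian_zero_if_boundary_condition[OF F(1) G(1) S yS same' _ ev uv(1,2) uv'(1,2) uv(3) uv'(3)]) auto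
  next
    case False
    then obtain h where h: "solution \<omega>\<^sub>1 h" "\<not> L2_on ?S h"
      using alt t by (auto simp: lpc_right_def)
    have "L2_on ?S f" "L2_on ?S g"
      using L2_on_subset[OF F(2) S(3)] L2_on_subset[OF G(2) S(3)] by auto
    then show ?thesis
      using L2_solutions_span[OF F(1) G(1) h(1) S same' _ _ yS] h(2) by blast
  qed
  then show ?thesis using y by simp
qed

end

section \<open>Null sets seen through two coordinates\<close>

lemma emeasure_PiM_insert:
  assumes M: "\<And>k. k \<in> insert i I \<Longrightarrow> prob_space (M k)"
    and S: "S \<in> sets (Pi\<^sub>M (insert i I) M)"
  shows "(\<lambda>X. emeasure (M i) {r \<in> space (M i). X(i := r) \<in> S}) \<in> borel_measurable (Pi\<^sub>M I M)" (is ?meas)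
    and "emeasure (Pi\<^sub>M (insert i I) M) S =
      (\<integral>\<^sup>+X. emeasure (M i) {r \<in> space (M i). X(i := r) \<in> S} \<partial>Pi\<^sub>M I M)" (is ?eq)
proof -
  interpret Mi: prob_space "M i" using M by simp
  interpret R: prob_space "Pi\<^sub>M I M" using M by (intro prob_space_PiM) auto
  interpret pair_sigma_finite "M i" "Pi\<^sub>M I M" ..
  let ?F = "\<lambda>(r, X). X(i := r)"
  let ?N = "M i \<Otimes>\<^sub>M Pi\<^sub>M I M"
  let ?S = "?F -` S \<inter> space ?N"
  have F: "?F \<in> measurable ?N (Pi\<^sub>M (insert i I) M)"
    by (rule measurable_fun_upd[where J=I, THEN measurable_cong[THEN iffD1, rotated]])
       (auto simp: case_prod_beta)
  have S': "?S \<in> sets ?N"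
    using measurable_sets[OF F S] .
  have slice: "(\<lambda>r. (r, X)) -` ?S = {r \<in> space (M i). X(i := r) \<in> S}"
    if "X \<in> space (Pi\<^sub>M I M)" for X
    using that by (auto simp: space_pair_measure)
  have "?meas \<longleftrightarrow> (\<lambda>X. emeasure (M i) ((\<lambda>r. (r, X)) -` ?S)) \<in> borel_measurable (Pi\<^sub>M I M)"
    using slice by (intro measurable_cong) simp
  then show ?meas
    using measurable_emeasure_Pair2[OF S'] by simp
  have "emeasure (Pi\<^sub>M (insert i I) M) S = emeasure ?N ?S"
    using distr_pair_PiM_eq_PiM[of I M i] M emeasure_distr[OF F S] by auto
  also have "\<dots> = (\<integral>\<^sup>+X. emeasure (M i) ((\<lambda>r. (r, X)) -` ?S) \<partial>Pi\<^sub>M I M)"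
    by (rule emeasure_pair_measure_alt2[OF S'])
  also have "\<dots> = (\<integral>\<^sup>+X. emeasure (M i) {r \<in> space (M i). X(i := r) \<in> S} \<partial>Pi\<^sub>M I M)"
    using slice by (intro nn_integral_cong) simp
  finally show ?eq .
qed

lemma emeasure_eq_0_if_subset_singleton:
  assumes "emeasure M {r} = 0" "{r} \<in> sets M" "A \<subseteq> {r}"
  shows "emeasure M A = 0"
  using assms by (metis emeasure_mono le_zero_eq)

text \<open>Fubini's theorem in two steps. The measure \<open>h X\<close> of the section in direction \<open>j\<close> is a function of the remaining
coordinates, and as such a measurable one; it is zero unless the coordinate \<open>i\<close> takes the
exceptional value \<open>r\<^sub>0\<close>. The exceptional values may depend on the other coordinates in a non-measurable way, which is why the
argument goes through \<open>h\<close>.\<close>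

lemma PiM_null_by_two_coordinates:
  fixes M :: "'i \<Rightarrow> 'a measure"
  assumes M: "\<And>k. k \<in> I \<Longrightarrow> prob_space (M k)"
    and atomless: "\<And>k r. k \<in> {i, j} \<Longrightarrow> {r} \<in> sets (M k) \<and> emeasure (M k) {r} = 0"
    and ij: "i \<in> I" "j \<in> I" "i \<noteq> j"
    and S: "S \<in> sets (Pi\<^sub>M I M)"
    and slices: "\<And>X. X \<in> space (Pi\<^sub>M I M) \<Longrightarrow>
       \<exists>r\<^sub>0. \<forall>r. r \<noteq> r\<^sub>0 \<longrightarrow> (\<exists>s\<^sub>0. \<forall>s. X(i := r, j := s) \<in> S \<longrightarrow> s = s\<^sub>0)"
  shows "emeasure (Pi\<^sub>M I M) S = 0"
proof -
  define I1 where "I1 = I - {j}"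
  define I2 where "I2 = I1 - {i}"
  have I1: "insert j I1 = I" and I2: "insert i I2 = I1" and notin: "i \<notin> I2" "j \<notin> I1"
    using ij by (auto simp: I1_def I2_def)
  have M1: "prob_space (M k)" if "k \<in> insert j I1" for k using M that I1 by auto
  have M2: "prob_space (M k)" if "k \<in> insert i I2" for k using M that I1 I2 by auto
  have at_i: "{r} \<in> sets (M i)" "emeasure (M i) {r} = 0"
    and at_j: "{r} \<in> sets (M j)" "emeasure (M j) {r} = 0" for r
    using atomless[of i r] atomless[of j r] by simp_all
  have S1: "S \<in> sets (Pi\<^sub>M (insert j I1) M)" using S I1 by simp
  define h where "h X = emeasure (M j) {s \<in> space (M j). X(j := s) \<in> S}" for X
  have h [measurable]: "h \<in> borel_measurable (Pi\<^sub>M I1 M)"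
    unfolding h_def by (rule emeasure_PiM_insert(1)[OF M1 S1])
  have "AE X in Pi\<^sub>M I1 M. h X = 0"
  proof -
    define T where "T = {X \<in> space (Pi\<^sub>M I1 M). h X \<noteq> 0}"
    have T: "T \<in> sets (Pi\<^sub>M (insert i I2) M)"
      unfolding T_def I2 by measurable
    have "emeasure (M i) {r \<in> space (M i). X(i := r) \<in> T} = 0" if X: "X \<in> space (Pi\<^sub>M I2 M)" for X
    proof -
      have "\<exists>r. r \<in> space (M k)" if "k \<in> I" for k
        using prob_space.not_empty[OF M[OF that]] by auto
      then obtain ri rj where r: "ri \<in> space (M i)" "rj \<in> space (M j)"
        using ij by metis
      have "X(i := ri, j := rj) \<in> space (Pi\<^sub>M I M)"
        using X r ij unfolding space_PiM I1[symmetric] I2[symmetric] by (intro PiE_fun_upd) auto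
      from slices[OF this] obtain r\<^sub>0 where
        r0: "\<And>r. r \<noteq> r\<^sub>0 \<Longrightarrow> \<exists>s\<^sub>0. \<forall>s. X(i := r, j := s) \<in> S \<longrightarrow> s = s\<^sub>0"
        using ij by (auto simp: fun_upd_twist[of j i])
      have "{r \<in> space (M i). X(i := r) \<in> T} \<subseteq> {r\<^sub>0}"
      proof
        fix r assume r: "r \<in> {r \<in> space (M i). X(i := r) \<in> T}"
        show "r \<in> {r\<^sub>0}"
        proof (rule ccontr)
          assume "r \<notin> {r\<^sub>0}"
          then obtain s\<^sub>0 where "\<forall>s. X(i := r, j := s) \<in> S \<longrightarrow> s = s\<^sub>0"
            using r0 by blast
          then have "{s \<in> space (M j). X(i := r, j := s) \<in> S} \<subseteq> {s\<^sub>0}" by blast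
          then have "h (X(i := r)) = 0"
            unfolding h_def by (rule emeasure_eq_0_if_subset_singleton[OF at_j(2,1)])
          then show False using r by (simp add: T_def)
        qed
      qed
      then show ?thesis by (rule emeasure_eq_0_if_subset_singleton[OF at_i(2,1)])
    qed
    then have "(\<integral>\<^sup>+X. emeasure (M i) {r \<in> space (M i). X(i := r) \<in> T} \<partial>Pi\<^sub>M I2 M) = 0"
      by (simp cong: nn_integral_cong)
    then have "emeasure (Pi\<^sub>M (insert i I2) M) T = 0"
      using emeasure_PiM_insert(2)[OF M2 T] by simp
    then show ?thesis
      using T by (intro AE_I[of _ _ T]) (auto simp: T_def I2)
  qed
  then have "(\<integral>\<^sup>+X. h X \<partial>Pi\<^sub>M I1 M) = 0"
    by (simp add: nn_integral_0_iff_AE[OF h])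
  then show ?thesis
    using emeasure_PiM_insert(2)[OF M1 S1] unfolding h_def I1 by simp
qed

section \<open>Eigenvalues as two strengths vary\<close>

context delta_points
begin

lemma strength_upd:
  assumes "n \<in> I"
  shows "strength (X(n := r)) c = (if c = x n then r else strength X c)"
proof (cases "c \<in> M \<and> c \<noteq> x n")
  case True
  then have "inv_into I x c \<noteq> n" using f_inv_into_f[of c x I] by auto
  then show ?thesis using True by (simp add: strength_def)
next
  case False
  then consider "c = x n" | "c \<notin> M" "c \<noteq> x n" using assms by blast
  then show ?thesis
    using strength_point[OF assms, of "X(n := r)"] by cases (simp_all add: strength_def)
qed

end

context delta_equation
begin

lemma wronskian_across_gap:
  assumes f: "solution \<omega>\<^sub>1 f" and g: "solution \<omega>\<^sub>2 g" and st: "s < t" "{s..t} \<subseteq> \<Omega>" "{s<..<t} \<inter> M = {}"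
  shows "wronskian f g t = wronskian f g s + of_real (strength \<omega>\<^sub>2 s - strength \<omega>\<^sub>1 s) * (f s * g s)"
proof -
  have "s \<in> \<Omega>" "t \<in> \<Omega>" using st by auto
  obtain \<rho> where \<rho>: "\<rho> > 0" "\<And>y. y \<in> {s<..<s + \<rho>} \<Longrightarrow> wronskian f g y =
      wronskian f g s + of_real (strength \<omega>\<^sub>2 s - strength \<omega>\<^sub>1 s) * (f s * g s)"
    using wronskian_near[OF f g \<open>s \<in> \<Omega>\<close>] by metis
  obtain \<rho>' where \<rho>': "\<rho>' > 0" "\<And>y. y \<in> {t - \<rho>'<..t} \<Longrightarrow> wronskian f g y = wronskian f g t"
    using wronskian_near[OF f g \<open>t \<in> \<Omega>\<close>] by metis
  define u where "u = s + min \<rho> (t - s) / 2"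
  define v where "v = t - min \<rho>' (t - s) / 2"
  have u: "u \<in> {s<..<s + \<rho>}" "s < u" "u < t" and v: "v \<in> {t - \<rho>'<..t}" "s < v" "v < t" and "u \<le> v"
    using \<rho>(1) \<rho>'(1) st(1) by (auto simp: u_def v_def min_def field_simps)
  have "{s<..<t} \<subseteq> {s..t}" by auto
  moreover have "{u..v} \<subseteq> {s<..<t}" using u v by auto
  ultimately have "{u..v} \<subseteq> \<Omega> - M" using st(2,3) by blast
  then have "wronskian f g v = wronskian f g u" using \<open>u \<le> v\<close> by (intro wronskian_off_points[OF f g])
  then show ?thesis using \<rho>(2)[OF u(1)] \<rho>'(2)[OF v(1)] by simp
qed

lemma eigenfunction_not_both_zero:
  assumes f: "eigenfunction \<theta> \<gamma> \<omega> f" and st: "s < t" "{s..t} \<subseteq> \<Omega>" "{s<..<t} \<inter> M = {}"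
    and short: "Q * ((t - s) / 2)\<^sup>2 \<le> 1"
  shows "f s \<noteq> 0 \<or> f t \<noteq> 0"
proof (rule ccontr)
  assume "\<not> (f s \<noteq> 0 \<or> f t \<noteq> 0)"
  then have ends: "f s = 0" "f t = 0" by auto
  note F = eigenfunctionD[OF f]
  have "{s<..<t} \<subseteq> {s..t}" by auto
  then have "{s<..<t} \<subseteq> \<Omega> - M" using st by blast
  then have zero: "\<forall>y\<in>{s..t}. f y = 0"
    using no_two_zeros[OF F(1) st(1) _ st(2) ends short] by blast
  let ?y = "(s + t) / 2"
  have "\<forall>\<^sub>F y in nhds ?y. y \<in> {s<..<t}" using st(1) by (intro eventually_nhds_in_open) auto
  then have "\<forall>\<^sub>F y in nhds ?y. f y = 0" by eventually_elim (use zero in auto)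
  moreover have "?y \<in> \<Omega>" using st by (intro subsetD[OF st(2)]) auto
  ultimately show False using F(3) unique_continuation[OF F(1)] by blast
qed

text \<open>The exceptional \<open>r\<^sub>0\<close> is the strength at \<open>x i\<close> for which some eigenfunction vanishes at \<open>x j\<close>, if there is one.
For \<open>r \<noteq> r\<^sub>0\<close> the logarithmic derivative of an eigenfunction on either side of \<open>x j\<close> is determined by the remaining data, and
so is the strength at \<open>x j\<close>.\<close>

lemma eigenvalue_section:
  assumes ij: "i \<in> I" "j \<in> I" and st: "x i < x j" "{x i<..<x j} \<inter> M = {}"
    and short: "Q * ((x j - x i) / 2)\<^sup>2 \<le> 1"
    and left: "\<And>r s. regular_left a b V I x \<or> lpc_left a b V I x (X(i := r, j := s))"
    and right: "\<And>r s. regular_right a b V I x \<or> lpc_right a b V I x (X(i := r, j := s))"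
  shows "\<exists>r\<^sub>0. \<forall>r. r \<noteq> r\<^sub>0 \<longrightarrow> (\<exists>s\<^sub>0. \<forall>s. of_real E \<in> sigma_p a b V I x \<theta> \<gamma> (X(i := r, j := s)) \<longrightarrow> s = s\<^sub>0)"
proof -
  have "i \<noteq> j" using st(1) by auto
  have O: "x i \<in> \<Omega>" "x j \<in> \<Omega>" using points ij by (auto simp: interaction_points_def)
  have sub: "{x i..x j} \<subseteq> \<Omega>" using between[OF O] .
  let ?w = "\<lambda>r s. X(i := r, j := s)"
  have str: "strength (?w r s) c = (if c = x j then s else if c = x i then r else strength X c)" for r s c
    using strength_upd[OF ij(2)] strength_upd[OF ij(1)] by simp
  have three: "of_real (r' - r) * (f (x i) * g (x i)) + of_real (s' - s) * (f (x j) * g (x j)) = (0 :: complex)"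
    "wronskian f g (x j) = of_real (r' - r) * (f (x i) * g (x i))"
    if f: "eigenfunction \<theta> \<gamma> (?w r s) f" and g: "eigenfunction \<theta> \<gamma> (?w r' s') g" for r s r' s' f g
  proof -
    note sol = eigenfunctionD(1)[OF f] eigenfunctionD(1)[OF g]
    have "wronskian f g (x i) = 0"
      using st(1) by (intro wronskian_zero_left[OF f g O(1) _ left]) (auto simp: str)
    then show W: "wronskian f g (x j) = of_real (r' - r) * (f (x i) * g (x i))"
      using wronskian_across_gap[OF sol st(1) sub st(2)] st(1) by (simp add: str)
    have "wronskian f g (x j) + of_real (strength (?w r' s') (x j) - strength (?w r s) (x j)) * (f (x j) * g (x j)) = 0"
      using st(1) by (intro wronskian_zero_right[OF f g O(2) _ right]) (auto simp: str)
    then show "of_real (r' - r) * (f (x i) * g (x i)) + of_real (s' - s) * (f (x j) * g (x j)) = 0"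
      using W by (simp add: str)
  qed
  have nz: "f (x i) \<noteq> 0 \<or> f (x j) \<noteq> 0" if "eigenfunction \<theta> \<gamma> (?w r s) f" for r s f
    using eigenfunction_not_both_zero[OF that st(1) sub st(2) short] .
  let ?D = "\<lambda>r. \<exists>s f. eigenfunction \<theta> \<gamma> (?w r s) f \<and> f (x j) = 0"
  have uniq: "r = r'" if "?D r" "?D r'" for r r'
  proof -
    obtain s f s' g where f: "eigenfunction \<theta> \<gamma> (?w r s) f" "f (x j) = 0"
      and g: "eigenfunction \<theta> \<gamma> (?w r' s') g" "g (x j) = 0"
      using \<open>?D r\<close> \<open>?D r'\<close> by blast
    have "f (x i) \<noteq> 0" "g (x i) \<noteq> 0" using nz[OF f(1)] nz[OF g(1)] f(2) g(2) by auto
    moreover have "of_real (r' - r) * (f (x i) * g (x i)) = (0 :: complex)"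
      using three(1)[OF f(1) g(1)] f(2) by simp
    ultimately show ?thesis by simp
  qed
  then obtain r\<^sub>0 where r0: "\<And>r. r \<noteq> r\<^sub>0 \<Longrightarrow> \<not> ?D r" by metis
  show ?thesis
  proof (rule exI[of _ r\<^sub>0], intro allI impI)
    fix r assume "r \<noteq> r\<^sub>0"
    have uniq': "s = s'" if f: "eigenfunction \<theta> \<gamma> (?w r s) f" and g: "eigenfunction \<theta> \<gamma> (?w r s') g" for s s' f g
    proof -
      have "f (x j) \<noteq> 0" "g (x j) \<noteq> 0" using f g r0[OF \<open>r \<noteq> r\<^sub>0\<close>] by blast+
      then show ?thesis using three(1)[OF f g] by simp
    qed
    show "\<exists>s\<^sub>0. \<forall>s. of_real E \<in> sigma_p a b V I x \<theta> \<gamma> (?w r s) \<longrightarrow> s = s\<^sub>0"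
      unfolding sigma_p_iff using uniq' by metis
  qed
qed

end

text \<open>Only finitely many interaction points lie in a compact part of the interval, so a next one exists.\<close>

lemma (in delta_points) adjacent_points:
  assumes "is_interval J" "s \<in> J \<inter> M" "t \<in> J \<inter> M" "s \<noteq> t"
  obtains i j where "i \<in> I" "j \<in> I" "x i < x j" "{x i..x j} \<subseteq> J" "{x i<..<x j} \<inter> M = {}"
proof -
  obtain u v where uv: "u \<in> J \<inter> M" "v \<in> J \<inter> M" "u < v"
    using assms(2-4) by (cases "s < t") auto
  have "u \<in> \<Omega>" "v \<in> \<Omega>" using uv points by (auto simp: interaction_points_def)
  then have sub: "{u..v} \<subseteq> \<Omega>" by (rule between)
  have "finite (M \<inter> {u..v})"
  proof (rule ccontr)
    assume "infinite (M \<inter> {u..v})"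
    then obtain c where "c \<in> {u..v}" "c islimpt (M \<inter> {u..v})"
      using Heine_Borel_imp_Bolzano_Weierstrass[OF compact_Icc, of "M \<inter> {u..v}" u v] by blast
    then have "c islimpt M" by (meson inf_le1 islimpt_subset)
    then show False using points sub \<open>c \<in> {u..v}\<close> by (auto simp: interaction_points_def)
  qed
  then have fin: "finite (M \<inter> {u<..v})" by (rule finite_subset[rotated]) auto
  define w where "w = Min (M \<inter> {u<..v})"
  have "M \<inter> {u<..v} \<noteq> {}" using uv by auto
  then have w: "w \<in> M" "u < w" "w \<le> v" "\<And>y. y \<in> M \<inter> {u<..v} \<Longrightarrow> w \<le> y"
    using Min_in[OF fin] Min_le[OF fin] unfolding w_def by auto
  obtain i j where ij: "i \<in> I" "j \<in> I" "u = x i" "w = x j" using uv(1) w(1) by blast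
  show thesis
  proof (rule that[OF ij(1,2)])
    show "x i < x j" using w(2) ij by simp
    show "{x i..x j} \<subseteq> J"
    proof
      fix y assume "y \<in> {x i..x j}"
      then have "u \<le> y" "y \<le> v" using ij w(3) by auto
      then show "y \<in> J" using assms(1) uv(1,2) unfolding is_interval_1 by blast
    qed
    show "{x i<..<x j} \<inter> M = {}"
    proof (rule ccontr)
      assume "{x i<..<x j} \<inter> M \<noteq> {}"
      then obtain y where "y \<in> M" "u < y" "y < w" unfolding ij(3,4) by (metis IntE disjoint_iff greaterThanLessThan_iff)
      then show False using w(3) w(4)[of y] by auto
    qed
  qed
qed

theorem theorem4p2:
  fixes I :: "int set" and p :: "int \<Rightarrow> real measure"
    and a b :: ereal and V :: "real \<Rightarrow> real" and x :: "int \<Rightarrow> real"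
    and \<theta> \<gamma> E K :: real and J :: "real set" and B :: "(int \<Rightarrow> real) set"
  assumes "\<And>n. n \<in> I \<Longrightarrow> continuous_prob (p n)"
    and "a < b"
    and "L1_loc (einterval a b) V"
    and "interaction_points a b I x"
    and "\<And>\<omega>. \<omega> \<in> space (Omega I p) \<Longrightarrow> regular_left a b V I x \<or> lpc_left a b V I x \<omega>"
    and "\<And>\<omega>. \<omega> \<in> space (Omega I p) \<Longrightarrow> regular_right a b V I x \<or> lpc_right a b V I x \<omega>"
    and "\<theta> \<in> {0..<pi}" and "\<gamma> \<in> {0..<pi}"
    and "\<And>t. t \<in> einterval a b \<Longrightarrow> \<bar>V t\<bar> \<le> K"
    and "K + \<bar>E\<bar> > 0"
    and "is_interval J"
    and "emeasure lborel J \<le> ennreal (2 / sqrt (K + \<bar>E\<bar>))"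
    and "\<exists>s \<in> J \<inter> x ` I. \<exists>t \<in> J \<inter> x ` I. s \<noteq> t"
    and "B \<in> sets (Omega I p)"
    and "B \<subseteq> {\<omega> \<in> space (Omega I p). complex_of_real E \<in> sigma_p a b V I x \<theta> \<gamma> \<omega>}"
  shows "emeasure (Omega I p) B = 0"
proof -
  interpret delta_equation a b I x V K E
    using assms(4,9) by unfold_locales auto
  obtain i j where ij: "i \<in> I" "j \<in> I" and lt: "x i < x j" and J: "{x i..x j} \<subseteq> J"
    and gap: "{x i<..<x j} \<inter> x ` I = {}"
    using adjacent_points[OF assms(11)] assms(13) by metis
  have short: "(K + \<bar>E\<bar>) * ((x j - x i) / 2)\<^sup>2 \<le> 1"
  proof -
    have "J \<in> sets borel" using assms(11) by (rule real_interval_borel_measurable)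
    then have "emeasure lborel {x i..x j} \<le> emeasure lborel J" using J by (intro emeasure_mono) auto
    also have "\<dots> \<le> ennreal (2 / sqrt (K + \<bar>E\<bar>))" by (rule assms(12))
    finally have "x j - x i \<le> 2 / sqrt (K + \<bar>E\<bar>)" using lt assms(10) by simp
    then have "((x j - x i) / 2)\<^sup>2 \<le> (1 / sqrt (K + \<bar>E\<bar>))\<^sup>2" using lt by (intro power_mono) auto
    also have "\<dots> = 1 / (K + \<bar>E\<bar>)" using assms(10) by (simp add: power_divide)
    finally show ?thesis using assms(10) by (simp add: field_simps)
  qed
  have P: "prob_space (p n)" "sets (p n) = sets borel" "emeasure (p n) {r} = 0" if "n \<in> I" for n r
    using assms(1)[OF that] by (auto simp: continuous_prob_def)
  have space_p: "space (p n) = UNIV" if "n \<in> I" for n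
    using sets_eq_imp_space_eq[OF P(2)[OF that]] by simp
  have spaceO: "space (Omega I p) = space (Pi\<^sub>M I p)" by (simp add: Omega_def)
  \<comment> \<open>a set in the completion has a core \<open>S\<close> in the product \<open>\<sigma>\<close>-algebra, to which Fubini's theorem applies\<close>
  obtain S N N' where S: "B = S \<union> N" "S \<in> sets (Pi\<^sub>M I p)" "N \<subseteq> N'" "N' \<in> null_sets (Pi\<^sub>M I p)"
    using assms(14) unfolding Omega_def by (rule sets_completionE)
  have "emeasure (Pi\<^sub>M I p) S = 0"
  proof (rule PiM_null_by_two_coordinates[OF P(1) _ ij _ S(2)])
    show "{r} \<in> sets (p k) \<and> emeasure (p k) {r} = 0" if "k \<in> {i, j}" for k r
      using P(2,3)[of k] ij that by auto
    show "i \<noteq> j" using lt by auto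
    fix X assume X: "X \<in> space (Pi\<^sub>M I p)"
    have "X(i := r, j := s) \<in> space (Omega I p)" for r s
      using X ij space_p unfolding spaceO space_PiM by (auto simp: PiE_iff extensional_def)
    then obtain r\<^sub>0 where r0: "\<forall>r. r \<noteq> r\<^sub>0 \<longrightarrow> (\<exists>s\<^sub>0. \<forall>s.
        of_real E \<in> sigma_p a b V I x \<theta> \<gamma> (X(i := r, j := s)) \<longrightarrow> s = s\<^sub>0)"
      using eigenvalue_section[OF ij lt gap short] assms(5,6) by metis
    have "of_real E \<in> sigma_p a b V I x \<theta> \<gamma> \<omega>" if "\<omega> \<in> S" for \<omega>
      using that S(1) assms(15) by blast
    then show "\<exists>r\<^sub>0. \<forall>r. r \<noteq> r\<^sub>0 \<longrightarrow> (\<exists>s\<^sub>0. \<forall>s. X(i := r, j := s) \<in> S \<longrightarrow> s = s\<^sub>0)"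
      using r0 by meson
  qed
  then have "S \<in> null_sets (Pi\<^sub>M I p)" using S(2) by (simp add: null_sets_def)
  then have "S \<union> N' \<in> null_sets (Pi\<^sub>M I p)" using S(4) by blast
  then have "B \<in> null_sets (completion (Pi\<^sub>M I p))"
    using S(1,3) by (intro null_sets_completion_subset[of B "S \<union> N'"]) (auto intro: null_sets_completionI)
  then show ?thesis by (simp add: Omega_def null_sets_def)
qed

end
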